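(* Let $\Omega\subset\mathbb{R}^n$ be a bounded extension domain for $W^{s,p}$, let $q\in(1,\infty)\cap(\tfrac{n}{sp},\infty)$, and let $V_0\in L^q(\Omega)$. There is a rearrangement $V_*\in\mathcal{R}(V_0)$ of $V_0$ in $\Omega$ such that $$\lambda(V_* )=\min\{\lambda(V)\colon V\in\mathcal{R}(V_0)\}.$$ Moreover, there exists a decreasing (i.e. nonincreasing) function $\varphi\colon\mathbb{R}\to\mathbb{R}$ such that $V_*=\varphi\circ|u_*|^p$ a.e. in $\Omega$, where $u_*$ is the positive eigenfunction associated to $\lambda(V_* )$ such that $\|u_*\|_p=1$.
   Context: Fix $n\ge 1$, $0<s<1<p<\infty$. For an open set $\Omega\subset\mathbb{R}^n$, $W^{s,p}(\Omega)$ is the space of $u\in L^p(\Omega)$ with $[u]_{s,p;\Omega}:=\left(\iint_{\Omega\times\Omega}\frac{|u(x)-u(y)|^p}{|x-y|^{n+sp}}\,dx\,dy\right)^{1/p}<\infty$, normed by $\|u\|_{s,p;\Omega}=(\|u\|_{L^p(\Omega)}^p+[u]_{s,p;\Omega}^p)^{1/p}$. When $\Omega=\mathbb{R}^n$ the set is omitted: $[u]_{s,p}$, $\|u\|_{s,p}$, $\|u\|_p$. An open set $\Omega$ is an extension domain for $W^{s,p}$ if there is $C=C(n,s,p,\Omega)>0$ such that every $u\in W^{s,p}(\Omega)$ has an extension $\tilde u\in W^{s,p}(\mathbb{R}^n)$ with $\tilde u=u$ on $\Omega$ and $\|\tilde u\|_{s,p}\le C\|u\|_{s,p;\Omega}$.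 $\widetilde W^{s,p}(\Omega)$ is the space of all $u\in W^{s,p}(\Omega)$ whose extension by zero outside $\Omega$ belongs to $W^{s,p}(\mathbb{R}^n)$, normed by the $W^{s,p}(\mathbb{R}^n)$ norm of the zero extension; such $u$ are always identified with their zero extension to $\mathbb{R}^n$. For $u,v\in W^{s,p}(\mathbb{R}^n)$ put $\mathcal{H}(u,v)=\frac12\iint_{\mathbb{R}^n\times\mathbb{R}^n}\frac{|u(x)-u(y)|^{p-2}(u(x)-u(y))(v(x)-v(y))}{|x-y|^{n+sp}}\,dx\,dy$. For $V\in L^q(\Omega)$, a number $\lambda\in\mathbb{R}$ is an eigenvalue (for the potential $V$) if there is a nontrivial $u\in\widetilde W^{s,p}(\Omega)$ (an associated eigenfunction) with $\mathcal{H}(u,v)+\int_\Omega V|u|^{p-2}uv\,dx=\lambda\int_{\mathbb{R}^n}|u|^{p-2}uv\,dx$ for all $v\in\widetilde W^{s,p}(\Omega)$. $\lambda(V)=\inf\{\frac12[u]_{s,p}^p+\int_\Omega V|u|^p\,dx\colon u\in\widetilde W^{s,p}(\Omega),\ \|u\|_p=1\}$. It is an eigenvalue and has a unique positive eigenfunction with $\|u\|_p=1$. $\mathcal{R}(V_0)$ is the set of rearrangements of $V_0$: all measurable $V\colon\Omega\to\mathbb{R}$ such that $|\{x\in\Omega\colon V(x)\ge t\}|=|\{x\in\Omega\colon V_0(x)\ge t\}|$ for every $t\in\mathbb{R}$, where $|\cdot|$ is Lebesgue measure. Every $V\in\mathcal{R}(V_0)$ lies in $L^q(\Omega)$ wi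th $\|V\|_{L^q(\Omega)}=\|V_0\|_{L^q(\Omega)}$.
   Formalization: The function φ takes values in [-∞,∞] instead of ℝ: with φ: ℝ→ℝ one has φ(|u_*|^p) ≤ φ(0), so the claim fails if V_0 is not essentially bounded above; for essentially bounded V_0 a truncation gives a real φ. Ω is assumed nonempty. *)

theory Defs
  imports "HOL-Analysis.Analysis"
begin

text \<open>
  The space \<open>\<real>\<^sup>n\<close> is an arbitrary type \<open>'a :: euclidean_space\<close>, with \<open>n = DIM('a)\<close>. Elements of function
  spaces over \<open>\<Omega>\<close> are represented by functions on all of \<open>'a\<close> whose values outside \<open>\<Omega>\<close> are ignored;
  they are Lebesgue measurable on \<open>\<Omega>\<close>, and equality of elements is equality almost everywhere.
\<close>

definition Lp_space :: "real \<Rightarrow> 'a::euclidean_space set \<Rightarrow> ('a \<Rightarrow> real) set" where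
  "Lp_space p \<Omega> = {u \<in> borel_measurable (lebesgue_on \<Omega>).
     integrable (lebesgue_on \<Omega>) (\<lambda>x. \<bar>u x\<bar> powr p)}"

definition Lp_norm :: "real \<Rightarrow> 'a::euclidean_space set \<Rightarrow> ('a \<Rightarrow> real) \<Rightarrow> real" where
  "Lp_norm p \<Omega> u = (LINT x|lebesgue_on \<Omega>. \<bar>u x\<bar> powr p) powr (1 / p)"

text \<open>The integrand is \<open>0\<close> on the diagonal \<open>x = y\<close>, since \<open>0 / 0 = 0\<close>; the diagonal is a null set.\<close>

definition gagliardo_integrand ::
    "real \<Rightarrow> real \<Rightarrow> ('a::euclidean_space \<Rightarrow> real) \<Rightarrow> 'a \<times> 'a \<Rightarrow> real" where
  "gagliardo_integrand s p u =
     (\<lambda>(x, y). \<bar>u x - u y\<bar> powr p / norm (x - y) powr (real DIM('a) + s * p))"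

definition Wsp :: "real \<Rightarrow> real \<Rightarrow> 'a::euclidean_space set \<Rightarrow> ('a \<Rightarrow> real) set" where
  "Wsp s p \<Omega> = {u \<in> Lp_space p \<Omega>.
     integrable (lebesgue_on \<Omega> \<Otimes>\<^sub>M lebesgue_on \<Omega>) (gagliardo_integrand s p u)}"

definition gagliardo_seminorm ::
    "real \<Rightarrow> real \<Rightarrow> 'a::euclidean_space set \<Rightarrow> ('a \<Rightarrow> real) \<Rightarrow> real" where
  "gagliardo_seminorm s p \<Omega> u =
     (LINT z|(lebesgue_on \<Omega> \<Otimes>\<^sub>M lebesgue_on \<Omega>). gagliardo_integrand s p u z) powr (1 / p)"

definition Wsp_norm :: "real \<Rightarrow> real \<Rightarrow> 'a::euclidean_space set \<Rightarrow> ('a \<Rightarrow> real) \<Rightarrow> real" where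
  "Wsp_norm s p \<Omega> u =
     (Lp_norm p \<Omega> u powr p + gagliardo_seminorm s p \<Omega> u powr p) powr (1 / p)"

definition extension_domain :: "real \<Rightarrow> real \<Rightarrow> 'a::euclidean_space set \<Rightarrow> bool" where
  "extension_domain s p \<Omega> \<longleftrightarrow> open \<Omega> \<and>
     (\<exists>C>0. \<forall>u\<in>Wsp s p \<Omega>. \<exists>w\<in>Wsp s p UNIV.
        (AE x in lebesgue_on \<Omega>. w x = u x) \<and> Wsp_norm s p UNIV w \<le> C * Wsp_norm s p \<Omega> u)"

definition zero_ext :: "'a set \<Rightarrow> ('a \<Rightarrow> real) \<Rightarrow> 'a \<Rightarrow> real" where
  "zero_ext \<Omega> u = (\<lambda>x. if x \<in> \<Omega> then u x else 0)"

text \<open>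
  Elements of this space are identified with their extensions by zero, so each representative is
  such an extension (and vanishes outside \<open>\<Omega>\<close>).
\<close>

definition Wsp_tilde :: "real \<Rightarrow> real \<Rightarrow> 'a::euclidean_space set \<Rightarrow> ('a \<Rightarrow> real) set" where
  "Wsp_tilde s p \<Omega> = {zero_ext \<Omega> u | u. u \<in> Wsp s p \<Omega> \<and> zero_ext \<Omega> u \<in> Wsp s p UNIV}"

text \<open>
  In the next definitions \<open>\<bar>t\<bar> powr (p - 2) * t\<close> is \<open>0\<close> at \<open>t = 0\<close> for every \<open>p\<close>, which is the usual
  convention for \<open>1 < p < 2\<close>.
\<close>

definition H_form ::
    "real \<Rightarrow> real \<Rightarrow> ('a::euclidean_space \<Rightarrow> real) \<Rightarrow> ('a \<Rightarrow> real) \<Rightarrow> real" where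
  "H_form s p u v = 1 / 2 * (LINT (x, y)|(lebesgue \<Otimes>\<^sub>M lebesgue).
     \<bar>u x - u y\<bar> powr (p - 2) * (u x - u y) * (v x - v y)
       / norm (x - y) powr (real DIM('a) + s * p))"

definition is_eigenfunction ::
    "real \<Rightarrow> real \<Rightarrow> 'a::euclidean_space set \<Rightarrow> ('a \<Rightarrow> real) \<Rightarrow> real \<Rightarrow> ('a \<Rightarrow> real) \<Rightarrow> bool" where
  "is_eigenfunction s p \<Omega> V l u \<longleftrightarrow>
     u \<in> Wsp_tilde s p \<Omega> \<and> \<not> (AE x in lebesgue. u x = 0) \<and>
     (\<forall>v\<in>Wsp_tilde s p \<Omega>.
        H_form s p u v + (LINT x|lebesgue_on \<Omega>. V x * \<bar>u x\<bar> powr (p - 2) * u x * v x)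
          = l * (LINT x|lebesgue. \<bar>u x\<bar> powr (p - 2) * u x * v x))"

text \<open>
  For \<open>\<Omega>\<close> nonempty and bounded and \<open>V\<close> in \<open>L\<^sup>q(\<Omega>)\<close> with \<open>q > max 1 (n / (s p))\<close>, the set below is
  nonempty and bounded below, so the real-valued infimum is the genuine one.
\<close>

definition first_eigenvalue ::
    "real \<Rightarrow> real \<Rightarrow> 'a::euclidean_space set \<Rightarrow> ('a \<Rightarrow> real) \<Rightarrow> real" where
  "first_eigenvalue s p \<Omega> V =
     Inf {1 / 2 * gagliardo_seminorm s p UNIV u powr p
            + (LINT x|lebesgue_on \<Omega>. V x * \<bar>u x\<bar> powr p) | u.
          u \<in> Wsp_tilde s p \<Omega> \<and> Lp_norm p UNIV u = 1}"

definition is_positive_first_eigenfunction ::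
    "real \<Rightarrow> real \<Rightarrow> 'a::euclidean_space set \<Rightarrow> ('a \<Rightarrow> real) \<Rightarrow> ('a \<Rightarrow> real) \<Rightarrow> bool" where
  "is_positive_first_eigenfunction s p \<Omega> V u \<longleftrightarrow>
     is_eigenfunction s p \<Omega> V (first_eigenvalue s p \<Omega> V) u \<and>
     (AE x in lebesgue_on \<Omega>. u x > 0) \<and> Lp_norm p UNIV u = 1"

definition rearrangements :: "'a::euclidean_space set \<Rightarrow> ('a \<Rightarrow> real) \<Rightarrow> ('a \<Rightarrow> real) set" where
  "rearrangements \<Omega> V0 = {V \<in> borel_measurable (lebesgue_on \<Omega>).
     \<forall>t. emeasure lebesgue {x \<in> \<Omega>. V x \<ge> t} = emeasure lebesgue {x \<in> \<Omega>. V0 x \<ge> t}}"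

end

theory Submission
  imports Defs "HOL-Library.Diagonal_Subsequence"
begin

text \<open>Minimising \<open>\<lambda>(V)\<close> over the rearrangements of \<open>V\<^sub>0\<close> is the same as minimising
  \<open>J(V, u) = [u]\<^sup>p / 2 + \<integral> V |u|\<^sup>p\<close> over both \<open>V\<close> and the functions \<open>u\<close> of unit \<open>L\<^sup>p\<close> norm, and this joint
  problem needs no weak limit of potentials. For a minimising sequence \<open>(V\<^sub>k, u\<^sub>k)\<close> only the \<open>u\<^sub>k\<close> have to
  converge: by the Hardy-Littlewood inequality some rearrangement \<open>V\<^sub>*\<close> minimises \<open>\<integral> V |u|\<^sup>p\<close> over all
  rearrangements, where \<open>u\<close> is the limit, and \<open>(V\<^sub>*, u)\<close> is then a minimising pair.

  The compactness has two elementary sources. Integrating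
  \<open>|u(x)|\<^sup>p \<le> 2\<^sup>p (|u(x) - u(y)|\<^sup>p + |u(y)|\<^sup>p)\<close> over \<open>y\<close> in a ball whose radius is chosen according to
  \<open>|u(x)|\<close> bounds the \<open>L\<^bsup>pq'\<^esup>\<close> norm of \<open>u\<close> by its seminorm (\<open>Sobolev_inequality\<close>); since \<open>|V|\<^sup>q\<close> has the
  same tails for all rearrangements, the potential term is infinitesimally form bounded, uniformly
  in \<open>V\<close> (\<open>form_bound\<close>). Approximation of \<open>u\<close> by its means over small balls gives a subsequence
  that converges almost everywhere (\<open>Rellich_subsequence\<close>); with Vitali's theorem and Fatou's lemma this yields the
  minimising pair (\<open>minimizing_limit\<close>), and \<open>u\<close> may be replaced by \<open>|u|\<close>.

  Positivity and uniqueness of the first eigenfunction both come from submodularity: replacing a pair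
  \<open>(u, w)\<close> by \<open>(max(u, w), min(u, w))\<close> preserves the \<open>L\<^sup>p\<close> and the potential terms and decreases the sum of
  the energies, strictly so if both \<open>{u > w}\<close> and \<open>{u < w}\<close> have positive measure (\<open>powr_max_min_less\<close>,
  \<open>excess_le\<close>). Two nonnegative minimisers of equal norm therefore coincide. If a minimiser \<open>u \<ge> 0\<close>
  vanished on a subset of \<open>\<Omega>\<close> of positive measure, then comparison with \<open>t \<phi>\<close>, \<open>\<phi>\<close> a bump function, would
  gain a term of order \<open>t\<close> at a cost of order \<open>t\<^sup>p\<close>, which is impossible for small \<open>t\<close>.

  It remains to see that \<open>V\<^sub>*\<close> is a function of \<open>|u|\<^sup>p\<close>. Arranging the values of \<open>V\<^sub>0\<close> decreasingly along
  \<open>|u|\<^sup>p\<close> leaves a choice on the level sets of \<open>|u|\<^sup>p\<close>. Breaking ties by a coordinate, once increasingly and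
  once decreasingly, gives two rearrangements that are both optimal for the same \<open>u\<close>. Subtraction of
  their Euler-Lagrange equations shows that they agree almost everywhere (\<open>optimal_potentials_equal\<close>),
  and a function that is both increasing and decreasing in the coordinate on a level set is constant
  there, up to a null set (\<open>antitone_factorization\<close>).\<close>

section \<open>Gagliardo integrands and zero extensions\<close>

lemma sigma_finite_lebesgue: "sigma_finite_measure (lebesgue :: 'a::euclidean_space measure)"
proof
  show "\<exists>A::'a set set. countable A \<and> A \<subseteq> sets lebesgue \<and> \<Union>A = space lebesgue \<and>
          (\<forall>a\<in>A. emeasure lebesgue a \<noteq> \<infinity>)"
  proof (intro exI[of _ "range (\<lambda>n::nat. ball (0::'a) (real n))"] conjI ballI)
    have "emeasure lebesgue (ball (0::'a) r) \<noteq> \<infinity>" for r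
      using emeasure_bounded_finite[OF bounded_ball[of "0::'a" r]] by auto
    then show "emeasure lebesgue a \<noteq> \<infinity>" if "a \<in> range (\<lambda>n::nat. ball (0::'a) (real n))" for a
      using that by blast
    show "\<Union> (range (\<lambda>n::nat. ball (0::'a) (real n))) = space lebesgue"
      using reals_Archimedean2 by (auto simp: )
  qed auto
qed

interpretation leb: sigma_finite_measure "lebesgue :: 'a::euclidean_space measure"
  by (rule sigma_finite_lebesgue)

interpretation leb_pair: pair_sigma_finite "lebesgue :: 'a::euclidean_space measure"
    "lebesgue :: 'a::euclidean_space measure" ..

lemma measurable_ident_lebesgue [measurable]: "(\<lambda>x. x) \<in> lebesgue \<rightarrow>\<^sub>M (borel :: 'a::euclidean_space measure)"
  by (rule measurable_completion) simp

lemma measurable_ident_lebesgue_on [measurable]: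
  "(\<lambda>x. x) \<in> lebesgue_on S \<rightarrow>\<^sub>M (borel :: 'a::euclidean_space measure)"
  by (rule measurable_restrict_space1) simp

lemma measurable_norm_diff_pair:
  assumes "(\<lambda>x. x) \<in> M \<rightarrow>\<^sub>M (borel :: 'a::euclidean_space measure)"
  shows "(\<lambda>z. norm (fst z - snd z)) \<in> borel_measurable (M \<Otimes>\<^sub>M M)"
  using measurable_compose[OF measurable_fst assms, of M] measurable_compose[OF measurable_snd assms, of M]
  by measurable

lemma measurable_gagliardo_integrand:
  assumes "(\<lambda>x. x) \<in> M \<rightarrow>\<^sub>M (borel :: 'a::euclidean_space measure)" and [measurable]: "u \<in> borel_measurable M"
  shows "gagliardo_integrand s p u \<in> borel_measurable (M \<Otimes>\<^sub>M M)"
proof -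
  note [measurable] = measurable_norm_diff_pair[OF assms(1)]
  show ?thesis
    unfolding gagliardo_integrand_def case_prod_beta by measurable
qed

lemmas [measurable] = measurable_norm_diff_pair[OF measurable_ident_lebesgue]
  measurable_gagliardo_integrand[OF measurable_ident_lebesgue]

lemma gagliardo_integrand_nonneg: "0 \<le> gagliardo_integrand s p u z"
  by (simp add: gagliardo_integrand_def case_prod_beta)

lemma AE_pair_lebesgue:
  assumes "AE x in lebesgue. P (x::'a::euclidean_space)"
  shows "AE z in lebesgue \<Otimes>\<^sub>M lebesgue. P (fst z) \<and> P (snd z)"
proof -
  obtain N where N: "{x. \<not> P x} \<subseteq> N" "N \<in> null_sets lebesgue"
    using assms by (auto simp: eventually_ae_filter)
  have "N \<times> UNIV \<union> UNIV \<times> N \<in> null_sets (lebesgue \<Otimes>\<^sub>M (lebesgue :: 'a measure))"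
    using N(2) by (intro null_sets.Un leb.times_in_null_sets1 leb.times_in_null_sets2) auto
  then show ?thesis
    by (rule AE_I') (use N(1) in \<open>auto simp: space_pair_measure\<close>)
qed

lemma integrable_lebesgue_pair_restrict:
  fixes f :: "'a::euclidean_space \<times> 'a \<Rightarrow> real"
  assumes "integrable (lebesgue \<Otimes>\<^sub>M lebesgue) f" and "S \<in> sets lebesgue" and nn: "\<And>z. 0 \<le> f z"
    and [measurable]: "f \<in> borel_measurable (lebesgue_on S \<Otimes>\<^sub>M lebesgue_on S)"
  shows "integrable (lebesgue_on S \<Otimes>\<^sub>M lebesgue_on S) f"
proof -
  interpret S: sigma_finite_measure "lebesgue_on S"
    by (rule sigma_finite_measure_restrict_space[OF sigma_finite_lebesgue assms(2)])
  have [measurable]: "f \<in> borel_measurable (lebesgue \<Otimes>\<^sub>M lebesgue)" using assms(1) by simp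
  have S: "S \<inter> space lebesgue \<in> sets lebesgue" using assms(2) by simp
  have "(\<integral>\<^sup>+z. ennreal (f z) \<partial>(lebesgue_on S \<Otimes>\<^sub>M lebesgue_on S))
      = (\<integral>\<^sup>+x. (\<integral>\<^sup>+y. ennreal (f (x, y)) \<partial>lebesgue_on S) \<partial>lebesgue_on S)"
    by (simp add: S.nn_integral_fst[symmetric])
  also have "\<dots> \<le> (\<integral>\<^sup>+x. (\<integral>\<^sup>+y. ennreal (f (x, y)) \<partial>lebesgue) \<partial>lebesgue)"
    unfolding nn_integral_restrict_space[OF S]
    by (intro nn_integral_mono) (auto simp: indicator_def intro!: nn_integral_mono)
  also have "\<dots> = (\<integral>\<^sup>+z. ennreal (f z) \<partial>(lebesgue \<Otimes>\<^sub>M lebesgue))"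
    by (rule leb.nn_integral_fst) simp
  also have "\<dots> < \<infinity>"
    using assms(1) nn by (subst nn_integral_eq_integral) auto
  finally show ?thesis
    by (intro integrableI_nonneg) (auto simp: nn)
qed

lemma Wsp_UNIV_iff:
  fixes u :: "'a::euclidean_space \<Rightarrow> real"
  shows "u \<in> Wsp s p UNIV \<longleftrightarrow> u \<in> borel_measurable lebesgue \<and> integrable lebesgue (\<lambda>x. \<bar>u x\<bar> powr p)
    \<and> integrable (lebesgue \<Otimes>\<^sub>M lebesgue) (gagliardo_integrand s p u)"
  by (auto simp: Wsp_def Lp_space_def lebesgue_on_UNIV_eq)

text \<open>A function that vanishes outside \<open>\<Omega>\<close> lies in the space of zero extensions as soon as it has finite
  norm on the whole space: restriction to \<open>\<Omega>\<close> only decreases the two integrals.\<close>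

lemma Wsp_tilde_iff:
  fixes u :: "'a::euclidean_space \<Rightarrow> real"
  assumes "\<Omega> \<in> sets lebesgue"
  shows "u \<in> Wsp_tilde s p \<Omega> \<longleftrightarrow> u \<in> borel_measurable lebesgue \<and> (\<forall>x. x \<notin> \<Omega> \<longrightarrow> u x = 0)
    \<and> integrable lebesgue (\<lambda>x. \<bar>u x\<bar> powr p)
    \<and> integrable (lebesgue \<Otimes>\<^sub>M lebesgue) (gagliardo_integrand s p u)" (is "?L \<longleftrightarrow> ?R")
proof
  assume ?L then show ?R
    by (auto simp: Wsp_tilde_def Wsp_UNIV_iff zero_ext_def)
next
  assume R: ?R
  then have [measurable]: "u \<in> borel_measurable lebesgue" by simp
  have z: "zero_ext \<Omega> u = u" using R by (auto simp: zero_ext_def)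
  have [measurable]: "u \<in> borel_measurable (lebesgue_on \<Omega>)"
    by (rule measurable_restrict_space1) simp
  have "integrable (lebesgue_on \<Omega>) (\<lambda>x. \<bar>u x\<bar> powr p)"
    using R assms by (intro integrable_restrict_space[THEN iffD2])
       (auto intro!: integrable_real_mult_indicator simp: mult.commute[of "indicator _ _"])
  moreover have "integrable (lebesgue_on \<Omega> \<Otimes>\<^sub>M lebesgue_on \<Omega>) (gagliardo_integrand s p u)"
    using R assms by (intro integrable_lebesgue_pair_restrict gagliardo_integrand_nonneg 
        measurable_gagliardo_integrand) auto
  ultimately have "u \<in> Wsp s p \<Omega>"
    by (auto simp: Wsp_def Lp_space_def)
  then show ?L
    using R z unfolding Wsp_tilde_def by (auto simp: Wsp_UNIV_iff intro!: exI[of _ u])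
qed

section \<open>Inequalities for powers and closure properties\<close>

lemma powr_abs_le_sum:
  fixes a b c K p :: real
  assumes "0 < p" "0 \<le> K" "\<bar>c\<bar> \<le> K * (\<bar>a\<bar> + \<bar>b\<bar>)"
  shows "\<bar>c\<bar> powr p \<le> (2 * K) powr p * (\<bar>a\<bar> powr p + \<bar>b\<bar> powr p)"
proof -
  define m where "m = max \<bar>a\<bar> \<bar>b\<bar>"
  have "K * (\<bar>a\<bar> + \<bar>b\<bar>) \<le> K * (2 * m)"
    using assms(2) by (intro mult_left_mono) (auto simp: m_def)
  then have "\<bar>c\<bar> powr p \<le> (2 * K * m) powr p"
    using assms by (intro powr_mono2) (auto simp: algebra_simps)
  also have "\<dots> = (2 * K) powr p * m powr p"
    using assms(2) by (simp add: powr_mult m_def)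
  also have "m powr p \<le> \<bar>a\<bar> powr p + \<bar>b\<bar> powr p"
    by (auto simp: m_def max_def)
  then have "(2 * K) powr p * m powr p \<le> (2 * K) powr p * (\<bar>a\<bar> powr p + \<bar>b\<bar> powr p)"
    by (intro mult_left_mono) auto
  finally show ?thesis .
qed

lemma powr_abs_add_le:
  fixes a b p :: real
  assumes "0 < p"
  shows "\<bar>a + b\<bar> powr p \<le> 2 powr p * (\<bar>a\<bar> powr p + \<bar>b\<bar> powr p)"
  using powr_abs_le_sum[of p 1 "a + b" a b] assms by auto

lemma has_real_derivative_abs_powr:
  fixes p x :: real
  assumes "1 < p"
  shows "((\<lambda>t. \<bar>t\<bar> powr p) has_real_derivative p * (\<bar>x\<bar> powr (p - 2) * x)) (at x)"
proof -
  consider "x > 0" | "x < 0" | "x = 0" by linarith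
  then show ?thesis
  proof cases
    case 1
    have "((\<lambda>t. t powr p) has_real_derivative p * x powr (p - 1)) (at x)"
      using 1 by (rule has_real_derivative_powr)
    moreover have "x powr (p - 1) = \<bar>x\<bar> powr (p - 2) * x"
      using 1 powr_add[of x "p - 2" 1] by simp
    ultimately have "((\<lambda>t. t powr p) has_real_derivative p * (\<bar>x\<bar> powr (p - 2) * x)) (at x)" by simp
    then show ?thesis
      by (rule has_field_derivative_transform_within_open[where S = "{0<..}"]) (use 1 in auto)
  next
    case 2
    have "((\<lambda>t. (- t) powr p) has_real_derivative (p * (- x) powr (p - 1)) * (-1)) (at x)"
      using 2 by (auto intro!: derivative_eq_intros simp: powr_diff)
    moreover have "(p * (- x) powr (p - 1)) * (-1) = p * (\<bar>x\<bar> powr (p - 2) * x)"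
      using 2 powr_add[of "- x" "p - 2" 1] by simp
    ultimately have "((\<lambda>t. (- t) powr p) has_real_derivative p * (\<bar>x\<bar> powr (p - 2) * x)) (at x)"
      by simp
    then show ?thesis
      by (rule has_field_derivative_transform_within_open[where S = "{..<0}"]) (use 2 in auto)
  next
    case 3
    have "((\<lambda>h::real. \<bar>h\<bar> powr (p - 1)) \<longlongrightarrow> \<bar>0\<bar> powr (p - 1)) (at 0)"
      using assms by (intro tendsto_powr' tendsto_intros) auto
    then have "((\<lambda>h::real. \<bar>h\<bar> powr (p - 1)) \<longlongrightarrow> 0) (at 0)" by simp
    moreover have "norm (\<bar>0 + h\<bar> powr p - \<bar>0\<bar> powr p) / norm h = \<bar>h\<bar> powr (p - 1)" if "h \<noteq> 0" for h :: real
      using that by (simp add: powr_diff)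
    ultimately have "((\<lambda>h::real. \<bar>h\<bar> powr p / h) \<longlongrightarrow> 0) (at 0)"
      by (subst tendsto_norm_zero_iff[symmetric], elim Lim_transform_eventually)
         (auto simp: eventually_at_filter powr_diff)
    then show ?thesis
      using 3 by (simp add: DERIV_def)
  qed
qed

lemma abs_powr_mult_strict_mono:
  fixes p x y :: real
  assumes "1 < p" "x < y"
  shows "\<bar>x\<bar> powr (p - 2) * x < \<bar>y\<bar> powr (p - 2) * y"
proof -
  have pos: "\<bar>t\<bar> powr (p - 2) * t = t powr (p - 1)" if "t > 0" for t :: real
    using that powr_add[of t "p - 2" 1] by simp
  have neg: "\<bar>t\<bar> powr (p - 2) * t = - ((- t) powr (p - 1))" if "t < 0" for t :: real
    using pos[of "- t"] that by simp
  consider "0 < x" | "x \<le> 0" "0 \<le> y" | "y < 0" by linarith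
  then show ?thesis
  proof cases
    case 1
    then show ?thesis using assms pos by (auto intro!: powr_less_mono2)
  next
    case 2
    have "\<bar>x\<bar> powr (p - 2) * x \<le> 0" "0 \<le> \<bar>y\<bar> powr (p - 2) * y"
      using 2 by (auto simp: mult_le_0_iff)
    moreover have "\<bar>x\<bar> powr (p - 2) * x \<noteq> 0 \<or> \<bar>y\<bar> powr (p - 2) * y \<noteq> 0"
      using 2 assms(2) by auto
    ultimately show ?thesis by linarith
  next
    case 3
    then show ?thesis using assms neg by (auto intro!: powr_less_mono2)
  qed
qed

lemma abs_abs_powr_mult:
  fixes p x :: real
  shows "\<bar>\<bar>x\<bar> powr (p - 2) * x\<bar> = \<bar>x\<bar> powr (p - 1)"
  using powr_add[of "\<bar>x\<bar>" "p - 2" 1] by (cases "x = 0") (auto simp: abs_mult)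

text \<open>Strict convexity of \<open>|t|\<^sup>p\<close>, in the form that moving two points towards each other, with their sum
  unchanged, decreases the sum of the values.\<close>

lemma powr_abs_inner_points_less:
  fixes p :: real
  assumes "1 < p" "Y < m" "m \<le> M" "M < X" "m + M = X + Y"
  shows "\<bar>m\<bar> powr p + \<bar>M\<bar> powr p < \<bar>X\<bar> powr p + \<bar>Y\<bar> powr p"
proof -
  note D = has_real_derivative_abs_powr[OF assms(1)]
  obtain a where a: "Y < a" "a < m" "\<bar>m\<bar> powr p - \<bar>Y\<bar> powr p = (m - Y) * (p * (\<bar>a\<bar> powr (p - 2) * a))"
    using MVT2[OF assms(2), of "\<lambda>t. \<bar>t\<bar> powr p" "\<lambda>x. p * (\<bar>x\<bar> powr (p - 2) * x)"] D by metis
  obtain b where b: "M < b" "b < X" "\<bar>X\<bar> powr p - \<bar>M\<bar> powr p = (X - M) * (p * (\<bar>b\<bar> powr (p - 2) * b))"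
    using MVT2[OF assms(4), of "\<lambda>t. \<bar>t\<bar> powr p" "\<lambda>x. p * (\<bar>x\<bar> powr (p - 2) * x)"] D by metis
  have eq: "m - Y = X - M" using assms(5) by simp
  have "p * (\<bar>a\<bar> powr (p - 2) * a) < p * (\<bar>b\<bar> powr (p - 2) * b)"
    using abs_powr_mult_strict_mono[OF assms(1), of a b] a b assms by simp
  then have "(X - M) * (p * (\<bar>a\<bar> powr (p - 2) * a)) < (X - M) * (p * (\<bar>b\<bar> powr (p - 2) * b))"
    by (rule mult_strict_left_mono) (use assms(4) in simp)
  then show ?thesis using a(3) b(3) eq by simp
qed

text \<open>Strict submodularity: with \<open>a = u(x)\<close>, \<open>b = u(y)\<close>, \<open>c = w(x)\<close>, \<open>d = w(y)\<close>, the differences of the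
  maximum and of the minimum lie strictly between those of \<open>u\<close> and \<open>w\<close> and have the same sum.\<close>

lemma powr_max_min_less:
  fixes a b c d p :: real
  assumes "1 < p" "c < a" "b < d"
  shows "\<bar>max a c - max b d\<bar> powr p + \<bar>min a c - min b d\<bar> powr p < \<bar>a - b\<bar> powr p + \<bar>c - d\<bar> powr p"
proof -
  have "\<bar>a - d\<bar> powr p + \<bar>c - b\<bar> powr p < \<bar>a - b\<bar> powr p + \<bar>c - d\<bar> powr p"
    using powr_abs_inner_points_less[OF assms(1), of "c - d" "a - d" "c - b" "a - b"]
      powr_abs_inner_points_less[OF assms(1), of "c - d" "c - b" "a - d" "a - b"] assms(2,3)
    by (cases "a - d \<le> c - b") auto
  then show ?thesis using assms by (simp add: max_def min_def)
qed

lemma powr_max_min_le: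
  fixes a b c d p :: real
  assumes "1 < p"
  shows "\<bar>max a c - max b d\<bar> powr p + \<bar>min a c - min b d\<bar> powr p \<le> \<bar>a - b\<bar> powr p + \<bar>c - d\<bar> powr p"
proof -
  consider "c < a" "b < d" | "a < c" "d < b" | "c \<le> a" "d \<le> b" | "a \<le> c" "b \<le> d" by linarith
  then show ?thesis
  proof cases
    case 1 then show ?thesis using powr_max_min_less[OF assms, of c a b d] by simp
  next
    case 2 then show ?thesis using powr_max_min_less[OF assms, of a c d b]
      by (simp add: max.commute min.commute add.commute)
  qed (auto simp: max_def min_def)
qed

lemma abs_max_diff_le: "\<bar>max a c - max b d\<bar> \<le> \<bar>a - b\<bar> + \<bar>c - d\<bar>" for a b c d :: real
  by (smt (verit))

lemma abs_min_diff_le: "\<bar>min a c - min b d\<bar> \<le> \<bar>a - b\<bar> + \<bar>c - d\<bar>" for a b c d :: real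
  by (smt (verit))

lemma max_abs_le_sum: "\<bar>max a b\<bar> \<le> \<bar>a\<bar> + \<bar>b\<bar>" for a b :: real
  by (smt (verit))

lemma min_abs_le_sum: "\<bar>min a b\<bar> \<le> \<bar>a\<bar> + \<bar>b\<bar>" for a b :: real
  by (smt (verit))

lemma abs_truncate_diff_le: "\<bar>min \<bar>a\<bar> m - min \<bar>b\<bar> m\<bar> \<le> 2 * \<bar>a - b\<bar>" for a b m :: real
  by (smt (verit))

lemma powr_abs_quotient_tendsto:
  fixes a b p :: real
  assumes "1 < p"
  shows "(\<lambda>n. (\<bar>a + 1 / real (Suc n) * b\<bar> powr p - \<bar>a\<bar> powr p) / (1 / real (Suc n)))
    \<longlonglongrightarrow> p * (\<bar>a\<bar> powr (p - 2) * a * b)"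
proof -
  have "((\<lambda>t. \<bar>a + t * b\<bar> powr p) has_real_derivative p * (\<bar>a + 0 * b\<bar> powr (p - 2) * (a + 0 * b)) * b) (at 0)"
    by (rule DERIV_chain2[where g = "\<lambda>t. a + t * b", OF has_real_derivative_abs_powr[OF assms]])
       (auto intro!: derivative_eq_intros)
  then have "((\<lambda>t. (\<bar>a + t * b\<bar> powr p - \<bar>a\<bar> powr p) / t) \<longlongrightarrow> p * (\<bar>a\<bar> powr (p - 2) * a * b)) (at 0)"
    by (simp add: DERIV_def mult.assoc)
  moreover have "filterlim (\<lambda>n. 1 / real (Suc n)) (at 0) sequentially"
    unfolding filterlim_at using LIMSEQ_inverse_real_of_nat
    by (auto simp: inverse_eq_divide)
  ultimately show ?thesis
    by (rule filterlim_compose)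
qed

lemma powr_abs_quotient_bound:
  fixes a b p t :: real
  assumes "1 < p" "0 < t" "t \<le> 1"
  shows "\<bar>(\<bar>a + t * b\<bar> powr p - \<bar>a\<bar> powr p) / t\<bar> \<le> p * 2 powr p * (\<bar>a\<bar> powr p + \<bar>b\<bar> powr p)"
proof -
  have D: "((\<lambda>t. \<bar>a + t * b\<bar> powr p) has_real_derivative p * (\<bar>a + x * b\<bar> powr (p - 2) * (a + x * b)) * b) (at x)" for x
    by (rule DERIV_chain2[where g = "\<lambda>t. a + t * b", OF has_real_derivative_abs_powr[OF assms(1)]])
       (auto intro!: derivative_eq_intros)
  obtain x where x: "0 < x" "x < t" "\<bar>a + t * b\<bar> powr p - \<bar>a + 0 * b\<bar> powr p
      = (t - 0) * (p * (\<bar>a + x * b\<bar> powr (p - 2) * (a + x * b)) * b)"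
    using MVT2[OF assms(2), of "\<lambda>t. \<bar>a + t * b\<bar> powr p"
      "\<lambda>x. p * (\<bar>a + x * b\<bar> powr (p - 2) * (a + x * b)) * b", OF D] by blast
  define m where "m = \<bar>a\<bar> + \<bar>b\<bar>"
  have "\<bar>a + x * b\<bar> \<le> \<bar>a\<bar> + \<bar>x * b\<bar>" by simp
  also have "\<bar>x * b\<bar> \<le> \<bar>b\<bar>" using x assms by (simp add: abs_mult mult_left_le_one_le)
  finally have m1: "\<bar>a + x * b\<bar> \<le> m" by (simp add: m_def)
  have "\<bar>(\<bar>a + t * b\<bar> powr p - \<bar>a\<bar> powr p) / t\<bar> = \<bar>p * (\<bar>a + x * b\<bar> powr (p - 2) * (a + x * b)) * b\<bar>"
    using x assms(2) by simp
  also have "\<dots> = p * \<bar>a + x * b\<bar> powr (p - 1) * \<bar>b\<bar>"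
    by (simp only: abs_mult[of _ b] abs_mult[of p] abs_abs_powr_mult) (use assms(1) in simp)
  also have "\<dots> \<le> p * m powr (p - 1) * m"
    using assms(1) m1 by (intro mult_mono powr_mono2) (auto simp: m_def)
  also have "\<dots> = p * \<bar>m\<bar> powr p"
    using powr_add[of m "p - 1" 1] by (cases "m = 0") (auto simp: m_def)
  also have "\<bar>m\<bar> powr p \<le> 2 powr p * (\<bar>a\<bar> powr p + \<bar>b\<bar> powr p)"
    using powr_abs_add_le[of p "\<bar>a\<bar>" "\<bar>b\<bar>"] assms(1) by (simp add: m_def)
  finally show ?thesis using assms(1) by (simp add: mult.assoc)
qed

text \<open>Directional derivative of a weighted \<open>p\<close>-th power integral. The weight may change sign, so the same
  statement serves the energy, the potential term and the norm.\<close>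

lemma integral_abs_powr_quotient_tendsto:
  fixes a b W :: "'b \<Rightarrow> real"
  assumes "1 < p" and [measurable]: "a \<in> borel_measurable M" "b \<in> borel_measurable M" "W \<in> borel_measurable M"
    and ia: "integrable M (\<lambda>x. W x * \<bar>a x\<bar> powr p)" and ib: "integrable M (\<lambda>x. W x * \<bar>b x\<bar> powr p)"
  shows "(\<lambda>n. ((LINT x|M. W x * \<bar>a x + 1 / real (Suc n) * b x\<bar> powr p) - (LINT x|M. W x * \<bar>a x\<bar> powr p)) / (1 / real (Suc n)))
    \<longlonglongrightarrow> p * (LINT x|M. W x * (\<bar>a x\<bar> powr (p - 2) * a x * b x))"
proof -
  let ?t = "\<lambda>n. 1 / real (Suc n)"
  let ?B = "\<lambda>x. p * 2 powr p * (\<bar>W x * \<bar>a x\<bar> powr p\<bar> + \<bar>W x * \<bar>b x\<bar> powr p\<bar>)"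
  let ?q = "\<lambda>n x. W x * ((\<bar>a x + ?t n * b x\<bar> powr p - \<bar>a x\<bar> powr p) / ?t n)"
  have iB: "integrable M ?B" using ia ib by auto
  have bd: "norm (?q n x) \<le> ?B x" for n x
  proof -
    have "norm (?q n x) = \<bar>W x\<bar> * \<bar>(\<bar>a x + ?t n * b x\<bar> powr p - \<bar>a x\<bar> powr p) / ?t n\<bar>"
      unfolding real_norm_def abs_mult by simp
    also have "\<dots> \<le> \<bar>W x\<bar> * (p * 2 powr p * (\<bar>a x\<bar> powr p + \<bar>b x\<bar> powr p))"
      by (intro mult_left_mono powr_abs_quotient_bound assms) auto
    finally show ?thesis by (simp add: abs_mult algebra_simps)
  qed
  have iq: "integrable M (?q n)" for n
    by (rule Bochner_Integration.integrable_bound[OF iB]) (use order_trans[OF bd abs_ge_self] in \<open>auto simp del: of_nat_Suc\<close>)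
  have "(\<lambda>n. LINT x|M. ?q n x) \<longlonglongrightarrow> (LINT x|M. W x * (p * (\<bar>a x\<bar> powr (p - 2) * a x * b x)))"
  proof (rule integral_dominated_convergence[OF _ _ iB])
    show "AE x in M. (\<lambda>n. ?q n x) \<longlonglongrightarrow> W x * (p * (\<bar>a x\<bar> powr (p - 2) * a x * b x))"
      by (intro AE_I2 tendsto_mult tendsto_const powr_abs_quotient_tendsto assms)
    show "\<And>n. AE x in M. norm (?q n x) \<le> ?B x" using bd by (intro AE_I2)
  qed measurable
  moreover have "(LINT x|M. ?q n x) = ((LINT x|M. W x * \<bar>a x + ?t n * b x\<bar> powr p) - (LINT x|M. W x * \<bar>a x\<bar> powr p)) / ?t n" for n
  proof -
    have e: "W x * \<bar>a x + ?t n * b x\<bar> powr p = ?t n * ?q n x + W x * \<bar>a x\<bar> powr p" for x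
      by (simp add: field_simps)
    have "(LINT x|M. W x * \<bar>a x + ?t n * b x\<bar> powr p) = ?t n * (LINT x|M. ?q n x) + (LINT x|M. W x * \<bar>a x\<bar> powr p)"
      unfolding e by (simp only: Bochner_Integration.integral_add[OF integrable_mult_right[OF iq] ia]
          integral_mult_right_zero)
    then show ?thesis by (simp add: field_simps)
  qed
  ultimately show ?thesis by (simp add: mult.left_commute)
qed

text \<open>The \<open>p\<close>-th power of the seminorm on the whole space.\<close>

definition gagliardo_energy :: "real \<Rightarrow> real \<Rightarrow> ('a::euclidean_space \<Rightarrow> real) \<Rightarrow> real" where
  "gagliardo_energy s p u = (LINT z|(lebesgue \<Otimes>\<^sub>M lebesgue). gagliardo_integrand s p u z)"

lemma gagliardo_energy_nonneg: "0 \<le> gagliardo_energy s p u"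
  unfolding gagliardo_energy_def by (intro integral_nonneg_AE AE_I2 gagliardo_integrand_nonneg)

lemma gagliardo_seminorm_powr:
  assumes "0 < p"
  shows "gagliardo_seminorm s p UNIV u powr p = gagliardo_energy s p u"
  using assms gagliardo_energy_nonneg[of s p u]
  by (simp add: gagliardo_seminorm_def lebesgue_on_UNIV_eq powr_powr gagliardo_energy_def)

lemma Lp_norm_UNIV_eq_1_iff:
  assumes "0 < p"
  shows "Lp_norm p UNIV u = 1 \<longleftrightarrow> (LINT x|lebesgue. \<bar>u x\<bar> powr p) = 1"
proof -
  have "0 \<le> (LINT x|lebesgue. \<bar>u x\<bar> powr p)" by (intro integral_nonneg_AE) auto
  then have "Lp_norm p UNIV u powr p = (LINT x|lebesgue. \<bar>u x\<bar> powr p)"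
    using assms by (simp add: Lp_norm_def lebesgue_on_UNIV_eq powr_powr)
  then show ?thesis by (auto simp: Lp_norm_def lebesgue_on_UNIV_eq)
qed

lemma gagliardo_integrand_scale:
  "gagliardo_integrand s p (\<lambda>x. c * u x) z = \<bar>c\<bar> powr p * gagliardo_integrand s p u z"
proof -
  have "c * u (fst z) - c * u (snd z) = c * (u (fst z) - u (snd z))" by (simp add: algebra_simps)
  then show ?thesis by (simp add: gagliardo_integrand_def case_prod_beta abs_mult powr_mult)
qed

lemma gagliardo_energy_scale:
  "gagliardo_energy s p (\<lambda>x. c * u x) = \<bar>c\<bar> powr p * gagliardo_energy s p u"
  by (simp add: gagliardo_energy_def gagliardo_integrand_scale)

lemma gagliardo_integrand_max_min_le:
  assumes "1 < p"
  shows "gagliardo_integrand s p (\<lambda>x. max (u x) (v x)) z + gagliardo_integrand s p (\<lambda>x. min (u x) (v x)) z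
    \<le> gagliardo_integrand s p u z + gagliardo_integrand s p v z"
  unfolding gagliardo_integrand_def case_prod_beta add_divide_distrib[symmetric]
  by (intro divide_right_mono powr_max_min_le assms) auto

lemma integral_lebesgue_eq_lebesgue_on:
  fixes f :: "'a::euclidean_space \<Rightarrow> real"
  assumes "\<Omega> \<in> sets lebesgue" "\<And>x. x \<notin> \<Omega> \<Longrightarrow> f x = 0"
  shows "(LINT x|lebesgue_on \<Omega>. f x) = (LINT x|lebesgue. f x)"
  using assms by (subst integral_restrict_space) (auto intro!: Bochner_Integration.integral_cong simp: indicator_def)

lemma integrable_lebesgue_iff_lebesgue_on:
  fixes f :: "'a::euclidean_space \<Rightarrow> real"
  assumes "\<Omega> \<in> sets lebesgue" "\<And>x. x \<notin> \<Omega> \<Longrightarrow> f x = 0"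
  shows "integrable (lebesgue_on \<Omega>) f \<longleftrightarrow> integrable lebesgue f"
  using assms by (subst integrable_restrict_space) (auto intro!: Bochner_Integration.integrable_cong simp: indicator_def)

context
  fixes s p :: real and \<Omega> :: "'a::euclidean_space set"
  assumes p: "1 < p" and \<Omega>: "\<Omega> \<in> sets lebesgue"
begin

text \<open>All closure properties needed below are instances of one criterion: the increments and the values of
  \<open>w\<close> are dominated by those of two elements of the space.\<close>

lemma Wsp_tilde_dominated:
  fixes u v w :: "'a \<Rightarrow> real"
  assumes u: "u \<in> Wsp_tilde s p \<Omega>" and v: "v \<in> Wsp_tilde s p \<Omega>"
    and [measurable]: "w \<in> borel_measurable lebesgue" and "0 \<le> K"
    and diff: "\<And>x y. \<bar>w x - w y\<bar> \<le> K * (\<bar>u x - u y\<bar> + \<bar>v x - v y\<bar>)"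
    and bd: "\<And>x. \<bar>w x\<bar> \<le> K * (\<bar>u x\<bar> + \<bar>v x\<bar>)"
  shows "w \<in> Wsp_tilde s p \<Omega>"
proof -
  note iff = Wsp_tilde_iff[OF \<Omega>, of _ s p]
  have "integrable lebesgue (\<lambda>x. \<bar>w x\<bar> powr p)"
  proof (rule Bochner_Integration.integrable_bound)
    show "integrable lebesgue (\<lambda>x. (2 * K) powr p * (\<bar>u x\<bar> powr p + \<bar>v x\<bar> powr p))"
      using u v iff by auto
    show "AE x in lebesgue. norm (\<bar>w x\<bar> powr p) \<le> norm ((2 * K) powr p * (\<bar>u x\<bar> powr p + \<bar>v x\<bar> powr p))"
      using powr_abs_le_sum[OF _ \<open>0 \<le> K\<close> bd, of p] p by auto
  qed measurable
  moreover have "integrable (lebesgue \<Otimes>\<^sub>M lebesgue) (gagliardo_integrand s p w)"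
  proof (rule Bochner_Integration.integrable_bound)
    show "integrable (lebesgue \<Otimes>\<^sub>M lebesgue)
        (\<lambda>z. (2 * K) powr p * (gagliardo_integrand s p u z + gagliardo_integrand s p v z))"
      using u v iff by auto
    show "AE z in lebesgue \<Otimes>\<^sub>M lebesgue. norm (gagliardo_integrand s p w z)
        \<le> norm ((2 * K) powr p * (gagliardo_integrand s p u z + gagliardo_integrand s p v z))"
    proof (rule AE_I2)
      fix z :: "'a \<times> 'a"
      have "gagliardo_integrand s p w z
          \<le> (2 * K) powr p * (gagliardo_integrand s p u z + gagliardo_integrand s p v z)"
        using divide_right_mono[OF powr_abs_le_sum[OF _ \<open>0 \<le> K\<close> diff, of p "fst z" "snd z"],
            of "norm (fst z - snd z) powr (real DIM('a) + s * p)"] p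
        by (simp add: gagliardo_integrand_def case_prod_beta add_divide_distrib distrib_left)
      then show "norm (gagliardo_integrand s p w z)
        \<le> norm ((2 * K) powr p * (gagliardo_integrand s p u z + gagliardo_integrand s p v z))"
        using gagliardo_integrand_nonneg[of s p w z] by simp
    qed
  qed measurable
  moreover have "w x = 0" if "x \<notin> \<Omega>" for x
    using bd[of x] that u v iff by auto
  ultimately show ?thesis using iff by auto
qed

lemma Wsp_tilde_measurable: "u \<in> Wsp_tilde s p \<Omega> \<Longrightarrow> u \<in> borel_measurable lebesgue"
  and Wsp_tilde_zero: "u \<in> Wsp_tilde s p \<Omega> \<Longrightarrow> x \<notin> \<Omega> \<Longrightarrow> u x = 0"
  and Wsp_tilde_integrable: "u \<in> Wsp_tilde s p \<Omega> \<Longrightarrow> integrable lebesgue (\<lambda>x. \<bar>u x\<bar> powr p)"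
  and Wsp_tilde_integrable_gagliardo:
    "u \<in> Wsp_tilde s p \<Omega> \<Longrightarrow> integrable (lebesgue \<Otimes>\<^sub>M lebesgue) (gagliardo_integrand s p u)"
  using Wsp_tilde_iff[OF \<Omega>, of u s p] by auto

lemma Wsp_tilde_add:
  assumes "u \<in> Wsp_tilde s p \<Omega>" "v \<in> Wsp_tilde s p \<Omega>"
  shows "(\<lambda>x. u x + v x) \<in> Wsp_tilde s p \<Omega>"
  by (rule Wsp_tilde_dominated[OF assms, of _ 1])
    (use assms Wsp_tilde_measurable[OF assms(1)] Wsp_tilde_measurable[OF assms(2)] in \<open>auto intro!: borel_measurable_add\<close>)

lemma Wsp_tilde_scale:
  assumes "u \<in> Wsp_tilde s p \<Omega>"
  shows "(\<lambda>x. c * u x) \<in> Wsp_tilde s p \<Omega>"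
  by (rule Wsp_tilde_dominated[OF assms assms, of _ "\<bar>c\<bar>"])
    (use assms Wsp_tilde_measurable[OF assms] in \<open>auto intro!: borel_measurable_times simp: abs_mult right_diff_distrib[symmetric] mult_left_mono\<close>)

lemma Wsp_tilde_abs:
  assumes "u \<in> Wsp_tilde s p \<Omega>"
  shows "(\<lambda>x. \<bar>u x\<bar>) \<in> Wsp_tilde s p \<Omega>"
  by (rule Wsp_tilde_dominated[OF assms assms, of _ 1])
    (use assms Wsp_tilde_measurable[OF assms] in \<open>auto intro!: borel_measurable_abs intro: order_trans[OF abs_triangle_ineq3]\<close>)

lemma Wsp_tilde_max:
  assumes "u \<in> Wsp_tilde s p \<Omega>" "v \<in> Wsp_tilde s p \<Omega>"
  shows "(\<lambda>x. max (u x) (v x)) \<in> Wsp_tilde s p \<Omega>"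
  by (rule Wsp_tilde_dominated[OF assms, of _ 1])
    (use assms Wsp_tilde_measurable[OF assms(1)] Wsp_tilde_measurable[OF assms(2)] in \<open>auto intro: abs_max_diff_le max_abs_le_sum intro!: borel_measurable_max\<close>)

lemma Wsp_tilde_min:
  assumes "u \<in> Wsp_tilde s p \<Omega>" "v \<in> Wsp_tilde s p \<Omega>"
  shows "(\<lambda>x. min (u x) (v x)) \<in> Wsp_tilde s p \<Omega>"
  by (rule Wsp_tilde_dominated[OF assms, of _ 1])
    (use assms Wsp_tilde_measurable[OF assms(1)] Wsp_tilde_measurable[OF assms(2)] in \<open>auto intro: abs_min_diff_le min_abs_le_sum intro!: borel_measurable_min\<close>)

lemma Wsp_tilde_truncate:
  assumes "u \<in> Wsp_tilde s p \<Omega>" "0 \<le> m"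
  shows "(\<lambda>x. min \<bar>u x\<bar> m) \<in> Wsp_tilde s p \<Omega>"
  by (rule Wsp_tilde_dominated[OF assms(1) assms(1), of _ 1])
    (use assms Wsp_tilde_measurable[OF assms(1)] in \<open>auto intro: abs_truncate_diff_le intro!: borel_measurable_min borel_measurable_abs\<close>)

lemma gagliardo_energy_mono:
  assumes "u \<in> Wsp_tilde s p \<Omega>" "\<And>x y. \<bar>w x - w y\<bar> \<le> \<bar>u x - u y\<bar>"
  shows "gagliardo_energy s p w \<le> gagliardo_energy s p u"
  unfolding gagliardo_energy_def
proof (rule integral_mono')
  show "gagliardo_integrand s p w z \<le> gagliardo_integrand s p u z" for z
    unfolding gagliardo_integrand_def case_prod_beta
    using p assms(2) by (intro divide_right_mono powr_mono2) auto
qed (use assms in \<open>auto intro: Wsp_tilde_integrable_gagliardo gagliardo_integrand_nonneg\<close>)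

end

section \<open>Lipschitz test functions\<close>

lemma dyadic_exponent_ge_1:
  fixes r :: real
  assumes "1 \<le> r"
  obtains k :: nat where "2 powr real k \<le> r" "r < 2 powr (real k + 1)"
proof
  define k where "k = nat \<lfloor>log 2 r\<rfloor>"
  have "0 \<le> log 2 r" using assms by simp
  then have "real k \<le> log 2 r" "log 2 r < real k + 1" by (auto simp: k_def)
  then show "2 powr real k \<le> r" "r < 2 powr (real k + 1)"
    using assms by (auto simp: le_log_iff log_less_iff)
qed

text \<open>The kernel \<open>min(1, |h|)\<^sup>p / |h|\<^bsup>n + sp\<^esup>\<close> is integrable, by summation over dyadic annuli: the annuli with
  \<open>|h| < 1\<close> contribute a geometric series of ratio \<open>2\<^bsup>sp - p\<^esup>\<close>, the others one of ratio \<open>2\<^bsup>-sp\<^esup>\<close>.\<close>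

lemma truncated_kernel_bound:
  fixes s p :: real
  assumes "0 < s" "s < 1" "1 < p"
  shows "\<exists>C. \<forall>x::'a::euclidean_space.
    (\<integral>\<^sup>+y. ennreal (min 1 (norm (x - y)) powr p / norm (x - y) powr (real DIM('a) + s * p)) \<partial>lebesgue) \<le> ennreal C"
proof -
  define n where "n = real DIM('a)"
  define a where "a = n + s * p"
  define \<omega> where "\<omega> = unit_ball_vol n"
  have n: "0 \<le> n" "0 < a" and \<omega>: "0 \<le> \<omega>" using assms by (auto simp: n_def a_def \<omega>_def intro!: add_nonneg_pos)
  define c where "c k = 2 powr (a - real k * (p - a))" for k :: nat
  define d where "d k = 2 powr (- real k * a)" for k :: nat
  \<comment> \<open>The balls \<open>?B x k\<close> and \<open>?D x k\<close> contain the dyadic annuli of inner radius \<open>2 powr - (k + 1)\<close> and \<open>2 powr k\<close>; \<open>c k\<close> and \<open>d k\<close> bound the kernel on these annuli.\<close>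
  let ?B = "\<lambda>(x::'a) k. ball x (2 powr (1 - real k))" and ?D = "\<lambda>(x::'a) k. ball x (2 powr (real k + 1))"
  let ?g = "\<lambda>x k y. ennreal (c k) * indicator (?B x k) y + ennreal (d k) * indicator (?D x k) y"
  have cd: "0 \<le> c k" "0 \<le> d k" for k by (auto simp: c_def d_def)
  have pt: "ennreal (min 1 (norm (x - y)) powr p / norm (x - y) powr a) \<le> (\<Sum>k. ?g x k y)" for x y :: 'a
  proof (cases "x = y")
    case False
    define r where "r = norm (x - y)"
    have r: "r > 0" using False by (simp add: r_def)
    have "\<exists>k. ennreal (min 1 r powr p / r powr a) \<le> ?g x k y"
    proof (cases "r \<ge> 1")
      case True
      then obtain k :: nat where k: "2 powr real k \<le> r" "r < 2 powr (real k + 1)"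
        using dyadic_exponent_ge_1 by blast
      have "(2 powr real k) powr a \<le> r powr a" using n k by (intro powr_mono2) auto
      then have "1 / r powr a \<le> 1 / (2 powr real k) powr a" using r by (intro divide_left_mono) auto
      also have "\<dots> = d k" by (simp add: d_def powr_powr powr_minus field_simps)
      finally have "min 1 r powr p / r powr a \<le> d k" using True by simp
      then have "ennreal (min 1 r powr p / r powr a) \<le> ennreal (d k)" by (rule ennreal_leI)
      also have "y \<in> ?D x k" using k by (simp add: dist_norm r_def)
      then have "ennreal (d k) \<le> ?g x k y" by simp
      finally show ?thesis by blast
    next
      case False
      then have "1 \<le> 1 / r" using r by simp
      then obtain k :: nat where k: "2 powr real k \<le> 1 / r" "1 / r < 2 powr (real k + 1)"
        using dyadic_exponent_ge_1 by blast
      have le: "r \<le> 2 powr (- real k)" using k r by (simp add: powr_minus field_simps)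
      have ge: "2 powr (- (real k + 1)) \<le> r"
        using k r unfolding powr_minus_divide by (simp add: divide_simps mult.commute)
      have "r powr p / r powr a \<le> (2 powr (- real k)) powr p / (2 powr (- (real k + 1))) powr a"
        using r le ge n assms by (intro frac_le powr_mono2) auto
      also have "\<dots> = c k"
        by (simp add: c_def powr_powr powr_diff[symmetric] algebra_simps)
      finally have "min 1 r powr p / r powr a \<le> c k" using False by simp
      then have "ennreal (min 1 r powr p / r powr a) \<le> ennreal (c k)" by (rule ennreal_leI)
      also have "y \<in> ?B x k"
        using le_less_trans[OF le, of "2 powr (1 - real k)"] by (simp add: dist_norm r_def)
      then have "ennreal (c k) \<le> ?g x k y" by simp
      finally show ?thesis by blast
    qed
    then obtain k where "ennreal (min 1 r powr p / r powr a) \<le> ?g x k y" by blast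
    also have "?g x k y = sum (\<lambda>k. ?g x k y) {k}" by simp
    also have "\<dots> \<le> (\<Sum>k. ?g x k y)" by (rule sum_le_suminf) auto
    finally show ?thesis by (simp add: r_def)
  qed simp
  define C where "C = (\<Sum>k. \<omega> * 2 powr (a + n) * (2 powr (s * p - p)) ^ k + \<omega> * 2 powr n * (2 powr (- (s * p))) ^ k)"
  have s1: "summable (\<lambda>k. \<omega> * 2 powr (a + n) * (2 powr (s * p - p)) ^ k + \<omega> * 2 powr n * (2 powr (- (s * p))) ^ k)"
  proof (intro summable_add summable_mult summable_geometric)
    have "s * p < 1 * p" using assms by (intro mult_strict_right_mono) auto
    then show "norm (2 powr (s * p - p)) < 1" by (auto intro!: powr_less_one)
    show "norm (2 powr (- (s * p))) < 1" using assms by (auto intro!: powr_less_one)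
  qed
  have "(\<integral>\<^sup>+y. ennreal (min 1 (norm (x - y)) powr p / norm (x - y) powr a) \<partial>lebesgue) \<le> ennreal C" for x :: 'a
  proof -
    have [measurable]: "ball x t \<in> sets lebesgue" for t by simp
    have eb: "emeasure lebesgue (ball x (2 powr t)) = ennreal (\<omega> * 2 powr (t * n))" for t
      by (simp add: emeasure_ball \<omega>_def n_def powr_powr[symmetric] powr_realpow)
    have int_g: "(\<integral>\<^sup>+y. ?g x k y \<partial>lebesgue)
        = ennreal (\<omega> * 2 powr (a + n) * (2 powr (s * p - p)) ^ k + \<omega> * 2 powr n * (2 powr (- (s * p))) ^ k)" for k
    proof -
      have "(\<integral>\<^sup>+y. ?g x k y \<partial>lebesgue) = ennreal (c k) * emeasure lebesgue (?B x k) + ennreal (d k) * emeasure lebesgue (?D x k)"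
        by (subst nn_integral_add) (auto simp: nn_integral_cmult_indicator)
      also have "\<dots> = ennreal (c k * (\<omega> * 2 powr ((1 - real k) * n)) + d k * (\<omega> * 2 powr ((real k + 1) * n)))"
        unfolding eb using cd \<omega> by (simp add: ennreal_mult'[symmetric])
      also have "c k * (\<omega> * 2 powr ((1 - real k) * n)) = \<omega> * 2 powr (a + n) * (2 powr (s * p - p)) ^ k"
        by (simp add: c_def powr_realpow[symmetric] powr_powr powr_add[symmetric] a_def algebra_simps)
      also have "d k * (\<omega> * 2 powr ((real k + 1) * n)) = \<omega> * 2 powr n * (2 powr (- (s * p))) ^ k"
        by (simp add: d_def powr_realpow[symmetric] powr_powr powr_add[symmetric] a_def algebra_simps)
      finally show ?thesis .
    qed
    have "(\<integral>\<^sup>+y. ennreal (min 1 (norm (x - y)) powr p / norm (x - y) powr a) \<partial>lebesgue)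
        \<le> (\<integral>\<^sup>+y. (\<Sum>k. ?g x k y) \<partial>lebesgue)"
      by (intro nn_integral_mono pt)
    also have "\<dots> = (\<Sum>k. \<integral>\<^sup>+y. ?g x k y \<partial>lebesgue)"
      by (rule nn_integral_suminf) measurable
    also have "\<dots> = (\<Sum>k. ennreal (\<omega> * 2 powr (a + n) * (2 powr (s * p - p)) ^ k + \<omega> * 2 powr n * (2 powr (- (s * p))) ^ k))"
      by (simp only: int_g)
    also have "\<dots> = ennreal C"
      unfolding C_def using s1 \<omega> by (intro suminf_ennreal2) auto
    finally show ?thesis .
  qed
  then show ?thesis by (auto simp: a_def n_def)
qed

lemma Lipschitz_in_Wsp_tilde:
  fixes \<phi> :: "'a::euclidean_space \<Rightarrow> real"
  assumes sp: "0 < s" "s < 1" "1 < p" and \<Omega>: "\<Omega> \<in> sets lebesgue" "bounded \<Omega>"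
    and lip: "\<And>x y. \<bar>\<phi> x - \<phi> y\<bar> \<le> L * norm (x - y)" and bd: "\<And>x. \<bar>\<phi> x\<bar> \<le> B"
    and z: "\<And>x. x \<notin> \<Omega> \<Longrightarrow> \<phi> x = 0"
  shows "\<phi> \<in> Wsp_tilde s p \<Omega>"
proof -
  note [measurable] = \<Omega>(1)
  define a where "a = real DIM('a) + s * p"
  define k where "k z = min 1 (norm (fst z - snd z)) powr p / norm (fst z - snd z) powr a" for z :: "'a \<times> 'a"
  have k0: "0 \<le> k z" for z by (simp add: k_def)
  define K where "K = max \<bar>L\<bar> (2 * B)"
  have K0: "0 \<le> K" by (simp add: K_def)
  obtain C where C: "\<And>x::'a. (\<integral>\<^sup>+y. ennreal (k (x, y)) \<partial>lebesgue) \<le> ennreal C"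
    using truncated_kernel_bound[OF sp, where 'a = 'a] by (auto simp: k_def a_def)
  have ksym: "k (x, y) = k (y, x)" for x y by (simp add: k_def norm_minus_commute)
  have [measurable]: "k \<in> borel_measurable (lebesgue \<Otimes>\<^sub>M lebesgue)"
    unfolding k_def by measurable
  have "\<bar>L\<bar>-lipschitz_on UNIV \<phi>"
    using order_trans[OF lip mult_right_mono[OF abs_ge_self norm_ge_zero]]
    by (intro lipschitz_onI) (auto simp: dist_real_def dist_norm)
  then have "continuous_on UNIV \<phi>" by (rule lipschitz_on_continuous_on)
  then have "\<phi> \<in> borel_measurable borel" by (rule borel_measurable_continuous_onI)
  then have [measurable]: "\<phi> \<in> borel_measurable lebesgue"
    by (intro measurable_completion) simp
  have fin: "emeasure lebesgue \<Omega> < \<infinity>" 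
    using fmeasurableD2[OF bounded_set_imp_lmeasurable[OF \<Omega>(2,1)]]
    unfolding less_top infinity_ennreal_def .
  have "integrable lebesgue (\<lambda>x. \<bar>\<phi> x\<bar> powr p)"
  proof (rule Bochner_Integration.integrable_bound)
    show "integrable lebesgue (\<lambda>x. B powr p * indicator \<Omega> x)"
      using fin \<Omega> by (intro integrable_mult_right integrable_real_indicator) auto
    show "AE x in lebesgue. norm (\<bar>\<phi> x\<bar> powr p) \<le> norm (B powr p * indicator \<Omega> x)"
      using bd z sp by (auto simp: indicator_def intro!: powr_mono2)
  qed measurable
  moreover have "integrable (lebesgue \<Otimes>\<^sub>M lebesgue) (gagliardo_integrand s p \<phi>)"
  proof (rule integrableI_nonneg)
    have diff: "\<bar>\<phi> x - \<phi> y\<bar> \<le> K * min 1 (norm (x - y))" for x y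
    proof -
      have "L * norm (x - y) \<le> K * norm (x - y)" by (intro mult_right_mono) (auto simp: K_def)
      moreover have "\<bar>\<phi> x - \<phi> y\<bar> \<le> K" using bd[of x] bd[of y] by (auto simp: K_def)
      ultimately show ?thesis using lip[of x y] by (auto simp: min_def)
    qed
    have pt: "gagliardo_integrand s p \<phi> (x, y) \<le> K powr p * k (x, y) * (indicator \<Omega> x + indicator \<Omega> y)" for x y
    proof (cases "x \<in> \<Omega> \<or> y \<in> \<Omega>")
      case True
      have "gagliardo_integrand s p \<phi> (x, y) \<le> (K * min 1 (norm (x - y))) powr p / norm (x - y) powr a"
        using diff[of x y] sp unfolding gagliardo_integrand_def by (auto simp: a_def intro!: divide_right_mono powr_mono2)
      also have "\<dots> = K powr p * k (x, y)" using K0 by (simp add: k_def powr_mult)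
      also have "\<dots> \<le> K powr p * k (x, y) * (indicator \<Omega> x + indicator \<Omega> y)"
        using True k0[of "(x, y)"] by (auto simp: indicator_def)
      finally show ?thesis .
    qed (use z in \<open>auto simp: gagliardo_integrand_def\<close>)
    have "(\<integral>\<^sup>+z. ennreal (gagliardo_integrand s p \<phi> z) \<partial>(lebesgue \<Otimes>\<^sub>M lebesgue))
        \<le> (\<integral>\<^sup>+z. ennreal (K powr p * k z * indicator \<Omega> (fst z)) + ennreal (K powr p * k z * indicator \<Omega> (snd z)) \<partial>(lebesgue \<Otimes>\<^sub>M lebesgue))"
      using pt k0 by (intro nn_integral_mono) (auto simp: ennreal_plus[symmetric] distrib_left simp del: ennreal_plus intro!: ennreal_leI)
    also have "\<dots> = (\<integral>\<^sup>+z. ennreal (K powr p * k z * indicator \<Omega> (fst z)) \<partial>(lebesgue \<Otimes>\<^sub>M lebesgue))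
        + (\<integral>\<^sup>+z. ennreal (K powr p * k z * indicator \<Omega> (snd z)) \<partial>(lebesgue \<Otimes>\<^sub>M lebesgue))"
      by (rule nn_integral_add) measurable
    also have "(\<integral>\<^sup>+z. ennreal (K powr p * k z * indicator \<Omega> (snd z)) \<partial>(lebesgue \<Otimes>\<^sub>M lebesgue))
        = (\<integral>\<^sup>+y. (\<integral>\<^sup>+x. ennreal (K powr p * k (x, y) * indicator \<Omega> y) \<partial>lebesgue) \<partial>lebesgue)"
      by (subst leb_pair.nn_integral_snd[of "\<lambda>z. ennreal (K powr p * k z * indicator \<Omega> (snd z))", symmetric]) simp_all
    also have "\<dots> = (\<integral>\<^sup>+x. (\<integral>\<^sup>+y. ennreal (K powr p * k (x, y) * indicator \<Omega> x) \<partial>lebesgue) \<partial>lebesgue)"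
      by (simp add: ksym)
    also have "(\<integral>\<^sup>+z. ennreal (K powr p * k z * indicator \<Omega> (fst z)) \<partial>(lebesgue \<Otimes>\<^sub>M lebesgue))
        = (\<integral>\<^sup>+x. (\<integral>\<^sup>+y. ennreal (K powr p * k (x, y) * indicator \<Omega> x) \<partial>lebesgue) \<partial>lebesgue)"
      by (subst leb.nn_integral_fst[of "\<lambda>z. ennreal (K powr p * k z * indicator \<Omega> (fst z))", symmetric]) simp_all
    finally have *: "(\<integral>\<^sup>+z. ennreal (gagliardo_integrand s p \<phi> z) \<partial>(lebesgue \<Otimes>\<^sub>M lebesgue))
        \<le> 2 * (\<integral>\<^sup>+x. (\<integral>\<^sup>+y. ennreal (K powr p * k (x, y) * indicator \<Omega> x) \<partial>lebesgue) \<partial>lebesgue)"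
      by (simp add: mult_2)
    have "(\<integral>\<^sup>+x. (\<integral>\<^sup>+y. ennreal (K powr p * k (x, y) * indicator \<Omega> x) \<partial>lebesgue) \<partial>lebesgue)
        \<le> (\<integral>\<^sup>+x. ennreal (K powr p) * ennreal C * indicator \<Omega> x \<partial>lebesgue)"
    proof (intro nn_integral_mono)
      fix x :: 'a
      have m: "(\<lambda>y. k (x, y)) \<in> borel_measurable lebesgue"
        by measurable
      have "(\<integral>\<^sup>+y. ennreal (K powr p * k (x, y)) \<partial>lebesgue) = ennreal (K powr p) * (\<integral>\<^sup>+y. ennreal (k (x, y)) \<partial>lebesgue)"
        using m k0 by (simp add: ennreal_mult nn_integral_cmult)
      then show "(\<integral>\<^sup>+y. ennreal (K powr p * k (x, y) * indicator \<Omega> x) \<partial>lebesgue) \<le> ennreal (K powr p) * ennreal C * indicator \<Omega> x"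
        using C[of x] by (auto simp: indicator_def intro!: mult_left_mono)
    qed
    also have "\<dots> = ennreal (K powr p) * ennreal C * emeasure lebesgue \<Omega>"
      using \<Omega> by (simp add: nn_integral_cmult_indicator)
    also have "\<dots> < \<infinity>" using fin by (auto simp: ennreal_mult_less_top)
    finally have "2 * (\<integral>\<^sup>+x. (\<integral>\<^sup>+y. ennreal (K powr p * k (x, y) * indicator \<Omega> x) \<partial>lebesgue) \<partial>lebesgue) < \<infinity>"
      by (auto simp: ennreal_mult_less_top)
    with * show "(\<integral>\<^sup>+z. ennreal (gagliardo_integrand s p \<phi> z) \<partial>(lebesgue \<Otimes>\<^sub>M lebesgue)) < \<infinity>"
      by (rule le_less_trans)
  qed (auto simp: gagliardo_integrand_nonneg)
  ultimately show ?thesis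
    using z \<Omega> by (auto simp: Wsp_tilde_iff)
qed

section \<open>The fractional Sobolev inequality\<close>

lemma Holder_inequality:
  fixes f g :: "'b \<Rightarrow> real"
  assumes ab: "1 < a" "1 < b" "1 / a + 1 / b = 1"
    and [measurable]: "f \<in> borel_measurable M" "g \<in> borel_measurable M"
    and nn: "\<And>x. 0 \<le> f x" "\<And>x. 0 \<le> g x"
    and fa: "integrable M (\<lambda>x. f x powr a)" and gb: "integrable M (\<lambda>x. g x powr b)"
  shows "integrable M (\<lambda>x. f x * g x)"
    and "(LINT x|M. f x * g x) \<le> (LINT x|M. f x powr a) powr (1 / a) * (LINT x|M. g x powr b) powr (1 / b)"
proof -
  define A where "A = (LINT x|M. f x powr a)"
  define B where "B = (LINT x|M. g x powr b)"
  have A0: "0 \<le> A" and B0: "0 \<le> B" unfolding A_def B_def by (auto intro!: integral_nonneg_AE)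
  show int: "integrable M (\<lambda>x. f x * g x)"
  proof (rule Bochner_Integration.integrable_bound)
    show "integrable M (\<lambda>x. f x powr a / a + g x powr b / b)" using fa gb by auto
    show "AE x in M. norm (f x * g x) \<le> norm (f x powr a / a + g x powr b / b)"
      using Youngs_inequality[OF ab nn] ab nn by (intro AE_I2) (auto intro: order_trans[OF _ abs_ge_self])
  qed measurable
  show "(LINT x|M. f x * g x) \<le> A powr (1 / a) * B powr (1 / b)"
  proof (cases "A = 0 \<or> B = 0")
    case True
    then have "(AE x in M. f x powr a = 0) \<or> (AE x in M. g x powr b = 0)"
      unfolding A_def B_def using fa gb by (simp add: integral_nonneg_eq_0_iff_AE)
    then have "AE x in M. f x * g x = 0"
      by (auto elim!: eventually_mono)
    then have "(LINT x|M. f x * g x) = 0" by (rule integral_eq_zero_AE)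
    then show ?thesis by simp
  next
    case False
    then have pos: "0 < A" "0 < B" using A0 B0 by auto
    define A' where "A' = A powr (1 / a)"
    define B' where "B' = B powr (1 / b)"
    have pos': "0 < A'" "0 < B'" using pos by (auto simp: A'_def B'_def)
    have pw: "A' powr a = A" "B' powr b = B" using pos ab by (auto simp: A'_def B'_def powr_powr)
    have pt: "f x * g x \<le> A' * B' * (f x powr a / (a * A) + g x powr b / (b * B))" for x
    proof -
      have "f x / A' * (g x / B') \<le> (f x / A') powr a / a + (g x / B') powr b / b"
        using Youngs_inequality[OF ab, of "f x / A'" "g x / B'"] nn pos' by simp
      also have "\<dots> = f x powr a / (a * A) + g x powr b / (b * B)"
        using pos' nn pw by (simp add: powr_divide mult.commute)
      finally show ?thesis using pos' by (simp add: field_simps)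
    qed
    have "(LINT x|M. f x * g x) \<le> (LINT x|M. A' * B' * (f x powr a / (a * A) + g x powr b / (b * B)))"
      using fa gb int pt by (intro integral_mono) auto
    also have "\<dots> = A' * B' * (A / (a * A) + B / (b * B))"
      using fa gb by (simp add: A_def B_def)
    also have "\<dots> = A' * B'" using pos ab by (simp add: divide_simps)
    finally show ?thesis by (simp add: A'_def B'_def)
  qed
qed

context
  fixes s p q b :: real and \<Omega> :: "'a::euclidean_space set"
  assumes s: "0 < s" and p: "1 < p" and q: "1 < q" and b: "b = q / (q - 1)"
    and nq: "real DIM('a) / (s * p) < q"
    and \<Omega>: "\<Omega> \<in> sets lebesgue" "bounded \<Omega>"
begin

private lemma conj_exponent: "1 < b" "1 / q + 1 / b = 1"
  using q by (auto simp: b field_simps)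

text \<open>The inequality \<open>|u(x)|\<^sup>p \<le> 2\<^sup>p (|u(x) - u(y)|\<^sup>p + |u(y)|\<^sup>p)\<close> integrated over \<open>y\<close> in the ball of radius \<open>r\<close>
  around \<open>x\<close>, with Hoelder's inequality for the last term.\<close>

lemma Sobolev_pointwise:
  fixes u :: "'a \<Rightarrow> real"
  assumes u: "u \<in> Wsp_tilde s p \<Omega>" and ub: "integrable lebesgue (\<lambda>x. \<bar>u x\<bar> powr (p * b))"
    and gx: "integrable lebesgue (\<lambda>y. gagliardo_integrand s p u (x, y))" and r: "0 < r"
  defines "\<omega> \<equiv> unit_ball_vol (real DIM('a))"
  shows "\<omega> * r powr DIM('a) * \<bar>u x\<bar> powr p \<le> 2 powr p * (r powr (DIM('a) + s * p) * (LINT y|lebesgue. gagliardo_integrand s p u (x, y))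
      + (\<omega> * r powr DIM('a)) powr (1 / q) * (LINT y|lebesgue. \<bar>u y\<bar> powr (p * b)) powr (1 / b))"
proof -
  have [measurable]: "u \<in> borel_measurable lebesgue" using Wsp_tilde_measurable[OF p \<Omega>(1) u] .
  let ?B = "ball x r" and ?a = "real DIM('a) + s * p"
  have [measurable]: "?B \<in> sets lebesgue" by simp
  have mB: "measure lebesgue ?B = \<omega> * r powr DIM('a)"
    using r by (simp add: content_ball \<omega>_def powr_realpow)
  have finB: "emeasure lebesgue ?B < \<infinity>"
    using fmeasurableD2[OF bounded_set_imp_lmeasurable[of ?B]] unfolding less_top infinity_ennreal_def by simp
  have iB: "integrable lebesgue (indicator ?B :: 'a \<Rightarrow> real)"
    using finB by (intro integrable_real_indicator) auto
  have pw: "(\<bar>u y\<bar> powr p) powr b = \<bar>u y\<bar> powr (p * b)" "(indicator ?B y :: real) powr q = indicator ?B y" for y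
    using q by (auto simp: powr_powr indicator_def)
  have H: "integrable lebesgue (\<lambda>y. indicator ?B y * \<bar>u y\<bar> powr p)"
      "(LINT y|lebesgue. indicator ?B y * \<bar>u y\<bar> powr p)
        \<le> (\<omega> * r powr DIM('a)) powr (1 / q) * (LINT y|lebesgue. \<bar>u y\<bar> powr (p * b)) powr (1 / b)"
    using Holder_inequality[OF q conj_exponent, of "indicator ?B :: 'a \<Rightarrow> real" lebesgue "\<lambda>y. \<bar>u y\<bar> powr p"] iB ub
    unfolding pw mB[symmetric] by auto
  have pt: "indicator ?B y * \<bar>u x\<bar> powr p \<le> 2 powr p * (r powr ?a * gagliardo_integrand s p u (x, y) + indicator ?B y * \<bar>u y\<bar> powr p)" for y
  proof (cases "y \<in> ?B")
    case True
    have "\<bar>u x - u y\<bar> powr p \<le> r powr ?a * gagliardo_integrand s p u (x, y)"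
    proof (cases "x = y")
      case False
      have "norm (x - y) powr ?a \<le> r powr ?a"
        using True s p by (intro powr_mono2) (auto simp: dist_norm)
      then have "\<bar>u x - u y\<bar> powr p * (norm (x - y) powr ?a) \<le> \<bar>u x - u y\<bar> powr p * (r powr ?a)"
        by (intro mult_left_mono) auto
      then show ?thesis using False by (simp add: gagliardo_integrand_def divide_simps mult.commute)
    qed (simp add: gagliardo_integrand_nonneg)
    then have le: "2 powr p * (\<bar>u x - u y\<bar> powr p + \<bar>u y\<bar> powr p) \<le> 2 powr p * (r powr ?a * gagliardo_integrand s p u (x, y) + \<bar>u y\<bar> powr p)"
      by (intro mult_left_mono) auto
    then show ?thesis
      using order_trans[OF powr_abs_add_le[of p "u x - u y" "u y"] le] p True by simp
  next
    case False
    then show ?thesis using gagliardo_integrand_nonneg[of s p u "(x, y)"] by simp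
  qed
  have "\<omega> * r powr DIM('a) * \<bar>u x\<bar> powr p = (LINT y|lebesgue. indicator ?B y * \<bar>u x\<bar> powr p)"
    using finB by (simp add: mB)
  also have "\<dots> \<le> (LINT y|lebesgue. 2 powr p * (r powr ?a * gagliardo_integrand s p u (x, y) + indicator ?B y * \<bar>u y\<bar> powr p))"
    using iB gx H(1) pt by (intro integral_mono) auto
  also have "\<dots> = 2 powr p * (r powr ?a * (LINT y|lebesgue. gagliardo_integrand s p u (x, y)) + (LINT y|lebesgue. indicator ?B y * \<bar>u y\<bar> powr p))"
    using gx H(1) by simp
  finally show ?thesis
    using H(2) by (elim order_trans) (auto intro!: mult_left_mono)
qed

text \<open>An a priori estimate: it presupposes that the \<open>L\<^bsup>pb\<^esup>\<close> norm is finite, because a power of this norm is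
  cancelled at the end. Here \<open>b\<close> is the exponent conjugate to \<open>q\<close>.\<close>

lemma Sobolev_bounded:
  shows "\<exists>C\<ge>0. \<forall>u\<in>Wsp_tilde s p \<Omega>. integrable lebesgue (\<lambda>x. \<bar>u x\<bar> powr (p * b)) \<longrightarrow>
    (LINT x|lebesgue. \<bar>u x\<bar> powr (p * b)) powr (1 / b) \<le> C * gagliardo_energy s p u"
proof -
  define n where "n = real DIM('a)"
  define \<omega> where "\<omega> = unit_ball_vol n"
  define \<theta> where "\<theta> = s * p * b / n"
  define m where "m = measure lebesgue \<Omega> + 1"
  define C1 where "C1 = 2 powr (p + 1) * \<omega> powr (- 1 - s * p / n) * 2 powr ((p + 1) * \<theta>)"
  define C where "C = 2 * ((2 * m) powr (- ((b - 1 - \<theta>) / b)) * C1)"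
  have n: "0 < n" and \<omega>: "0 < \<omega>" and m: "0 < m"
    by (auto simp: n_def \<omega>_def m_def intro: unit_ball_vol_pos add_nonneg_pos)
  have b1: "1 < b" using conj_exponent by simp
  have C1: "0 \<le> C1" by (simp add: C1_def)
  have \<theta>: "0 < \<theta>" using s p b1 n by (simp add: \<theta>_def)
  have b\<theta>: "b \<le> 1 + \<theta>"
  proof -
    have "1 / q \<le> s * p / n" using nq s p q n by (simp add: n_def field_simps)
    then have "b * (1 / q) \<le> b * (s * p / n)" using b1 by (intro mult_left_mono) auto
    moreover have "b * (1 / q) = b - 1" using q by (simp add: b field_simps)
    ultimately show ?thesis by (simp add: \<theta>_def algebra_simps)
  qed
  have main: "(LINT x|lebesgue. \<bar>u x\<bar> powr (p * b)) powr (1 / b) \<le> C * gagliardo_energy s p u"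
    if u: "u \<in> Wsp_tilde s p \<Omega>" and ub: "integrable lebesgue (\<lambda>x. \<bar>u x\<bar> powr (p * b))" for u :: "'a \<Rightarrow> real"
  proof -
    define U where "U = (LINT x|lebesgue. \<bar>u x\<bar> powr (p * b)) powr (1 / b)"
    have U0: "0 \<le> U" by (simp add: U_def)
    have Ub: "U powr b = (LINT x|lebesgue. \<bar>u x\<bar> powr (p * b))"
      using b1 by (simp add: U_def powr_powr integral_nonneg_AE)
    note E0 = gagliardo_energy_nonneg[of s p u]
    define g where "g x = (LINT y|lebesgue. gagliardo_integrand s p u (x, y))" for x
    have g0: "0 \<le> g x" for x unfolding g_def by (intro integral_nonneg_AE AE_I2 gagliardo_integrand_nonneg)
    have iG: "integrable (lebesgue \<Otimes>\<^sub>M lebesgue) (gagliardo_integrand s p u)"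
      using Wsp_tilde_integrable_gagliardo[OF p \<Omega>(1) u] .
    have ig: "integrable lebesgue g" unfolding g_def using leb_pair.integrable_fst'[OF iG] .
    have gE: "(LINT x|lebesgue. g x) = gagliardo_energy s p u"
      unfolding g_def gagliardo_energy_def using leb_pair.integral_fst'[OF iG] .
    show ?thesis
    proof (cases "U = 0")
      case True
      then show ?thesis using E0 m C1 by (simp add: U_def[symmetric] C_def)
    next
      case False
      then have Upos: "0 < U" using U0 by simp
      have "AE x in lebesgue. integrable lebesgue (\<lambda>y. gagliardo_integrand s p u (x, y))"
        using leb_pair.AE_integrable_fst'[OF iG] .
      then have pt: "AE x in lebesgue. (\<bar>u x\<bar> powr p) powr (1 + \<theta>) \<le> C1 * g x * U powr \<theta>"
      proof (rule AE_mp, intro AE_I2 impI)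
        fix x assume gx: "integrable lebesgue (\<lambda>y. gagliardo_integrand s p u (x, y))"
        define t where "t = \<bar>u x\<bar> powr p"
        show "(\<bar>u x\<bar> powr p) powr (1 + \<theta>) \<le> C1 * g x * U powr \<theta>"
        proof (cases "t = 0")
          case True
          then show ?thesis using C1 g0 by (simp add: t_def)
        next
          case False
          then have t: "0 < t" by (simp add: t_def)
          \<comment> \<open>The radius is such that the last term of the pointwise inequality is half of its left-hand side.\<close>
          define z where "z = 2 powr (p + 1) * U / t"
          have z: "0 < z" using t Upos by (simp add: z_def)
          define r where "r = (z powr b / \<omega>) powr (1 / n)"
          have r: "0 < r" using z \<omega> by (simp add: r_def)
          have rn: "\<omega> * r powr n = z powr b" using n z \<omega> by (simp add: r_def powr_powr)
          have bq: "b * (1 / q) = b - 1" using q by (simp add: b field_simps)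
          have "z powr b * t \<le> 2 powr p * (r powr (n + s * p) * g x + (z powr b) powr (1 / q) * U)"
            using Sobolev_pointwise[OF u ub gx r] by (simp add: n_def[symmetric] \<omega>_def[symmetric] rn t_def g_def U_def)
          also have "(z powr b) powr (1 / q) = z powr b / z" using z bq by (simp add: powr_powr powr_diff)
          also have "2 powr p * (r powr (n + s * p) * g x + z powr b / z * U) = 2 powr p * r powr (n + s * p) * g x + z powr b * t / 2"
            using t Upos by (simp add: z_def powr_add field_simps)
          finally have "z powr b * t \<le> 2 powr (p + 1) * r powr (n + s * p) * g x"
            by (simp add: powr_add)
          also have "r powr (n + s * p) = z powr b / \<omega> * r powr (s * p)"
            using rn \<omega> by (simp add: powr_add field_simps)
          also have "r powr (s * p) = z powr \<theta> * \<omega> powr (- (s * p / n))"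
            using z \<omega> by (simp add: r_def powr_powr powr_divide powr_minus \<theta>_def field_simps)
          finally have "z powr b * t \<le> z powr b * (2 powr (p + 1) * (\<omega> powr (- (s * p / n)) / \<omega>) * z powr \<theta> * g x)"
            by (simp add: field_simps)
          then have "t \<le> 2 powr (p + 1) * (\<omega> powr (- (s * p / n)) / \<omega>) * z powr \<theta> * g x"
            using z by (subst (asm) mult_le_cancel_left_pos) auto
          also have "\<omega> powr (- (s * p / n)) / \<omega> = \<omega> powr (- 1 - s * p / n)"
            using \<omega> by (simp add: powr_diff powr_minus field_simps)
          also have "z powr \<theta> = 2 powr ((p + 1) * \<theta>) * U powr \<theta> / t powr \<theta>"
            using t Upos by (simp add: z_def powr_divide powr_mult powr_powr)
          finally have "t * t powr \<theta> \<le> C1 * g x * U powr \<theta>"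
            using t by (simp add: C1_def field_simps)
          then show ?thesis using t by (simp add: t_def[symmetric] powr_add)
        qed
      qed
      \<comment> \<open>At this level, the part of \<open>\<Omega>\<close> where \<open>|u|\<^sup>p \<le> K\<close> carries at most half of \<open>U\<^sup>b\<close>; above it, the exponent \<open>b\<close> may be raised to \<open>1 + \<theta>\<close>.\<close>
      define K where "K = U / (2 * m) powr (1 / b)"
      have K: "0 < K" using Upos m by (simp add: K_def)
      have pt2: "AE x in lebesgue. \<bar>u x\<bar> powr (p * b) \<le> K powr b * indicator \<Omega> x + K powr (b - 1 - \<theta>) * (C1 * g x * U powr \<theta>)"
        using pt
      proof (rule AE_mp, intro AE_I2 impI)
        fix x assume h: "(\<bar>u x\<bar> powr p) powr (1 + \<theta>) \<le> C1 * g x * U powr \<theta>"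
        define t where "t = \<bar>u x\<bar> powr p"
        have tb: "\<bar>u x\<bar> powr (p * b) = t powr b" by (simp add: t_def powr_powr)
        have nn: "0 \<le> K powr (b - 1 - \<theta>) * (C1 * g x * U powr \<theta>)" using C1 g0 by simp
        show "\<bar>u x\<bar> powr (p * b) \<le> K powr b * indicator \<Omega> x + K powr (b - 1 - \<theta>) * (C1 * g x * U powr \<theta>)"
        proof (cases "x \<in> \<Omega>")
          case False
          then have "u x = 0" using Wsp_tilde_zero[OF p \<Omega>(1) u] by blast
          then show ?thesis using nn False by simp
        next
          case True
          show ?thesis
          proof (cases "t \<le> K")
            case le: True
            then have "t powr b \<le> K powr b" using b1 by (intro powr_mono2) (auto simp: t_def)
            then show ?thesis using nn True tb by simp
          next
            case False
            then have tK: "K \<le> t" "0 < t" using K by auto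
            have "t powr (b - 1 - \<theta>) \<le> K powr (b - 1 - \<theta>)"
              using tK K b\<theta> by (intro powr_mono2') auto
            then have "t powr (b - 1 - \<theta>) * t powr (1 + \<theta>) \<le> K powr (b - 1 - \<theta>) * (C1 * g x * U powr \<theta>)"
              using h by (intro mult_mono) (auto simp: t_def)
            moreover have "t powr (b - 1 - \<theta>) * t powr (1 + \<theta>) = t powr b" by (simp flip: powr_add)
            ultimately show ?thesis using tb by (simp add: add_increasing)
          qed
        qed
      qed
      have fin: "emeasure lebesgue \<Omega> < \<infinity>"
        using fmeasurableD2[OF bounded_set_imp_lmeasurable[OF \<Omega>(2,1)]] unfolding less_top infinity_ennreal_def .
      have i\<Omega>: "integrable lebesgue (indicator \<Omega> :: 'a \<Rightarrow> real)"
        using fin \<Omega> by (intro integrable_real_indicator) auto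
      have "U powr b \<le> (LINT x|lebesgue. K powr b * indicator \<Omega> x + K powr (b - 1 - \<theta>) * (C1 * g x * U powr \<theta>))"
        unfolding Ub using ub i\<Omega> ig pt2 by (intro integral_mono_AE) auto
      also have "\<dots> = K powr b * measure lebesgue \<Omega> + K powr (b - 1 - \<theta>) * (C1 * gagliardo_energy s p u * U powr \<theta>)"
        using i\<Omega> ig by (simp add: gE)
      also have "K powr b * measure lebesgue \<Omega> \<le> K powr b * m" by (intro mult_left_mono) (auto simp: m_def)
      also have "K powr b * m = U powr b / 2"
        using Upos m b1 by (simp add: K_def powr_divide powr_powr)
      also have "K powr (b - 1 - \<theta>) = U powr (b - 1 - \<theta>) * (2 * m) powr (- ((b - 1 - \<theta>) / b))"
        using Upos m b1 by (simp add: K_def powr_divide powr_powr powr_minus_divide)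
      finally have "U powr b \<le> C * gagliardo_energy s p u * (U powr (b - 1 - \<theta>) * U powr \<theta>)"
        by (simp add: C_def algebra_simps)
      also have "U powr (b - 1 - \<theta>) * U powr \<theta> = U powr b / U"
        using Upos powr_add[of U "b - 1 - \<theta>" \<theta>] powr_diff[of U b 1] by simp
      finally have "U powr b \<le> C * gagliardo_energy s p u * (U powr b / U)" .
      then have "U \<le> C * gagliardo_energy s p u" using Upos by (simp add: field_simps)
      then show ?thesis by (simp only: U_def)
    qed
  qed
  have "0 \<le> C" using C1 m by (simp add: C_def)
  then show ?thesis using main by blast
qed

text \<open>Truncations are bounded, hence have a finite norm; the a priori estimate is uniform over them and
  passes to the limit by Fatou's lemma.\<close>

lemma Sobolev_inequality:
  obtains C where "0 \<le> C"
    "\<And>u. u \<in> Wsp_tilde s p \<Omega> \<Longrightarrow> integrable lebesgue (\<lambda>x. \<bar>u x\<bar> powr (p * b))"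
    "\<And>u. u \<in> Wsp_tilde s p \<Omega> \<Longrightarrow>
       (LINT x|lebesgue. \<bar>u x\<bar> powr (p * b)) powr (1 / b) \<le> C * gagliardo_energy s p u"
proof -
  obtain C where C: "C \<ge> 0" "\<And>u. u \<in> Wsp_tilde s p \<Omega> \<Longrightarrow> integrable lebesgue (\<lambda>x. \<bar>u x\<bar> powr (p * b)) \<Longrightarrow>
    (LINT x|lebesgue. \<bar>u x\<bar> powr (p * b)) powr (1 / b) \<le> C * gagliardo_energy s p u"
    using Sobolev_bounded by blast
  have int: "integrable lebesgue (\<lambda>x. \<bar>u x\<bar> powr (p * b))" if u: "u \<in> Wsp_tilde s p \<Omega>" for u
  proof -
    have [measurable]: "u \<in> borel_measurable lebesgue" using Wsp_tilde_measurable[OF p \<Omega>(1) u] .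
    have b1: "1 < b" using conj_exponent by simp
    have pb: "0 < p * b" using p b1 by simp
    define v where "v k x = min \<bar>u x\<bar> (real k)" for k x
    have v: "v k \<in> Wsp_tilde s p \<Omega>" for k
      unfolding v_def using Wsp_tilde_truncate[OF p \<Omega>(1) u] by simp
    have [measurable]: "v k \<in> borel_measurable lebesgue" for k using Wsp_tilde_measurable[OF p \<Omega>(1) v] .
    have fin: "emeasure lebesgue \<Omega> < \<infinity>"
      using fmeasurableD2[OF bounded_set_imp_lmeasurable[OF \<Omega>(2,1)]] unfolding less_top infinity_ennreal_def .
    have iv: "integrable lebesgue (\<lambda>x. \<bar>v k x\<bar> powr (p * b))" for k
    proof (rule Bochner_Integration.integrable_bound)
      show "integrable lebesgue (\<lambda>x. real k powr (p * b) * indicator \<Omega> x)"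
        using fin \<Omega> by (intro integrable_mult_right integrable_real_indicator) auto
      show "AE x in lebesgue. norm (\<bar>v k x\<bar> powr (p * b)) \<le> norm (real k powr (p * b) * indicator \<Omega> x)"
        using pb Wsp_tilde_zero[OF p \<Omega>(1) v] by (auto simp: indicator_def v_def intro!: powr_mono2)
    qed measurable
    define D where "D = C * gagliardo_energy s p u"
    have bound: "(\<integral>\<^sup>+x. ennreal (\<bar>v k x\<bar> powr (p * b)) \<partial>lebesgue) \<le> ennreal (D powr b)" for k
    proof -
      have "gagliardo_energy s p (v k) \<le> gagliardo_energy s p u"
        by (rule gagliardo_energy_mono[OF p \<Omega>(1) u]) (auto simp: v_def)
      then have "(LINT x|lebesgue. \<bar>v k x\<bar> powr (p * b)) powr (1 / b) \<le> D"
        using C(2)[OF v iv] C(1) by (auto simp: D_def intro: order_trans mult_left_mono)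
      then have "((LINT x|lebesgue. \<bar>v k x\<bar> powr (p * b)) powr (1 / b)) powr b \<le> D powr b"
        using b1 by (intro powr_mono2) auto
      then have "(LINT x|lebesgue. \<bar>v k x\<bar> powr (p * b)) \<le> D powr b"
        using b1 by (simp add: powr_powr integral_nonneg_AE)
      then show ?thesis
        using iv by (subst nn_integral_eq_integral) (auto intro: ennreal_leI)
    qed
    have "(\<integral>\<^sup>+x. ennreal (\<bar>u x\<bar> powr (p * b)) \<partial>lebesgue) = (\<integral>\<^sup>+x. liminf (\<lambda>k. ennreal (\<bar>v k x\<bar> powr (p * b))) \<partial>lebesgue)"
    proof (rule nn_integral_cong)
      fix x
      obtain N where N: "\<bar>u x\<bar> \<le> real N" using real_arch_simple by blast
      have "eventually (\<lambda>k. ennreal (\<bar>v k x\<bar> powr (p * b)) = ennreal (\<bar>u x\<bar> powr (p * b))) sequentially"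
        using N by (intro eventually_sequentiallyI[of N]) (auto simp: v_def)
      then have "(\<lambda>k. ennreal (\<bar>v k x\<bar> powr (p * b))) \<longlonglongrightarrow> ennreal (\<bar>u x\<bar> powr (p * b))"
        by (rule tendsto_eventually)
      then show "ennreal (\<bar>u x\<bar> powr (p * b)) = liminf (\<lambda>k. ennreal (\<bar>v k x\<bar> powr (p * b)))"
        by (intro lim_imp_Liminf[symmetric]) auto
    qed
    also have "\<dots> \<le> liminf (\<lambda>k. \<integral>\<^sup>+x. ennreal (\<bar>v k x\<bar> powr (p * b)) \<partial>lebesgue)"
      by (rule nn_integral_liminf) measurable
    also have "\<dots> \<le> ennreal (D powr b)"
      using bound by (intro Liminf_le) (auto intro: always_eventually)
    also have "\<dots> < \<infinity>" by simp
    finally show ?thesis by (intro integrableI_nonneg) auto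
  qed
  show ?thesis using that[of C] C int by blast
qed

end

section \<open>Monotone rearrangements with tie-breaking\<close>

lemma one_over_Suc_antimono: "i \<le> j \<Longrightarrow> 1 / real (Suc j) \<le> 1 / real (Suc i)"
  by (simp add: frac_le)

lemma (in finite_measure) exists_quantile:
  fixes h :: "'a \<Rightarrow> real"
  assumes [measurable]: "h \<in> borel_measurable M" and t: "0 < t" "t < measure M (space M)"
  shows "\<exists>c. measure M {x \<in> space M. h x < c} \<le> t \<and> t \<le> measure M {x \<in> space M. h x \<le> c}"
proof -
  let ?F = "\<lambda>c. measure M {x \<in> space M. h x \<le> c}"
  have mono: "?F c \<le> ?F d" if "c \<le> d" for c d
    using that by (intro finite_measure_mono) auto
  define S where "S = {c. t \<le> ?F c}"
  have "(\<lambda>n. ?F (real n)) \<longlonglongrightarrow> measure M (\<Union>n. {x \<in> space M. h x \<le> real n})"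
    by (rule finite_Lim_measure_incseq) (auto simp: incseq_def)
  also have "(\<Union>n. {x \<in> space M. h x \<le> real n}) = space M"
    using real_arch_simple by auto
  finally have "eventually (\<lambda>n. t < ?F (real n)) sequentially"
    using t(2) by (rule order_tendstoD(1))
  then obtain N where "t < ?F (real N)" by (auto simp: eventually_sequentially)
  then have ne: "S \<noteq> {}" by (auto simp: S_def intro: less_imp_le)
  have "(\<lambda>n. ?F (- real n)) \<longlonglongrightarrow> measure M (\<Inter>n. {x \<in> space M. h x \<le> - real n})"
    by (rule finite_Lim_measure_decseq) (auto simp: decseq_def)
  also have "(\<Inter>n. {x \<in> space M. h x \<le> - real n}) = {}"
  proof -
    have False if "\<And>n. h x \<le> - real n" for x
    proof -
      obtain n where "- h x < real n" using reals_Archimedean2 by blast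
      then show False using that[of n] by simp
    qed
    then show ?thesis by auto
  qed
  finally have "(\<lambda>n. ?F (- real n)) \<longlonglongrightarrow> 0" by simp
  then have "eventually (\<lambda>n. ?F (- real n) < t) sequentially"
    using t(1) by (rule order_tendstoD(2))
  then obtain N' where N': "?F (- real N') < t" by (auto simp: eventually_sequentially)
  have bdd: "bdd_below S"
  proof (rule bdd_belowI)
    fix c assume "c \<in> S"
    then show "- real N' \<le> c" using N' mono[of c "- real N'"] by (force simp: S_def)
  qed
  define c where "c = Inf S"
  have above: "t \<le> ?F d" if cd: "c < d" for d
  proof -
    obtain e where "e \<in> S" "e < d" using cInf_lessD[of S d] cd ne unfolding c_def by blast
    then show ?thesis using mono[of e d] by (simp add: S_def)
  qed
  have below: "?F d < t" if "d < c" for d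
    using that bdd cInf_lower[of d S] by (force simp: S_def c_def)
  have "(\<lambda>n. ?F (c + 1 / real (Suc n))) \<longlonglongrightarrow> measure M (\<Inter>n. {x \<in> space M. h x \<le> c + 1 / real (Suc n)})"
    by (rule finite_Lim_measure_decseq)
      (auto simp: decseq_def simp del: of_nat_Suc dest!: one_over_Suc_antimono)
  also have "(\<Inter>n. {x \<in> space M. h x \<le> c + 1 / real (Suc n)}) = {x \<in> space M. h x \<le> c}"
  proof -
    have "h x \<le> c" if le: "\<And>n. h x \<le> c + 1 / real (Suc n)" for x
    proof (rule field_le_epsilon)
      fix e :: real assume "0 < e"
      then obtain n where "1 / real (Suc n) < e" using nat_approx_posE by blast
      then show "h x \<le> c + e" using le[of n] by simp
    qed
    moreover have "h x \<le> c + 1 / real (Suc n)" if "h x \<le> c" for x n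
      using that by (simp add: add_increasing2)
    ultimately show ?thesis by blast
  qed
  finally have l1: "t \<le> ?F c"
    by (rule LIMSEQ_le_const) (use above in auto)
  have "(\<lambda>n. ?F (c - 1 / real (Suc n))) \<longlonglongrightarrow> measure M (\<Union>n. {x \<in> space M. h x \<le> c - 1 / real (Suc n)})"
    by (rule finite_Lim_measure_incseq)
      (auto simp: incseq_def simp del: of_nat_Suc dest!: one_over_Suc_antimono)
  also have "(\<Union>n. {x \<in> space M. h x \<le> c - 1 / real (Suc n)}) = {x \<in> space M. h x < c}"
  proof -
    have "\<exists>n. h x \<le> c - 1 / real (Suc n)" if hx: "h x < c" for x
    proof -
      obtain n where "1 / real (Suc n) < c - h x" using nat_approx_posE[of "c - h x"] hx by auto
      then show ?thesis by (intro exI[of _ n]) simp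
    qed
    moreover have "h x < c" if "h x \<le> c - 1 / real (Suc n)" for x n
      using that by (smt (verit) of_nat_0_less_iff zero_less_Suc zero_less_divide_1_iff)
    ultimately show ?thesis by auto
  qed
  finally have l2: "measure M {x \<in> space M. h x < c} \<le> t"
    by (rule LIMSEQ_le_const2) (use below in \<open>auto intro!: exI[of _ 0] less_imp_le[OF below]\<close>)
  show ?thesis using l1 l2 by blast
qed

text \<open>The lexicographic order of the pairs \<open>(f x, \<tau> x)\<close>; the second component serves to break ties on the
  level sets of the first.\<close>

definition lex_less :: "('b \<Rightarrow> real) \<Rightarrow> ('b \<Rightarrow> real) \<Rightarrow> 'b \<Rightarrow> 'b \<Rightarrow> bool" where
  "lex_less f \<tau> x y \<longleftrightarrow> f x < f y \<or> (f x = f y \<and> \<tau> x < \<tau> y)"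

lemma lex_less_trans: "lex_less f \<tau> x y \<Longrightarrow> lex_less f \<tau> y z \<Longrightarrow> lex_less f \<tau> x z"
  by (auto simp: lex_less_def)

context finite_measure
begin

context
  fixes f \<tau> :: "'a \<Rightarrow> real"
  assumes f [measurable]: "f \<in> borel_measurable M" and \<tau> [measurable]: "\<tau> \<in> borel_measurable M"
    and null: "\<And>c. emeasure M {x \<in> space M. \<tau> x = c} = 0"
begin

text \<open>If the level sets of \<open>\<tau>\<close> are null sets, then every value between \<open>0\<close> and the total mass is the measure
  of an initial segment of the lexicographic order: a quantile of \<open>f\<close>, refined by a quantile of \<open>\<tau>\<close> on
  the critical level set of \<open>f\<close>.\<close>

lemma exists_lex_initial_set:
  assumes t: "0 \<le> t" "t \<le> measure M (space M)"
  shows "\<exists>A\<in>sets M. measure M A = t \<and> (\<forall>x\<in>A. \<forall>y\<in>space M. \<not> lex_less f \<tau> x y \<longrightarrow> y \<in> A)"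
proof -
  consider "t = 0" | "t = measure M (space M)" | "0 < t" "t < measure M (space M)" using t by linarith
  then show ?thesis
  proof cases
    case 1
    then show ?thesis by (intro bexI[of _ "{}"]) auto
  next
    case 2
    then show ?thesis by (intro bexI[of _ "space M"]) auto
  next
    case 3
    obtain c where c: "measure M {x \<in> space M. f x < c} \<le> t" "t \<le> measure M {x \<in> space M. f x \<le> c}"
      using exists_quantile[OF f 3] by blast
    let ?L = "{x \<in> space M. f x < c}" and ?E = "{x \<in> space M. f x = c}"
    have split: "measure M {x \<in> space M. f x \<le> c} = measure M ?L + measure M ?E"
      by (subst finite_measure_Union[symmetric]) (auto intro!: arg_cong[where f = "measure M"])
    consider "t = measure M ?L" | "t = measure M {x \<in> space M. f x \<le> c}" | "measure M ?L < t" "t < measure M ?L + measure M ?E"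
      using c split by linarith
    then show ?thesis
    proof cases
      case 1
      then show ?thesis by (intro bexI[of _ ?L]) (auto simp: lex_less_def)
    next
      case 2
      then show ?thesis by (intro bexI[of _ "{x \<in> space M. f x \<le> c}"]) (auto simp: lex_less_def)
    next
      case 3
      interpret E: finite_measure "restrict_space M ?E"
        by (rule finite_measure_restrict_space) (use finite_measure_axioms in auto)
      have mE: "measure (restrict_space M ?E) {x \<in> ?E. P x} = measure M {x \<in> ?E. P x}" for P
        by (rule measure_restrict_space) auto
      have sE: "space (restrict_space M ?E) = ?E" by (auto simp: space_restrict_space)
      have "\<exists>d. measure M {x \<in> ?E. \<tau> x < d} \<le> t - measure M ?L \<and> t - measure M ?L \<le> measure M {x \<in> ?E. \<tau> x \<le> d}"
        using E.exists_quantile[of \<tau> "t - measure M ?L"] 3 measurable_restrict_space1[OF \<tau>, of ?E] mE[of "\<lambda>_. True"]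
        unfolding sE mE by (auto simp: measure_restrict_space)
      then obtain d where d: "measure M {x \<in> ?E. \<tau> x < d} \<le> t - measure M ?L" "t - measure M ?L \<le> measure M {x \<in> ?E. \<tau> x \<le> d}"
        by blast
      have "measure M {x \<in> ?E. \<tau> x \<le> d} \<le> measure M {x \<in> ?E. \<tau> x < d} + measure M {x \<in> space M. \<tau> x = d}"
        by (rule order_trans[OF finite_measure_mono measure_Un_le]) auto
      also have "measure M {x \<in> space M. \<tau> x = d} = 0" using null[of d] by (simp add: measure_def)
      finally have eq: "measure M {x \<in> ?E. \<tau> x \<le> d} = t - measure M ?L"
        using d by simp
      have "measure M (?L \<union> {x \<in> ?E. \<tau> x \<le> d}) = t"
        using eq by (subst finite_measure_Union) auto
      then show ?thesis
        by (intro bexI[of _ "?L \<union> {x \<in> ?E. \<tau> x \<le> d}"]) (auto simp: lex_less_def)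
    qed
  qed
qed

text \<open>The measure of the strict predecessors of a point. As the level sets of \<open>\<tau>\<close> are null sets, it is
  uniformly distributed on the interval from \<open>0\<close> to the total mass.\<close>

definition lex_rank :: "'a \<Rightarrow> real" where
  "lex_rank x = measure M {y \<in> space M. lex_less f \<tau> y x}"

lemma lex_section_measurable [measurable]: "{y \<in> space M. lex_less f \<tau> y x} \<in> sets M"
  unfolding lex_less_def by measurable

lemma lex_rank_measurable [measurable]: "lex_rank \<in> borel_measurable M"
proof -
  have "Measurable.pred (M \<Otimes>\<^sub>M M) (\<lambda>z. lex_less f \<tau> (snd z) (fst z))"
    unfolding lex_less_def by measurable
  then have "{z \<in> space (M \<Otimes>\<^sub>M M). lex_less f \<tau> (snd z) (fst z)} \<in> sets (M \<Otimes>\<^sub>M M)"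
    by (simp add: pred_def)
  then have "(\<lambda>x. measure M (Pair x -` {z \<in> space (M \<Otimes>\<^sub>M M). lex_less f \<tau> (snd z) (fst z)})) \<in> borel_measurable M"
    unfolding measure_def by (intro borel_measurable_enn2real measurable_emeasure_Pair)
  moreover have "Pair x -` {z \<in> space (M \<Otimes>\<^sub>M M). lex_less f \<tau> (snd z) (fst z)} = {y \<in> space M. lex_less f \<tau> y x}"
    if "x \<in> space M" for x
    using that by (auto simp: space_pair_measure)
  ultimately have "(\<lambda>x. measure M {y \<in> space M. lex_less f \<tau> y x}) \<in> borel_measurable M"
    by (subst measurable_cong) auto
  then show ?thesis by (simp add: lex_rank_def[abs_def])
qed

lemma lex_rank_mono: "lex_less f \<tau> x y \<Longrightarrow> lex_rank x \<le> lex_rank y"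
  unfolding lex_rank_def by (intro finite_measure_mono) (auto intro: lex_less_trans)

lemma measure_lex_rank_less:
  assumes t: "0 \<le> t" "t \<le> measure M (space M)"
  shows "measure M {x \<in> space M. lex_rank x < t} = t"
proof (rule antisym)
  obtain A where A: "A \<in> sets M" "measure M A = t" "\<And>x y. x \<in> A \<Longrightarrow> y \<in> space M \<Longrightarrow> \<not> lex_less f \<tau> x y \<Longrightarrow> y \<in> A"
    using exists_lex_initial_set[OF t] by blast
  have "{x \<in> space M. lex_rank x < t} \<subseteq> A"
  proof
    fix x assume x: "x \<in> {x \<in> space M. lex_rank x < t}"
    show "x \<in> A"
    proof (rule ccontr)
      assume "x \<notin> A"
      then have "A \<subseteq> {y \<in> space M. lex_less f \<tau> y x}"
        using A x sets.sets_into_space by blast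
      then have "t \<le> lex_rank x"
        unfolding lex_rank_def A(2)[symmetric] by (intro finite_measure_mono) auto
      then show False using x by simp
    qed
  qed
  then show "measure M {x \<in> space M. lex_rank x < t} \<le> t"
    using A by (metis finite_measure_mono)
next
  have le: "r \<le> measure M {x \<in> space M. lex_rank x < t}" if r: "0 \<le> r" "r < t" for r
  proof -
    obtain A where A: "A \<in> sets M" "measure M A = r" "\<And>x y. x \<in> A \<Longrightarrow> y \<in> space M \<Longrightarrow> \<not> lex_less f \<tau> x y \<Longrightarrow> y \<in> A"
      using exists_lex_initial_set[of r] r t by auto
    have "lex_rank x \<le> r" if "x \<in> A" for x
    proof -
      have "{y \<in> space M. lex_less f \<tau> y x} \<subseteq> A"
        using A(3)[OF that] by (auto simp: lex_less_def)
      then show ?thesis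
        unfolding lex_rank_def A(2)[symmetric] using A(1) by (intro finite_measure_mono)
    qed
    then have "A \<subseteq> {x \<in> space M. lex_rank x < t}"
      using A(1) r sets.sets_into_space by fastforce
    then show ?thesis
      unfolding A(2)[symmetric] by (intro finite_measure_mono) auto
  qed
  show "t \<le> measure M {x \<in> space M. lex_rank x < t}"
  proof (cases "t = 0")
    case False
    then have "0 < t" using t by simp
    then show ?thesis
      using le by (intro dense_le_bounded[of 0 t]) auto
  qed simp
qed

text \<open>The rearrangement is the decreasing rearrangement of \<open>V\<^sub>0\<close> composed with \<open>lex_rank\<close>. The supremum that
  defines it is finite on the set \<open>G\<close> of points whose rank is neither \<open>0\<close> nor the total mass; outside this
  set of full measure the value is set to \<open>0\<close>, so monotonicity is claimed on \<open>G\<close> only.\<close>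

lemma exists_lex_antitone_rearrangement:
  fixes V0 :: "'a \<Rightarrow> real"
  assumes [measurable]: "V0 \<in> borel_measurable M" and pos: "0 < measure M (space M)"
  obtains V G where "V \<in> borel_measurable M"
    "\<And>a. measure M {x \<in> space M. a \<le> V x} = measure M {x \<in> space M. a \<le> V0 x}"
    "AE x in M. x \<in> G" "\<And>x y. x \<in> G \<Longrightarrow> y \<in> G \<Longrightarrow> lex_less f \<tau> x y \<Longrightarrow> V y \<le> V x"
proof -
  define m where "m a = measure M {x \<in> space M. a \<le> V0 x}" for a
  define total where "total = measure M (space M)"
  have m_bd: "0 \<le> m a" "m a \<le> total" for a
    unfolding m_def total_def by (auto intro!: finite_measure_mono)
  have m_anti: "m b \<le> m a" if "a \<le> b" for a b
    unfolding m_def using that by (intro finite_measure_mono) auto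
  define G where "G = {x \<in> space M. 0 < lex_rank x \<and> lex_rank x < total}"
  define V where "V x = (if x \<in> G then Sup {a. lex_rank x < m a} else 0)" for x
  have [measurable]: "G \<in> sets M" unfolding G_def by measurable
  have rank0: "measure M {x \<in> space M. lex_rank x \<le> 0} = 0"
  proof -
    have "measure M {x \<in> space M. lex_rank x \<le> 0} \<le> e" if "0 < e" for e
    proof -
      have "measure M {x \<in> space M. lex_rank x \<le> 0} \<le> measure M {x \<in> space M. lex_rank x < min e total}"
        using that pos by (intro finite_measure_mono) (auto simp: total_def)
      also have "\<dots> = min e total" using that by (intro measure_lex_rank_less) (auto simp: total_def)
      finally show ?thesis by simp
    qed
    then show ?thesis using field_le_epsilon[of "measure M {x \<in> space M. lex_rank x \<le> 0}" 0] measure_nonneg by (simp add: antisym)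
  qed
  have rank1: "measure M {x \<in> space M. total \<le> lex_rank x} = 0"
  proof -
    have "measure M {x \<in> space M. lex_rank x < total} + measure M {x \<in> space M. total \<le> lex_rank x} = total"
      unfolding total_def by (subst finite_measure_Union[symmetric]) (auto intro!: arg_cong[where f = "measure M"])
    then show ?thesis using measure_lex_rank_less[of total] by (simp add: total_def)
  qed
  have AE_G: "AE x in M. x \<in> G"
  proof (rule AE_I[where N = "{x \<in> space M. lex_rank x \<le> 0} \<union> {x \<in> space M. total \<le> lex_rank x}"])
    show "{x \<in> space M. x \<notin> G} \<subseteq> {x \<in> space M. lex_rank x \<le> 0} \<union> {x \<in> space M. total \<le> lex_rank x}"
      by (auto simp: G_def)
    have "measure M ({x \<in> space M. lex_rank x \<le> 0} \<union> {x \<in> space M. total \<le> lex_rank x}) \<le> 0 + 0"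
      using rank0 rank1 measure_Un_le[of "{x \<in> space M. lex_rank x \<le> 0}" M "{x \<in> space M. total \<le> lex_rank x}"]
      by simp
    then show "emeasure M ({x \<in> space M. lex_rank x \<le> 0} \<union> {x \<in> space M. total \<le> lex_rank x}) = 0"
      by (simp add: emeasure_eq_measure measure_le_0_iff)
  qed measurable
  have tends0: "(\<lambda>n. m (real n)) \<longlonglongrightarrow> 0"
  proof -
    have "(\<lambda>n. m (real n)) \<longlonglongrightarrow> measure M (\<Inter>n. {x \<in> space M. real n \<le> V0 x})"
      unfolding m_def by (rule finite_Lim_measure_decseq) (auto simp: decseq_def)
    also have "(\<Inter>n. {x \<in> space M. real n \<le> V0 x}) = {}"
      by (auto simp: not_le) (metis not_le reals_Archimedean2)
    finally show ?thesis by simp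
  qed
  have tends1: "(\<lambda>n. m (- real n)) \<longlonglongrightarrow> total"
  proof -
    have "(\<lambda>n. m (- real n)) \<longlonglongrightarrow> measure M (\<Union>n. {x \<in> space M. - real n \<le> V0 x})"
      unfolding m_def by (rule finite_Lim_measure_incseq) (auto simp: incseq_def)
    also have "(\<Union>n. {x \<in> space M. - real n \<le> V0 x}) = space M"
    proof -
      have "\<exists>n. - real n \<le> V0 x" for x
        using real_arch_simple[of "- V0 x"] by (auto simp: minus_le_iff)
      then show ?thesis by auto
    qed
    finally show ?thesis by (simp add: total_def)
  qed
  have S: "{a. lex_rank x < m a} \<noteq> {}" "bdd_above {a. lex_rank x < m a}" if "x \<in> G" for x
  proof -
    have "eventually (\<lambda>n. lex_rank x < m (- real n)) sequentially"
      using tends1 that by (intro order_tendstoD(1)[OF tends1]) (auto simp: G_def)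
    then show "{a. lex_rank x < m a} \<noteq> {}" by (auto simp: eventually_sequentially)
    have "eventually (\<lambda>n. m (real n) < lex_rank x) sequentially"
      using that by (intro order_tendstoD(2)[OF tends0]) (auto simp: G_def)
    then obtain N where N: "m (real N) < lex_rank x" by (auto simp: eventually_sequentially)
    show "bdd_above {a. lex_rank x < m a}"
    proof (rule bdd_aboveI)
      fix a assume "a \<in> {a. lex_rank x < m a}"
      then show "a \<le> real N" using N m_anti[of "real N" a] by force
    qed
  qed
  have V_ge: "a \<le> V x \<longleftrightarrow> (\<forall>n. lex_rank x < m (a - 1 / real (Suc n)))" if x: "x \<in> G" for x a
  proof
    assume a: "a \<le> V x"
    show "\<forall>n. lex_rank x < m (a - 1 / real (Suc n))"
    proof
      fix n
      have "a - 1 / real (Suc n) < Sup {a. lex_rank x < m a}"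
        using a x by (simp add: V_def) (smt (verit) divide_pos_pos of_nat_0_le_iff)
      then obtain b where "lex_rank x < m b" "a - 1 / real (Suc n) < b"
        using S[OF x] by (auto simp: less_cSup_iff)
      then show "lex_rank x < m (a - 1 / real (Suc n))" using m_anti[of "a - 1 / real (Suc n)" b] by simp
    qed
  next
    assume h: "\<forall>n. lex_rank x < m (a - 1 / real (Suc n))"
    show "a \<le> V x"
    proof (rule field_le_epsilon)
      fix e :: real assume "0 < e"
      then obtain n where "1 / real (Suc n) < e" using nat_approx_posE by blast
      moreover have "a - 1 / real (Suc n) \<le> V x"
        using h x S[OF x] by (auto simp: V_def intro!: cSup_upper)
      ultimately show "a \<le> V x + e" by simp
    qed
  qed
  have V_set: "{x \<in> space M. a \<le> V x} = (\<Inter>n. {x \<in> space M. x \<in> G \<and> lex_rank x < m (a - 1 / real (Suc n))})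
      \<union> {x \<in> space M. x \<notin> G \<and> a \<le> 0}" for a
    using V_ge by (auto simp: V_def)
  have [measurable]: "V \<in> borel_measurable M"
    unfolding borel_measurable_iff_ge V_set by (intro allI) measurable
  have "measure M {x \<in> space M. a \<le> V x} = m a" for a
  proof -
    have "measure M {x \<in> space M. a \<le> V x} = measure M (\<Inter>n. {x \<in> space M. lex_rank x < m (a - 1 / real (Suc n))})"
    proof (rule finite_measure_eq_AE)
      show "AE x in M. (x \<in> {x \<in> space M. a \<le> V x}) = (x \<in> (\<Inter>n. {x \<in> space M. lex_rank x < m (a - 1 / real (Suc n))}))"
        using AE_G by (rule AE_mp) (use V_ge in \<open>auto intro!: AE_I2\<close>)
    qed measurable
    moreover have "(\<lambda>n. m (a - 1 / real (Suc n))) \<longlonglongrightarrow> measure M (\<Inter>n. {x \<in> space M. lex_rank x < m (a - 1 / real (Suc n))})"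
    proof -
      have "(\<lambda>n. measure M {x \<in> space M. lex_rank x < m (a - 1 / real (Suc n))}) \<longlonglongrightarrow> measure M (\<Inter>n. {x \<in> space M. lex_rank x < m (a - 1 / real (Suc n))})"
      proof (rule finite_Lim_measure_decseq)
        show "decseq (\<lambda>n. {x \<in> space M. lex_rank x < m (a - 1 / real (Suc n))})"
          unfolding decseq_def
        proof (intro allI impI subsetI)
          fix i j :: nat and x assume "i \<le> j" "x \<in> {x \<in> space M. lex_rank x < m (a - 1 / real (Suc j))}"
          moreover have "m (a - 1 / real (Suc j)) \<le> m (a - 1 / real (Suc i))"
            using \<open>i \<le> j\<close> by (intro m_anti) (auto simp: frac_le)
          ultimately show "x \<in> {x \<in> space M. lex_rank x < m (a - 1 / real (Suc i))}" by auto
        qed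
      qed auto
      then show ?thesis using measure_lex_rank_less[OF m_bd[unfolded total_def]] by simp
    qed
    moreover have "(\<lambda>n. m (a - 1 / real (Suc n))) \<longlonglongrightarrow> m a"
    proof -
      have "(\<lambda>n. m (a - 1 / real (Suc n))) \<longlonglongrightarrow> measure M (\<Inter>n. {x \<in> space M. a - 1 / real (Suc n) \<le> V0 x})"
        unfolding m_def
      proof (rule finite_Lim_measure_decseq)
        show "decseq (\<lambda>n. {x \<in> space M. a - 1 / real (Suc n) \<le> V0 x})"
          unfolding decseq_def
        proof (intro allI impI subsetI)
          fix i j :: nat and x assume ij: "i \<le> j" "x \<in> {x \<in> space M. a - 1 / real (Suc j) \<le> V0 x}"
          have "1 / real (Suc j) \<le> 1 / real (Suc i)" using ij(1) by (auto simp: frac_le)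
          then show "x \<in> {x \<in> space M. a - 1 / real (Suc i) \<le> V0 x}" using ij(2) by auto
        qed
      qed auto
      also have "(\<Inter>n. {x \<in> space M. a - 1 / real (Suc n) \<le> V0 x}) = {x \<in> space M. a \<le> V0 x}"
      proof -
        have "a \<le> V0 x" if le: "\<And>n. a - 1 / real (Suc n) \<le> V0 x" for x
        proof (rule field_le_epsilon)
          fix e :: real assume "0 < e"
          then obtain n where "1 / real (Suc n) < e" using nat_approx_posE by blast
          then show "a \<le> V0 x + e" using le[of n] by simp
        qed
        moreover have "a - 1 / real (Suc n) \<le> V0 x" if "a \<le> V0 x" for x n
          using that by (smt (verit) divide_nonneg_nonneg of_nat_0_le_iff)
        ultimately show ?thesis by auto
      qed
      finally show ?thesis by (simp add: m_def)
    qed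
    ultimately show ?thesis by (metis LIMSEQ_unique)
  qed
  moreover have "V y \<le> V x" if xy: "x \<in> G" "y \<in> G" "lex_less f \<tau> x y" for x y
  proof -
    have "{a. lex_rank y < m a} \<subseteq> {a. lex_rank x < m a}"
      using lex_rank_mono[OF xy(3)] by auto
    then show ?thesis
      using S[OF xy(1)] S[OF xy(2)] xy by (simp add: V_def cSup_subset_mono)
  qed
  ultimately show ?thesis using that[of V G] AE_G by (simp add: m_def)
qed

end

text \<open>By the layer-cake formula it suffices to compare, for each level \<open>a\<close>, the sets on which exactly one of
  \<open>V\<close> and \<open>W\<close> is at least \<open>a\<close>. They have equal measure, and up to a null set no value of \<open>f\<close> on
  the set where only \<open>V\<close> is at least \<open>a\<close> exceeds one on the other set.\<close>

lemma Hardy_Littlewood_antitone: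
  fixes V W f :: "'a \<Rightarrow> real"
  assumes [measurable]: "V \<in> borel_measurable M" "W \<in> borel_measurable M" "f \<in> borel_measurable M"
    and f0: "\<And>x. 0 \<le> f x"
    and eq: "\<And>a. measure M {x \<in> space M. a \<le> V x} = measure M {x \<in> space M. a \<le> W x}"
    and G: "AE x in M. x \<in> G" and anti: "\<And>x y. x \<in> G \<Longrightarrow> y \<in> G \<Longrightarrow> f x < f y \<Longrightarrow> V y \<le> V x"
    and iV: "integrable M (\<lambda>x. V x * f x)" and iW: "integrable M (\<lambda>x. W x * f x)"
  shows "(LINT x|M. V x * f x) \<le> (LINT x|M. W x * f x)"
proof -
  have G': "AE x in M. x \<in> G \<and> x \<in> space M"
    using G AE_space by eventually_elim simp
  have step: "(\<integral>\<^sup>+x. ennreal (f x) * indicator {x \<in> space M. W x < a \<and> a \<le> V x} x \<partial>M)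
      \<le> (\<integral>\<^sup>+x. ennreal (f x) * indicator {x \<in> space M. V x < a \<and> a \<le> W x} x \<partial>M)" for a
  proof -
    let ?P = "{x \<in> space M. W x < a \<and> a \<le> V x}" and ?Q = "{x \<in> space M. V x < a \<and> a \<le> W x}"
    let ?R = "{x \<in> space M. a \<le> V x \<and> a \<le> W x}"
    have "measure M {x \<in> space M. a \<le> V x} = measure M ?P + measure M ?R"
      by (subst finite_measure_Union[symmetric]) (auto intro!: arg_cong[where f = "measure M"])
    moreover have "measure M {x \<in> space M. a \<le> W x} = measure M ?Q + measure M ?R"
      by (subst finite_measure_Union[symmetric]) (auto intro!: arg_cong[where f = "measure M"])
    ultimately have PQ: "measure M ?P = measure M ?Q" using eq[of a] by simp
    then have ePQ: "emeasure M ?P = emeasure M ?Q" by (simp add: emeasure_eq_measure)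
    have le: "f x \<le> f y" if "x \<in> ?P \<inter> G" "y \<in> ?Q \<inter> G" for x y
      using anti[of y x] that by force
    show ?thesis
    proof (cases "emeasure M ?P = 0")
      case True
      then have "AE x in M. x \<notin> ?P" by (intro AE_not_in) (auto simp: null_sets_def)
      then have "(\<integral>\<^sup>+x. ennreal (f x) * indicator ?P x \<partial>M) = (\<integral>\<^sup>+x. 0 \<partial>M)"
        by (intro nn_integral_cong_AE) (auto elim!: eventually_mono)
      then show ?thesis by simp
    next
      case False
      have ne: "X \<inter> G \<noteq> {}" if "X \<in> sets M" "emeasure M X \<noteq> 0" for X
      proof
        assume "X \<inter> G = {}"
        then have "AE x in M. x \<notin> X" using G by (auto elim!: eventually_mono)
        then have "X \<in> null_sets M" using that(1) by (simp add: AE_iff_null_sets)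
        then show False using that(2) by (simp add: null_sets_def)
      qed
      have neP: "?P \<inter> G \<noteq> {}" by (rule ne) (use False in auto)
      have neQ: "?Q \<inter> G \<noteq> {}" by (rule ne) (use False ePQ in auto)
      define c where "c = Sup (f ` (?P \<inter> G))"
      obtain y0 where y0: "y0 \<in> ?Q \<inter> G" using neQ by blast
      have bdd: "bdd_above (f ` (?P \<inter> G))" using le[OF _ y0] by (intro bdd_aboveI2)
      have c1: "f x \<le> c" if "x \<in> ?P \<inter> G" for x
        unfolding c_def using bdd that by (intro cSup_upper) auto
      have c2: "c \<le> f y" if "y \<in> ?Q \<inter> G" for y
        unfolding c_def using neP le[OF _ that] by (intro cSup_least) auto
      have "(\<integral>\<^sup>+x. ennreal (f x) * indicator ?P x \<partial>M) \<le> (\<integral>\<^sup>+x. ennreal c * indicator ?P x \<partial>M)"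
        using G' by (intro nn_integral_mono_AE, elim eventually_mono) (use c1 in \<open>auto simp: indicator_def intro!: ennreal_leI\<close>)
      also have "\<dots> = ennreal c * emeasure M ?P" by (rule nn_integral_cmult_indicator) measurable
      also have "\<dots> = ennreal c * emeasure M ?Q" by (simp only: ePQ)
      also have "\<dots> = (\<integral>\<^sup>+x. ennreal c * indicator ?Q x \<partial>M)" by (rule nn_integral_cmult_indicator[symmetric]) measurable
      also have "\<dots> \<le> (\<integral>\<^sup>+x. ennreal (f x) * indicator ?Q x \<partial>M)"
        using G' by (intro nn_integral_mono_AE, elim eventually_mono) (use c2 in \<open>auto simp: indicator_def intro!: ennreal_leI\<close>)
      finally show ?thesis .
    qed
  qed
  have layer: "(\<integral>\<^sup>+x. ennreal ((V' x - W' x) * f x) \<partial>M)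
      = (\<integral>\<^sup>+a. (\<integral>\<^sup>+x. ennreal (f x) * indicator {x \<in> space M. W' x < a \<and> a \<le> V' x} x \<partial>M) \<partial>lborel)"
    if [measurable]: "V' \<in> borel_measurable M" "W' \<in> borel_measurable M" for V' W' :: "'a \<Rightarrow> real"
  proof -
    interpret L: pair_sigma_finite M lborel ..
    have "(\<integral>\<^sup>+x. ennreal ((V' x - W' x) * f x) \<partial>M)
        = (\<integral>\<^sup>+x. (\<integral>\<^sup>+a. ennreal (f x) * indicator {W' x<..V' x} a \<partial>lborel) \<partial>M)"
    proof (rule nn_integral_cong)
      fix x
      have "(\<integral>\<^sup>+a. ennreal (f x) * indicator {W' x<..V' x} a \<partial>lborel) = ennreal (f x) * emeasure lborel {W' x<..V' x}"
        by (rule nn_integral_cmult_indicator) auto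
      also have "emeasure lborel {W' x<..V' x} = ennreal (V' x - W' x)"
        by (cases "W' x \<le> V' x") (auto simp: ennreal_neg)
      finally show "ennreal ((V' x - W' x) * f x) = (\<integral>\<^sup>+a. ennreal (f x) * indicator {W' x<..V' x} a \<partial>lborel)"
        using ennreal_mult'[OF f0[of x], of "V' x - W' x"] by (simp add: mult.commute)
    qed
    also have "\<dots> = (\<integral>\<^sup>+x. (\<integral>\<^sup>+a. (if W' x < a \<and> a \<le> V' x then ennreal (f x) else 0) \<partial>lborel) \<partial>M)"
      by (intro nn_integral_cong) (auto simp: indicator_def)
    also have "\<dots> = (\<integral>\<^sup>+a. (\<integral>\<^sup>+x. (if W' x < a \<and> a \<le> V' x then ennreal (f x) else 0) \<partial>M) \<partial>lborel)"
      by (rule L.Fubini'[symmetric]) measurable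
    also have "\<dots> = (\<integral>\<^sup>+a. (\<integral>\<^sup>+x. ennreal (f x) * indicator {x \<in> space M. W' x < a \<and> a \<le> V' x} x \<partial>M) \<partial>lborel)"
      by (intro nn_integral_cong) (auto simp: indicator_def)
    finally show ?thesis .
  qed
  let ?d = "\<lambda>x. (V x - W x) * f x"
  have id: "integrable M ?d" using iV iW by (simp add: left_diff_distrib)
  have "(\<integral>\<^sup>+x. ennreal ((V x - W x) * f x) \<partial>M) \<le> (\<integral>\<^sup>+x. ennreal ((W x - V x) * f x) \<partial>M)"
    unfolding layer[OF assms(1,2)] layer[OF assms(2,1)] by (intro nn_integral_mono step)
  then have "enn2real (\<integral>\<^sup>+x. ennreal (?d x) \<partial>M) \<le> enn2real (\<integral>\<^sup>+x. ennreal (- ?d x) \<partial>M)"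
    using id by (intro enn2real_mono) (auto simp: real_integrable_def less_top[symmetric] algebra_simps)
  then have "(LINT x|M. ?d x) \<le> 0" using id by (simp add: real_lebesgue_integral_def)
  then show ?thesis using iV iW by (simp add: left_diff_distrib)
qed

text \<open>Since \<open>V = V'\<close> is both decreasing and increasing in \<open>\<tau>\<close> on each level set of \<open>f\<close>, two points of such a
  set at which \<open>V\<close> differs have the same \<open>\<tau>\<close>. The points at which the value exceeds that of another point
  of the same level set therefore lie in countably many level sets of \<open>\<tau>\<close>, one for each rational number in
  the gap. The infimum in the definition of \<open>\<phi>\<close> is over a possibly empty or unbounded set, which is why \<open>\<phi>\<close> is
  extended-real valued.\<close>

lemma antitone_factorization:
  fixes V V' f \<tau> :: "'a \<Rightarrow> real"
  assumes null: "\<And>c. {x \<in> space M. \<tau> x = c} \<in> null_sets M"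
    and G: "AE x in M. x \<in> G" "G \<subseteq> space M"
    and anti: "\<And>x y. x \<in> G \<Longrightarrow> y \<in> G \<Longrightarrow> lex_less f \<tau> x y \<Longrightarrow> V y \<le> V x"
    and anti': "\<And>x y. x \<in> G \<Longrightarrow> y \<in> G \<Longrightarrow> lex_less f (\<lambda>x. - \<tau> x) x y \<Longrightarrow> V' y \<le> V' x"
    and eq: "\<And>x. x \<in> G \<Longrightarrow> V x = V' x"
  shows "\<exists>\<phi> :: real \<Rightarrow> ereal. antimono \<phi> \<and> (AE x in M. ereal (V x) = \<phi> (f x))"
proof -
  have same: "V x = V y" if "x \<in> G" "y \<in> G" "f x = f y" "\<tau> x \<noteq> \<tau> y" for x y
  proof (cases "\<tau> x < \<tau> y")
    case True
    then show ?thesis using anti[of x y] anti'[of y x] eq that by (auto simp: lex_less_def)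
  next
    case False
    then show ?thesis using anti[of y x] anti'[of x y] eq that by (auto simp: lex_less_def)
  qed
  define \<phi> where "\<phi> c = Inf ((\<lambda>x. ereal (V x)) ` {x \<in> G. f x \<le> c})" for c
  define D where "D r = {y \<in> G. \<exists>x\<in>G. f x = f y \<and> V x < r \<and> r < V y}" for r
  have D_null: "\<exists>c. D r \<subseteq> {x \<in> space M. \<tau> x = c}" for r
  proof (cases "D r = {}")
    case False
    then obtain y0 x0 where 0: "y0 \<in> G" "x0 \<in> G" "f x0 = f y0" "V x0 < r" "r < V y0" by (auto simp: D_def)
    have t0: "\<tau> x0 = \<tau> y0" using same[of x0 y0] 0 by force
    have "\<tau> y = \<tau> y0" if yD: "y \<in> D r" for y
    proof -
      obtain x where x: "y \<in> G" "x \<in> G" "f x = f y" "V x < r" "r < V y" using yD unfolding D_def by blast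
      have "\<not> f y < f y0" using anti[of x y0] x 0 by (auto simp: lex_less_def)
      moreover have "\<not> f y0 < f y" using anti[of x0 y] x 0 by (auto simp: lex_less_def)
      ultimately have "f y = f y0" by simp
      then show ?thesis using same[of y x0] x 0 t0 by force
    qed
    then show ?thesis using G(2) by (intro exI[of _ "\<tau> y0"]) (auto simp: D_def)
  qed auto
  have "AE x in M. \<forall>r\<in>\<rat>. x \<notin> D r"
  proof (subst AE_ball_countable)
    show "\<forall>r\<in>\<rat>. AE x in M. x \<notin> D r"
    proof
      fix r :: real
      obtain c where "D r \<subseteq> {x \<in> space M. \<tau> x = c}" using D_null by blast
      then show "AE x in M. x \<notin> D r" using AE_not_in[OF null[of c]] by (auto elim!: eventually_mono)
    qed
  qed (rule countable_rat)
  then have "AE x in M. ereal (V x) = \<phi> (f x)"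
    using G(1)
  proof eventually_elim
    case (elim y)
    have "V y \<le> V x" if x: "x \<in> G" "f x \<le> f y" for x
    proof (cases "f x < f y")
      case True
      then show ?thesis using anti[of x y] x elim by (simp add: lex_less_def)
    next
      case False
      then have "f x = f y" using x by simp
      show ?thesis
      proof (rule ccontr)
        assume "\<not> V y \<le> V x"
        then obtain r where "r \<in> \<rat>" "V x < r" "r < V y" using Rats_dense_in_real[of "V x" "V y"] by auto
        then show False using elim x \<open>f x = f y\<close> by (auto simp: D_def)
      qed
    qed
    then show ?case
      unfolding \<phi>_def using elim by (intro antisym INF_greatest INF_lower) auto
  qed
  moreover have "antimono \<phi>"
    unfolding \<phi>_def by (intro antimonoI INF_superset_mono) auto
  ultimately show ?thesis by blast
qed

end

section \<open>Compactness in Lebesgue spaces\<close>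

lemma le_powr_mult_powr:
  fixes m t b :: real
  assumes "0 < m" "m \<le> t" "1 < b"
  shows "t \<le> m powr (1 - b) * t powr b"
proof -
  have "1 = m powr (1 - b) * m powr (b - 1)" using assms powr_add[of m "1 - b" "b - 1"] by simp
  also have "\<dots> \<le> m powr (1 - b) * t powr (b - 1)" using assms by (intro mult_left_mono powr_mono2) auto
  finally have "1 * t \<le> m powr (1 - b) * t powr (b - 1) * t" using assms by (intro mult_right_mono) auto
  moreover have "t powr (b - 1) * t = t powr b" using assms powr_add[of t "b - 1" 1] by simp
  ultimately show ?thesis by (simp only: mult.assoc mult_1)
qed

lemma Fatou_integrable:
  fixes f :: "nat \<Rightarrow> 'b \<Rightarrow> real"
  assumes int: "\<And>k. integrable M (f k)" and nn: "\<And>k x. 0 \<le> f k x" and [measurable]: "g \<in> borel_measurable M"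
    and lim: "AE x in M. (\<lambda>k. f k x) \<longlonglongrightarrow> g x"
    and bd: "\<And>k. (LINT x|M. f k x) \<le> c k" and c: "c \<longlonglongrightarrow> l"
  shows "integrable M g" "(LINT x|M. g x) \<le> l"
proof -
  have [measurable]: "f k \<in> borel_measurable M" for k using int[of k] by simp
  have g0: "AE x in M. 0 \<le> g x"
    using lim by eventually_elim (rule LIMSEQ_le_const, use nn in auto)
  have c0: "0 \<le> c k" for k
    using order_trans[OF _ bd[of k]] nn by (auto intro!: integral_nonneg_AE)
  have l0: "0 \<le> l" using c by (rule LIMSEQ_le_const) (use c0 in auto)
  have "(\<integral>\<^sup>+x. ennreal (g x) \<partial>M) = (\<integral>\<^sup>+x. liminf (\<lambda>k. ennreal (f k x)) \<partial>M)"
    using lim by (intro nn_integral_cong_AE) (auto elim!: eventually_mono intro!: lim_imp_Liminf[symmetric])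
  also have "\<dots> \<le> liminf (\<lambda>k. \<integral>\<^sup>+x. ennreal (f k x) \<partial>M)"
    by (rule nn_integral_liminf) measurable
  also have "\<dots> \<le> liminf (\<lambda>k. ennreal (c k))"
    using int nn bd by (intro Liminf_mono always_eventually allI) (auto simp: nn_integral_eq_integral intro: ennreal_leI)
  also have "liminf (\<lambda>k. ennreal (c k)) = ennreal l"
    using c by (intro lim_imp_Liminf) auto
  finally have le: "(\<integral>\<^sup>+x. ennreal (g x) \<partial>M) \<le> ennreal l" .
  then show int_g: "integrable M g"
    using g0 by (intro integrableI_nonneg) (auto intro: le_less_trans)
  show "(LINT x|M. g x) \<le> l"
    using le l0 by (subst (asm) nn_integral_eq_integral[OF int_g g0]) simp
qed

lemma gagliardo_integrand_tendsto:
  fixes u :: "nat \<Rightarrow> 'a::euclidean_space \<Rightarrow> real"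
  assumes "0 < p" "AE x in lebesgue. (\<lambda>k. u k x) \<longlonglongrightarrow> v x"
  shows "AE z in lebesgue \<Otimes>\<^sub>M lebesgue. (\<lambda>k. gagliardo_integrand s p (u k) z) \<longlonglongrightarrow> gagliardo_integrand s p v z"
  using AE_pair_lebesgue[OF assms(2)]
proof eventually_elim
  case (elim z)
  then show ?case using assms(1) unfolding gagliardo_integrand_def case_prod_beta divide_inverse
    by (intro tendsto_mult_right tendsto_powr' tendsto_rabs tendsto_diff tendsto_const) auto
qed

lemma Vitali_tendsto_zero:
  fixes f :: "nat \<Rightarrow> 'b \<Rightarrow> real"
  assumes [measurable]: "\<And>k. f k \<in> borel_measurable M" "S \<in> sets M" and fin: "emeasure M S < \<infinity>"
    and z: "\<And>k x. x \<notin> S \<Longrightarrow> f k x = 0" and b: "1 < b"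
    and int: "\<And>k. integrable M (\<lambda>x. \<bar>f k x\<bar> powr b)" and K: "\<And>k. (LINT x|M. \<bar>f k x\<bar> powr b) \<le> K"
    and lim: "AE x in M. (\<lambda>k. f k x) \<longlonglongrightarrow> 0"
  shows "integrable M (f k)" "(\<lambda>k. LINT x|M. \<bar>f k x\<bar>) \<longlonglongrightarrow> 0"
proof -
  have iS: "integrable M (indicator S :: 'b \<Rightarrow> real)"
    using fin by (intro integrable_real_indicator) auto
  have K0: "0 \<le> K" using K[of 0] by (rule order_trans[rotated]) (auto intro!: integral_nonneg_AE)
  have pt: "\<bar>f k x\<bar> \<le> min \<bar>f k x\<bar> m * indicator S x + m powr (1 - b) * \<bar>f k x\<bar> powr b" if m: "0 < m" for k x m
  proof (cases "\<bar>f k x\<bar> \<le> m")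
    case True
    then show ?thesis using z[of x k] by (cases "x \<in> S") (auto simp: indicator_def)
  next
    case False
    then show ?thesis
      using m b le_powr_mult_powr[of m "\<bar>f k x\<bar>" b] by (simp add: add_increasing indicator_def)
  qed
  have imin: "integrable M (\<lambda>x. min \<bar>f k x\<bar> m * indicator S x)" if "0 < m" for k m
    by (rule Bochner_Integration.integrable_bound[OF integrable_mult_right[OF iS, of m]])
       (measurable, use that in \<open>auto simp: indicator_def\<close>)
  show "integrable M (f k)" for k
    by (rule Bochner_Integration.integrable_bound[OF Bochner_Integration.integrable_add[OF imin[of 1 k] int[of k]]])
       (use pt[of 1 k] in \<open>auto intro: order_trans[OF _ abs_ge_self]\<close>)
  then have iabs: "integrable M (\<lambda>x. \<bar>f k x\<bar>)" for k by simp
  show "(\<lambda>k. LINT x|M. \<bar>f k x\<bar>) \<longlonglongrightarrow> 0"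
  proof (rule LIMSEQ_I)
    fix e :: real assume e: "0 < e"
    define m where "m = (e / (2 * (K + 1))) powr (1 / (1 - b))"
    have m: "0 < m" using e K0 by (simp add: m_def)
    have mb: "m powr (1 - b) = e / (2 * (K + 1))" using b e K0 by (simp add: m_def powr_powr)
    have "m powr (1 - b) * K < e / 2"
      unfolding mb using e K0 by (simp add: field_simps)
    have "(\<lambda>k. LINT x|M. min \<bar>f k x\<bar> m * indicator S x) \<longlonglongrightarrow> (LINT x|M. 0)"
    proof (rule integral_dominated_convergence[where w = "\<lambda>x. m * indicator S x"])
      show "integrable M (\<lambda>x. m * indicator S x)" using iS by simp
      show "AE x in M. (\<lambda>k. min \<bar>f k x\<bar> m * indicator S x) \<longlonglongrightarrow> 0"
        using lim
      proof eventually_elim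
        case (elim x)
        then have "(\<lambda>k. min \<bar>f k x\<bar> m * indicator S x) \<longlonglongrightarrow> min \<bar>0\<bar> m * indicator S x"
          by (intro tendsto_intros)
        then show ?case using m by simp
      qed
    qed (use iS m in \<open>auto simp: indicator_def\<close>)
    then have "eventually (\<lambda>k. (LINT x|M. min \<bar>f k x\<bar> m * indicator S x) < e / 2) sequentially"
      using e by (intro order_tendstoD(2)) auto
    then obtain N where N: "\<And>k. N \<le> k \<Longrightarrow> (LINT x|M. min \<bar>f k x\<bar> m * indicator S x) < e / 2"
      by (auto simp: eventually_sequentially)
    have "norm ((LINT x|M. \<bar>f k x\<bar>) - 0) < e" if "N \<le> k" for k
    proof -
      have "(LINT x|M. \<bar>f k x\<bar>) \<le> (LINT x|M. min \<bar>f k x\<bar> m * indicator S x + m powr (1 - b) * \<bar>f k x\<bar> powr b)"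
        using iabs imin[OF m] int pt[OF m] by (intro integral_mono) auto
      also have "\<dots> = (LINT x|M. min \<bar>f k x\<bar> m * indicator S x) + m powr (1 - b) * (LINT x|M. \<bar>f k x\<bar> powr b)"
        using imin[OF m] int by simp
      also have "m powr (1 - b) * (LINT x|M. \<bar>f k x\<bar> powr b) \<le> m powr (1 - b) * K"
        using K[of k] by (intro mult_left_mono) auto
      finally have "(LINT x|M. \<bar>f k x\<bar>) < e" using N[OF that] \<open>m powr (1 - b) * K < e / 2\<close> by simp
      then show ?thesis by (simp add: integral_nonneg_AE)
    qed
    then show "\<exists>N. \<forall>k\<ge>N. norm ((LINT x|M. \<bar>f k x\<bar>) - 0) < e" by blast
  qed
qed

text \<open>The mean of \<open>u\<close> over the ball of radius \<open>r > 0\<close> around \<open>c\<close>. The denominator is the volume of the ball, written out so that it visibly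
  does not depend on the centre.\<close>

definition ball_mean :: "real \<Rightarrow> ('a::euclidean_space \<Rightarrow> real) \<Rightarrow> 'a \<Rightarrow> real" where
  "ball_mean r u c = (LINT y|lebesgue. indicator (ball c r) y * u y) / (unit_ball_vol (real DIM('a)) * r powr real DIM('a))"

lemma emeasure_lebesgue_bounded_finite:
  fixes S :: "'a::euclidean_space set"
  assumes "S \<in> sets lebesgue" "bounded S"
  shows "emeasure lebesgue S < \<infinity>"
  using fmeasurableD2[OF bounded_set_imp_lmeasurable[OF assms(2,1)]] unfolding less_top infinity_ennreal_def .

context
  fixes s p :: real and \<Omega> :: "'a::euclidean_space set"
  assumes s: "0 < s" and p: "1 < p" and \<Omega>: "\<Omega> \<in> sets lebesgue" "bounded \<Omega>"
begin

lemma integrable_indicator_domain: "integrable lebesgue (indicator \<Omega> :: 'a \<Rightarrow> real)"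
  using emeasure_lebesgue_bounded_finite[OF \<Omega>] \<Omega> by (intro integrable_real_indicator) auto

lemma Wsp_tilde_integrable1:
  assumes "u \<in> Wsp_tilde s p \<Omega>"
  shows "integrable lebesgue u" "(LINT x|lebesgue. \<bar>u x\<bar>) \<le> measure lebesgue \<Omega> + (LINT x|lebesgue. \<bar>u x\<bar> powr p)"
proof -
  have [measurable]: "u \<in> borel_measurable lebesgue" using Wsp_tilde_measurable[OF p \<Omega>(1) assms] .
  have pt: "\<bar>u x\<bar> \<le> indicator \<Omega> x + \<bar>u x\<bar> powr p" for x
  proof (cases "\<bar>u x\<bar> \<le> 1")
    case True
    then show ?thesis using Wsp_tilde_zero[OF p \<Omega>(1) assms, of x] by (auto simp: indicator_def add_increasing2)
  next
    case False
    then have "\<bar>u x\<bar> powr 1 \<le> \<bar>u x\<bar> powr p" using p by (intro powr_mono) auto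
    then show ?thesis using False by (simp add: indicator_def)
  qed
  note iR = Bochner_Integration.integrable_add[OF integrable_indicator_domain Wsp_tilde_integrable[OF p \<Omega>(1) assms]]
  show i: "integrable lebesgue u"
    by (rule Bochner_Integration.integrable_bound[OF iR]) (use pt in \<open>auto intro: order_trans[OF _ abs_ge_self]\<close>)
  have "(LINT x|lebesgue. \<bar>u x\<bar>) \<le> (LINT x|lebesgue. indicator \<Omega> x + \<bar>u x\<bar> powr p)"
    using i iR pt by (intro integral_mono) auto
  also have "\<dots> = measure lebesgue \<Omega> + (LINT x|lebesgue. \<bar>u x\<bar> powr p)"
    using integrable_indicator_domain Wsp_tilde_integrable[OF p \<Omega>(1) assms] by simp
  finally show "(LINT x|lebesgue. \<bar>u x\<bar>) \<le> measure lebesgue \<Omega> + (LINT x|lebesgue. \<bar>u x\<bar> powr p)" .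
qed

lemma integrable_indicator_ball_mult:
  assumes "u \<in> Wsp_tilde s p \<Omega>"
  shows "integrable lebesgue (\<lambda>y. indicator (ball c r) y * u y)"
  using Wsp_tilde_integrable1(1)[OF assms] integrable_real_mult_indicator[of "ball c r" lebesgue u]
  by (simp add: mult.commute)

lemma integral_indicator_ball_bound:
  assumes "u \<in> Wsp_tilde s p \<Omega>"
  shows "\<bar>LINT y|lebesgue. indicator (ball c r) y * u y\<bar> \<le> measure lebesgue \<Omega> + (LINT x|lebesgue. \<bar>u x\<bar> powr p)"
proof -
  have "\<bar>LINT y|lebesgue. indicator (ball c r) y * u y\<bar> \<le> (LINT y|lebesgue. \<bar>indicator (ball c r) y * u y\<bar>)"
    by (rule integral_abs_bound)
  also have "\<dots> \<le> (LINT y|lebesgue. \<bar>u y\<bar>)"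
    using integrable_indicator_ball_mult[OF assms, of c r] Wsp_tilde_integrable1[OF assms]
    by (intro integral_mono) (auto simp: indicator_def)
  finally show ?thesis using Wsp_tilde_integrable1(2)[OF assms] by simp
qed

text \<open>The estimate follows from \<open>d \<le> e + e\<^bsup>1 - p\<^esup> d\<^sup>p\<close>, applied to \<open>d = |u(x) - u(y)|\<close> for \<open>y\<close> in the ball; it
  replaces Jensen's inequality and yields smallness in \<open>L\<^sup>1\<close> when first \<open>e\<close> and then \<open>r\<close> is small.\<close>

lemma ball_mean_pointwise:
  assumes u: "u \<in> Wsp_tilde s p \<Omega>" and x: "x \<in> ball c r" and e: "0 < e"
    and gx: "integrable lebesgue (\<lambda>y. gagliardo_integrand s p u (x, y))"
  shows "\<bar>u x - ball_mean r u c\<bar> \<le> e + e powr (1 - p) * ((2 * r) powr (DIM('a) + s * p)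
      / (unit_ball_vol (real DIM('a)) * r powr DIM('a))) * (LINT y|lebesgue. gagliardo_integrand s p u (x, y))"
proof -
  define v where "v = unit_ball_vol (real DIM('a)) * r powr DIM('a)"
  define a where "a = DIM('a) + s * p"
  have r: "0 < r" using x by (metis centre_in_ball dist_not_less_zero less_le_trans mem_ball not_le)
  have v: "0 < v" using r by (simp add: v_def)
  have a: "0 < a" using s p by (simp add: a_def add_nonneg_pos)
  have [measurable]: "u \<in> borel_measurable lebesgue" using Wsp_tilde_measurable[OF p \<Omega>(1) u] .
  have [measurable]: "ball c r \<in> sets lebesgue" by simp
  have mB: "measure lebesgue (ball c r) = v"
    using r by (simp add: content_ball v_def powr_realpow)
  have iB: "integrable lebesgue (indicator (ball c r) :: 'a \<Rightarrow> real)"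
    using emeasure_lebesgue_bounded_finite[of "ball c r"] by (intro integrable_real_indicator) auto
  note iu = integrable_indicator_ball_mult[OF u, of c r]
  have ix: "integrable lebesgue (\<lambda>y. indicator (ball c r) y * (u x - u y))"
    using iB iu by (simp add: right_diff_distrib)
  have pt: "\<bar>indicator (ball c r) y * (u x - u y)\<bar> \<le> e * indicator (ball c r) y + e powr (1 - p) * ((2 * r) powr a * gagliardo_integrand s p u (x, y))" for y
  proof (cases "y \<in> ball c r \<and> e < \<bar>u x - u y\<bar>")
    case True
    have xy: "x \<noteq> y" using True e by auto
    have "dist x y < 2 * r" using x True dist_triangle_less_add[of x c r y r] by (simp add: dist_commute)
    then have le: "norm (x - y) powr a \<le> (2 * r) powr a"
      using a by (intro powr_mono2) (auto simp: dist_norm)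
    have "\<bar>u x - u y\<bar> \<le> e powr (1 - p) * \<bar>u x - u y\<bar> powr p"
      using True p e by (intro le_powr_mult_powr) auto
    also have "\<dots> = e powr (1 - p) * (norm (x - y) powr a * gagliardo_integrand s p u (x, y))"
      using xy by (simp add: gagliardo_integrand_def a_def)
    also have "\<dots> \<le> e powr (1 - p) * ((2 * r) powr a * gagliardo_integrand s p u (x, y))"
      using le by (intro mult_left_mono mult_right_mono gagliardo_integrand_nonneg) auto
    finally show ?thesis using True e by simp
  next
    case False
    have "0 \<le> e powr (1 - p) * ((2 * r) powr a * gagliardo_integrand s p u (x, y))"
      by (simp add: gagliardo_integrand_nonneg)
    then show ?thesis using False e by (auto simp: indicator_def)
  qed
  have "v * \<bar>u x - ball_mean r u c\<bar> = \<bar>v * u x - (LINT y|lebesgue. indicator (ball c r) y * u y)\<bar>"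
  proof -
    have "v * (u x - ball_mean r u c) = v * u x - (LINT y|lebesgue. indicator (ball c r) y * u y)"
      using v by (simp add: ball_mean_def v_def[symmetric] field_simps)
    then show ?thesis using v by (metis abs_mult abs_of_pos)
  qed
  also have "v * u x - (LINT y|lebesgue. indicator (ball c r) y * u y) = (LINT y|lebesgue. indicator (ball c r) y * (u x - u y))"
    using iB iu by (simp add: right_diff_distrib mB)
  also have "\<bar>LINT y|lebesgue. indicator (ball c r) y * (u x - u y)\<bar> \<le> (LINT y|lebesgue. \<bar>indicator (ball c r) y * (u x - u y)\<bar>)"
    by (rule integral_abs_bound)
  also have "\<dots> \<le> (LINT y|lebesgue. e * indicator (ball c r) y + e powr (1 - p) * ((2 * r) powr a * gagliardo_integrand s p u (x, y)))"
    using ix iB gx pt by (intro integral_mono) auto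
  also have "\<dots> = e * v + e powr (1 - p) * ((2 * r) powr a * (LINT y|lebesgue. gagliardo_integrand s p u (x, y)))"
    using iB gx by (simp add: mB)
  finally show ?thesis
    using v unfolding v_def[symmetric] a_def[symmetric] by (simp add: field_simps)
qed

lemma ball_mean_approx:
  assumes u: "u \<in> Wsp_tilde s p \<Omega>" and r: "0 < r" and e: "0 < e"
    and c: "\<And>x. x \<in> ball (c x) r" and [measurable]: "(\<lambda>x. ball_mean r u (c x)) \<in> borel_measurable lebesgue"
  shows "integrable lebesgue (\<lambda>x. indicator \<Omega> x * ball_mean r u (c x))"
    and "(LINT x|lebesgue. \<bar>u x - indicator \<Omega> x * ball_mean r u (c x)\<bar>) \<le> e * measure lebesgue \<Omega>
      + e powr (1 - p) * ((2 * r) powr (DIM('a) + s * p) / (unit_ball_vol (real DIM('a)) * r powr DIM('a))) * gagliardo_energy s p u"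
proof -
  define C where "C = e powr (1 - p) * ((2 * r) powr (DIM('a) + s * p) / (unit_ball_vol (real DIM('a)) * r powr DIM('a)))"
  have C: "0 \<le> C" by (simp add: C_def)
  note [measurable] = \<Omega>(1)
  have [measurable]: "u \<in> borel_measurable lebesgue" using Wsp_tilde_measurable[OF p \<Omega>(1) u] .
  define g where "g x = (LINT y|lebesgue. gagliardo_integrand s p u (x, y))" for x
  have g0: "0 \<le> g x" for x unfolding g_def by (intro integral_nonneg_AE AE_I2 gagliardo_integrand_nonneg)
  have iG: "integrable (lebesgue \<Otimes>\<^sub>M lebesgue) (gagliardo_integrand s p u)"
    using Wsp_tilde_integrable_gagliardo[OF p \<Omega>(1) u] .
  have ig: "integrable lebesgue g" unfolding g_def using leb_pair.integrable_fst'[OF iG] .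
  have gE: "(LINT x|lebesgue. g x) = gagliardo_energy s p u"
    unfolding g_def gagliardo_energy_def using leb_pair.integral_fst'[OF iG] .
  have pt: "AE x in lebesgue. \<bar>u x - indicator \<Omega> x * ball_mean r u (c x)\<bar> \<le> e * indicator \<Omega> x + C * g x"
    using leb_pair.AE_integrable_fst'[OF iG]
  proof eventually_elim
    case (elim x)
    show ?case
    proof (cases "x \<in> \<Omega>")
      case True
      then show ?thesis using ball_mean_pointwise[OF u c e elim] by (simp add: C_def g_def)
    next
      case False
      then show ?thesis using Wsp_tilde_zero[OF p \<Omega>(1) u] C g0 by simp
    qed
  qed
  have iR: "integrable lebesgue (\<lambda>x. e * indicator \<Omega> x + C * g x)"
    using integrable_indicator_domain ig by simp
  have id: "integrable lebesgue (\<lambda>x. u x - indicator \<Omega> x * ball_mean r u (c x))"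
    by (rule Bochner_Integration.integrable_bound[OF iR])
      (measurable, use pt in \<open>auto elim!: eventually_mono intro: order_trans[OF _ abs_ge_self]\<close>)
  then have "integrable lebesgue (\<lambda>x. u x - (u x - indicator \<Omega> x * ball_mean r u (c x)))"
    by (rule Bochner_Integration.integrable_diff[OF Wsp_tilde_integrable1(1)[OF u]])
  moreover have "(\<lambda>x. u x - (u x - indicator \<Omega> x * ball_mean r u (c x))) = (\<lambda>x. indicator \<Omega> x * ball_mean r u (c x))"
    by auto
  ultimately show "integrable lebesgue (\<lambda>x. indicator \<Omega> x * ball_mean r u (c x))" by (simp only:)
  have "(LINT x|lebesgue. \<bar>u x - indicator \<Omega> x * ball_mean r u (c x)\<bar>) \<le> (LINT x|lebesgue. e * indicator \<Omega> x + C * g x)"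
    using id iR pt by (intro integral_mono_AE) auto
  also have "\<dots> = e * measure lebesgue \<Omega> + C * gagliardo_energy s p u"
    using integrable_indicator_domain ig by (simp add: gE)
  finally show "(LINT x|lebesgue. \<bar>u x - indicator \<Omega> x * ball_mean r u (c x)\<bar>) \<le> e * measure lebesgue \<Omega>
      + e powr (1 - p) * ((2 * r) powr (DIM('a) + s * p) / (unit_ball_vol (real DIM('a)) * r powr DIM('a))) * gagliardo_energy s p u"
    by (simp add: C_def)
qed

end

text \<open>Countably many bounded real sequences converge along a common subsequence.\<close>

lemma convergent_subseq_countable:
  fixes a :: "nat \<Rightarrow> nat \<Rightarrow> real"
  assumes "\<And>i k. \<bar>a i k\<bar> \<le> B"
  obtains r where "strict_mono r" "\<And>i. convergent (\<lambda>k. a i (r k))"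
proof -
  interpret subseqs "\<lambda>i s. convergent (\<lambda>k. a i (s k))"
  proof
    fix i and s :: "nat \<Rightarrow> nat"
    have "bounded (range (\<lambda>k. a i (s k)))"
      using assms by (auto simp: bounded_iff)
    then obtain l r where "strict_mono r" "((\<lambda>k. a i (s k)) \<circ> r) \<longlonglongrightarrow> l"
      using bounded_imp_convergent_subsequence by blast
    then show "\<exists>r'. strict_mono r' \<and> convergent (\<lambda>k. a i ((s \<circ> r') k))"
      by (auto simp: convergent_def o_def)
  qed
  have "convergent (\<lambda>k. a i ((diagseq \<circ> (+) (Suc i)) k))" for i
  proof (rule diagseq_holds)
    fix r s :: "nat \<Rightarrow> nat" and n assume "strict_mono r" "convergent (\<lambda>k. a n (s k))"
    then show "convergent (\<lambda>k. a n ((s \<circ> r) k))"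
      using convergent_subseq_convergent[of "\<lambda>k. a n (s k)" r] by (simp add: o_def)
  qed
  moreover have "(\<lambda>k. a i ((diagseq \<circ> (+) (Suc i)) k)) = (\<lambda>k. a i (diagseq (k + Suc i)))" for i
    by (intro ext) (simp add: add.commute)
  ultimately have "convergent (\<lambda>k. a i (diagseq (k + Suc i)))" for i by metis
  then have "convergent (\<lambda>k. a i (diagseq k))" for i
    using convergent_ignore_initial_segment[of "\<lambda>k. a i (diagseq k)" "Suc i"] by simp
  with subseq_diagseq that show ?thesis by blast
qed

text \<open>Along a subsequence the integrals over all balls with centres in a countable dense set and radii
  \<open>1 / (j + 1)\<close> converge. The step functions built from these means then converge by dominated convergence,
  and they are uniformly close to the given functions in \<open>L\<^sup>1\<close>, so that the latter form a Cauchy sequence.\<close>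

lemma Rellich_subsequence:
  fixes u :: "nat \<Rightarrow> 'a::euclidean_space \<Rightarrow> real"
  assumes s: "0 < s" and p: "1 < p" and \<Omega>: "\<Omega> \<in> sets lebesgue" "bounded \<Omega>"
    and u: "\<And>k. u k \<in> Wsp_tilde s p \<Omega>" and E: "\<And>k. gagliardo_energy s p (u k) \<le> K"
    and Lp: "\<And>k. (LINT x|lebesgue. \<bar>u k x\<bar> powr p) \<le> K"
  obtains r v where "strict_mono r" "v \<in> Wsp_tilde s p \<Omega>" "AE x in lebesgue. (\<lambda>k. u (r k) x) \<longlonglongrightarrow> v x"
proof -
  have um [measurable]: "u k \<in> borel_measurable lebesgue" for k using Wsp_tilde_measurable[OF p \<Omega>(1) u] .
  note [measurable] = \<Omega>(1)
  define \<omega> where "\<omega> = unit_ball_vol (real DIM('a))"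
  define m where "m = measure lebesgue \<Omega>"
  have \<omega>: "0 < \<omega>" by (simp add: \<omega>_def)
  have m: "0 \<le> m" by (simp add: m_def)
  have K: "0 \<le> K" using gagliardo_energy_nonneg order_trans E by blast
  obtain D :: "'a set" where D: "countable D" "\<And>X. open X \<Longrightarrow> X \<noteq> {} \<Longrightarrow> \<exists>d\<in>D. d \<in> X"
    using countable_dense_exists by blast
  define d where "d = from_nat_into D"
  have "D \<noteq> {}" using D(2)[of UNIV] by auto
  then have range_d: "range d = D" using D(1) by (simp add: d_def range_from_nat_into)
  have ex_d: "\<exists>i. x \<in> ball (d i) r" if r: "0 < r" for x r
  proof -
    obtain z where "z \<in> D" "z \<in> ball x r" using D(2)[of "ball x r"] r by auto
    then show ?thesis using range_d by (auto simp: dist_commute)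
  qed
  \<comment> \<open>Each point is assigned the first centre of the enumeration at distance less than \<open>r\<close>.\<close>
  define idx where "idx r x = (LEAST i. x \<in> ball (d i) r)" for r x
  have idx: "x \<in> ball (d (idx r x)) r" if "0 < r" for r x
    unfolding idx_def by (rule LeastI_ex) (rule ex_d[OF that])
  have [measurable]: "idx r \<in> lebesgue \<rightarrow>\<^sub>M count_space UNIV" for r
    unfolding idx_def mem_ball by measurable
  define rad where "rad j = 1 / real (Suc j)" for j
  have rad: "0 < rad j" for j by (simp add: rad_def)
  define a where "a i k = (LINT y|lebesgue. indicator (ball (d (snd (prod_decode i))) (rad (fst (prod_decode i)))) y * u k y)" for i k
  have "\<bar>a i k\<bar> \<le> m + K" for i k
    unfolding a_def m_def
    using order_trans[OF integral_indicator_ball_bound[OF s p \<Omega> u] add_left_mono[OF Lp]] .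
  then obtain \<sigma> where \<sigma>: "strict_mono \<sigma>" "\<And>i. convergent (\<lambda>k. a i (\<sigma> k))"
    using convergent_subseq_countable by blast
  define A where "A j i k = ball_mean (rad j) (u (\<sigma> k)) (d i)" for j i k
  have A_conv: "convergent (A j i)" for j i
  proof -
    have "A j i = (\<lambda>k. a (prod_encode (j, i)) (\<sigma> k) * (1 / (\<omega> * rad j powr DIM('a))))"
      by (auto simp: A_def a_def ball_mean_def \<omega>_def)
    then show ?thesis
      using convergent_mult[OF \<sigma>(2)[of "prod_encode (j, i)"] convergent_const] by (simp only:)
  qed
  define T where "T j k x = indicator \<Omega> x * A j (idx (rad j) x) k" for j k x
  define T' where "T' j x = indicator \<Omega> x * lim (A j (idx (rad j) x))" for j x
  have A_bd: "\<bar>A j i k\<bar> \<le> (m + K) / (\<omega> * rad j powr DIM('a))" for j i k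
  proof -
    have "\<bar>LINT y|lebesgue. indicator (ball (d i) (rad j)) y * u (\<sigma> k) y\<bar> \<le> m + K"
      using integral_indicator_ball_bound[OF s p \<Omega> u, of "d i" "rad j" "\<sigma> k"] Lp[of "\<sigma> k"] by (simp add: m_def)
    then show ?thesis
      using \<omega> by (auto simp: A_def ball_mean_def \<omega>_def[symmetric] abs_mult intro!: divide_right_mono)
  qed
  have Am: "(\<lambda>x. A j (idx (rad j) x) k) \<in> borel_measurable lebesgue" for j k
    by measurable
  have [measurable]: "T j k \<in> borel_measurable lebesgue" for j k
    unfolding T_def using Am by measurable
  have [measurable]: "T' j \<in> borel_measurable lebesgue" for j
    unfolding T'_def by measurable
  have T_lim: "(\<lambda>k. T j k x) \<longlonglongrightarrow> T' j x" for j x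
    unfolding T_def T'_def using A_conv by (intro tendsto_intros) (simp add: convergent_LIMSEQ_iff)
  define B where "B j = (m + K) / (\<omega> * rad j powr DIM('a))" for j
  have B: "0 \<le> B j" for j using m K \<omega> by (simp add: B_def)
  have T_bd: "\<bar>T j k x\<bar> \<le> B j * indicator \<Omega> x" for j k x
    using A_bd[of j "idx (rad j) x" k] by (auto simp: T_def B_def indicator_def)
  have T'_bd: "\<bar>T' j x\<bar> \<le> B j * indicator \<Omega> x" for j x
    by (rule LIMSEQ_le_const2[OF tendsto_rabs[OF T_lim]]) (use T_bd in auto)
  note i\<Omega> = integrable_indicator_domain[OF s p \<Omega>]
  have iT: "integrable lebesgue (T j k)" for j k
    by (rule Bochner_Integration.integrable_bound[of _ "\<lambda>x. B j * indicator \<Omega> x"])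
       (use i\<Omega> T_bd B in \<open>auto simp: abs_mult\<close>)
  have iT': "integrable lebesgue (T' j)" for j
    by (rule Bochner_Integration.integrable_bound[of _ "\<lambda>x. B j * indicator \<Omega> x"])
       (use i\<Omega> T'_bd B in \<open>auto simp: abs_mult\<close>)
  have T_L1: "(\<lambda>k. LINT x|lebesgue. \<bar>T j k x - T' j x\<bar>) \<longlonglongrightarrow> 0" for j
  proof -
    have "(\<lambda>k. LINT x|lebesgue. \<bar>T j k x - T' j x\<bar>) \<longlonglongrightarrow> (LINT x|(lebesgue :: 'a measure). 0)"
    proof (rule integral_dominated_convergence[where w = "\<lambda>x. 2 * (B j * indicator \<Omega> x)"])
      show "AE x in lebesgue. (\<lambda>k. \<bar>T j k x - T' j x\<bar>) \<longlonglongrightarrow> 0"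
      proof (rule AE_I2)
        fix x
        have "(\<lambda>k. \<bar>T j k x - T' j x\<bar>) \<longlonglongrightarrow> \<bar>T' j x - T' j x\<bar>"
          by (intro tendsto_intros T_lim)
        then show "(\<lambda>k. \<bar>T j k x - T' j x\<bar>) \<longlonglongrightarrow> 0" by simp
      qed
      show "AE x in lebesgue. norm \<bar>T j k x - T' j x\<bar> \<le> 2 * (B j * indicator \<Omega> x)" for k
        using T_bd[of j k] T'_bd[of j] by (intro AE_I2) (smt (verit) real_norm_def)
    qed (use i\<Omega> in auto)
    then show ?thesis by simp
  qed
  have approx: "\<exists>j. \<forall>k. (LINT x|lebesgue. \<bar>u (\<sigma> k) x - T j k x\<bar>) \<le> e" if e: "0 < e" for e
  proof -
    define \<epsilon> where "\<epsilon> = e / (2 * (m + 1))"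
    have \<epsilon>: "0 < \<epsilon>" using e m by (simp add: \<epsilon>_def)
    have \<epsilon>m: "\<epsilon> * m \<le> e / 2" using e m by (simp add: \<epsilon>_def field_simps)
    have "(\<lambda>j. rad j powr (s * p)) \<longlonglongrightarrow> 0 powr (s * p)"
      using s p LIMSEQ_inverse_real_of_nat unfolding rad_def
      by (intro tendsto_powr2 tendsto_const) (auto simp: inverse_eq_divide)
    then have "(\<lambda>j. \<epsilon> powr (1 - p) * (2 powr (DIM('a) + s * p) / \<omega>) * K * rad j powr (s * p)) \<longlonglongrightarrow>
        \<epsilon> powr (1 - p) * (2 powr (DIM('a) + s * p) / \<omega>) * K * 0"
      by (intro tendsto_intros) simp
    then have "eventually (\<lambda>j. \<epsilon> powr (1 - p) * (2 powr (DIM('a) + s * p) / \<omega>) * K * rad j powr (s * p) < e / 2) sequentially"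
      using e by (intro order_tendstoD(2)) auto
    then obtain j where j: "\<epsilon> powr (1 - p) * (2 powr (DIM('a) + s * p) / \<omega>) * K * rad j powr (s * p) < e / 2"
      by (auto simp: eventually_sequentially)
    have "(LINT x|lebesgue. \<bar>u (\<sigma> k) x - T j k x\<bar>) \<le> e" for k
    proof -
      have "(LINT x|lebesgue. \<bar>u (\<sigma> k) x - T j k x\<bar>) \<le> \<epsilon> * m
          + \<epsilon> powr (1 - p) * ((2 * rad j) powr (DIM('a) + s * p) / (\<omega> * rad j powr DIM('a))) * gagliardo_energy s p (u (\<sigma> k))"
        unfolding T_def A_def m_def \<omega>_def
        by (rule ball_mean_approx(2)[OF s p \<Omega> u rad \<epsilon> idx[OF rad]]) (use Am in \<open>simp add: A_def\<close>)
      also have "\<dots> \<le> e / 2 + \<epsilon> powr (1 - p) * ((2 * rad j) powr (DIM('a) + s * p) / (\<omega> * rad j powr DIM('a))) * K"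
        using \<epsilon>m E[of "\<sigma> k"] \<omega> by (intro add_mono mult_left_mono) auto
      also have "(2 * rad j) powr (DIM('a) + s * p) / (\<omega> * rad j powr DIM('a)) = 2 powr (DIM('a) + s * p) / \<omega> * rad j powr (s * p)"
        using rad[of j] \<omega> by (simp add: powr_mult powr_add field_simps)
      also have "e / 2 + \<epsilon> powr (1 - p) * (2 powr (DIM('a) + s * p) / \<omega> * rad j powr (s * p)) * K
          = e / 2 + \<epsilon> powr (1 - p) * (2 powr (DIM('a) + s * p) / \<omega>) * K * rad j powr (s * p)" by simp
      finally show ?thesis using j by linarith
    qed
    then show ?thesis by blast
  qed
  have iu: "integrable lebesgue (u k)" for k using Wsp_tilde_integrable1(1)[OF s p \<Omega> u] .
  obtain \<rho> where \<rho>: "strict_mono \<rho>" "AE x in lebesgue. Cauchy (\<lambda>i. u (\<sigma> (\<rho> i)) x)"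
  proof (rule cauchy_L1_AE_cauchy_subseq[of lebesgue "\<lambda>k. u (\<sigma> k)"])
    fix e :: real assume e: "0 < e"
    obtain j where j: "\<And>k. (LINT x|lebesgue. \<bar>u (\<sigma> k) x - T j k x\<bar>) \<le> e / 8"
      using approx[of "e / 8"] e by auto
    have "eventually (\<lambda>k. (LINT x|lebesgue. \<bar>T j k x - T' j x\<bar>) < e / 8) sequentially"
      using e by (intro order_tendstoD(2)[OF T_L1]) auto
    then obtain N where N: "\<And>k. N \<le> k \<Longrightarrow> (LINT x|lebesgue. \<bar>T j k x - T' j x\<bar>) < e / 8"
      by (auto simp: eventually_sequentially)
    have "(LINT x|lebesgue. norm (u (\<sigma> k) x - u (\<sigma> l) x)) < e" if "N \<le> k" "N \<le> l" for k l
    proof -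
      have "(LINT x|lebesgue. norm (u (\<sigma> k) x - u (\<sigma> l) x)) \<le> (LINT x|lebesgue.
          (\<bar>u (\<sigma> k) x - T j k x\<bar> + \<bar>T j k x - T' j x\<bar>) + (\<bar>T j l x - T' j x\<bar> + \<bar>u (\<sigma> l) x - T j l x\<bar>))"
        using iu iT iT' by (intro integral_mono) auto
      also have "\<dots> = ((LINT x|lebesgue. \<bar>u (\<sigma> k) x - T j k x\<bar>) + (LINT x|lebesgue. \<bar>T j k x - T' j x\<bar>))
          + ((LINT x|lebesgue. \<bar>T j l x - T' j x\<bar>) + (LINT x|lebesgue. \<bar>u (\<sigma> l) x - T j l x\<bar>))"
        using iu iT iT' by simp
      also have "\<dots> < e" using j[of k] j[of l] N[OF that(1)] N[OF that(2)] e by linarith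
      finally show ?thesis .
    qed
    then show "\<exists>N. \<forall>i\<ge>N. \<forall>j\<ge>N. (LINT x|lebesgue. norm (u (\<sigma> i) x - u (\<sigma> j) x)) < e" by blast
  qed (use iu that in auto)
  define r where "r = \<sigma> \<circ> \<rho>"
  have r: "strict_mono r" using \<sigma>(1) \<rho>(1) unfolding r_def by (rule strict_mono_o)
  define v where "v x = lim (\<lambda>k. u (r k) x)" for x
  have vm [measurable]: "v \<in> borel_measurable lebesgue"
    unfolding v_def by measurable
  have lim: "AE x in lebesgue. (\<lambda>k. u (r k) x) \<longlonglongrightarrow> v x"
    using \<rho>(2) by eventually_elim (simp add: r_def v_def Cauchy_convergent_iff convergent_LIMSEQ_iff)
  have "v \<in> Wsp_tilde s p \<Omega>"
  proof (subst Wsp_tilde_iff[OF \<Omega>(1)], intro conjI allI impI)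
    fix x assume "x \<notin> \<Omega>"
    then show "v x = 0" using Wsp_tilde_zero[OF p \<Omega>(1) u] by (simp add: v_def)
  next
    show "integrable lebesgue (\<lambda>x. \<bar>v x\<bar> powr p)"
    proof (rule Fatou_integrable(1)[where f = "\<lambda>k x. \<bar>u (r k) x\<bar> powr p" and c = "\<lambda>_. K"])
      show "AE x in lebesgue. (\<lambda>k. \<bar>u (r k) x\<bar> powr p) \<longlonglongrightarrow> \<bar>v x\<bar> powr p"
        using lim p by (auto elim!: eventually_mono intro!: tendsto_powr' tendsto_rabs)
    qed (use Wsp_tilde_integrable[OF p \<Omega>(1) u] Lp in auto)
    show "integrable (lebesgue \<Otimes>\<^sub>M lebesgue) (gagliardo_integrand s p v)"
    proof (rule Fatou_integrable(1)[where f = "\<lambda>k. gagliardo_integrand s p (u (r k))" and c = "\<lambda>_. K"])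
      show "AE z in lebesgue \<Otimes>\<^sub>M lebesgue. (\<lambda>k. gagliardo_integrand s p (u (r k)) z) \<longlonglongrightarrow> gagliardo_integrand s p v z"
        by (rule gagliardo_integrand_tendsto[OF _ lim]) (use p in simp)
    qed (use Wsp_tilde_integrable_gagliardo[OF p \<Omega>(1) u] E gagliardo_integrand_nonneg in \<open>auto simp: gagliardo_energy_def\<close>)
  qed (rule vm)
  then show ?thesis using that r lim by blast
qed

section \<open>Minimisers of the energy with potential\<close>

lemma abs_powr_mult_mult: "\<bar>d\<bar> powr (p - 2) * d * d = \<bar>d\<bar> powr p" for d p :: real
  using powr_add[of "\<bar>d\<bar>" "p - 2" 2] by (cases "d = 0") (auto simp: power2_eq_square mult.assoc)

lemma H_form_self: "H_form s p u u = 1 / 2 * gagliardo_energy s p u"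
proof -
  show ?thesis
    unfolding H_form_def gagliardo_energy_def gagliardo_integrand_def by (simp add: abs_powr_mult_mult)
qed

lemma H_form_minus: "H_form s p u (\<lambda>x. - v x) = - H_form s p u v"
proof -
  have eq: "\<bar>u x - u y\<bar> powr (p - 2) * (u x - u y) * (- v x - - v y) / norm (x - y) powr (real DIM('a) + s * p)
      = - (\<bar>u x - u y\<bar> powr (p - 2) * (u x - u y) * (v x - v y) / norm (x - y) powr (real DIM('a) + s * p))" for x y :: 'a
    by (simp add: algebra_simps diff_divide_distrib add_divide_distrib)
  show ?thesis
    unfolding H_form_def case_prod_beta by (simp only: eq Bochner_Integration.integral_minus mult_minus_right)
qed

text \<open>The standing assumptions on the domain, the exponents and the potential \<open>V\<^sub>0\<close>. Below, \<open>mass u\<close> is the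
  \<open>p\<close>-th power of the \<open>L\<^sup>p\<close> norm and \<open>R\<close> is the set of rearrangements of \<open>V\<^sub>0\<close>.\<close>

locale schroedinger =
  fixes s p q :: real and \<Omega> :: "'a::euclidean_space set" and V0 :: "'a \<Rightarrow> real"
  assumes s_pos: "0 < s" and s_lt_1: "s < 1" and p_gt_1: "1 < p" and nonempty_domain: "\<Omega> \<noteq> {}" and bounded_domain: "bounded \<Omega>"
    and open_domain: "open \<Omega>" and q_gt_1: "1 < q" and q_gt: "real DIM('a) / (s * p) < q" and V0: "V0 \<in> Lp_space q \<Omega>"
begin

abbreviation "L \<equiv> lebesgue_on \<Omega>"
abbreviation "W \<equiv> Wsp_tilde s p \<Omega>"
abbreviation "E \<equiv> gagliardo_energy s p :: ('a \<Rightarrow> real) \<Rightarrow> real"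
abbreviation "R \<equiv> rearrangements \<Omega> V0"
abbreviation "lam \<equiv> first_eigenvalue s p \<Omega>"
abbreviation "mass u \<equiv> LINT x|lebesgue. \<bar>u x :: real\<bar> powr p"

text \<open>The functional whose infimum over the unit sphere of \<open>L\<^sup>p\<close> is the first eigenvalue.\<close>

definition J :: "('a \<Rightarrow> real) \<Rightarrow> ('a \<Rightarrow> real) \<Rightarrow> real" where
  "J V u = 1 / 2 * E u + (LINT x|L. V x * \<bar>u x\<bar> powr p)"

text \<open>The exponent conjugate to \<open>q\<close>.\<close>

definition b :: real where "b = q / (q - 1)"

lemma b_gt_1: "1 < b" and conj_exponents: "1 / q + 1 / b = 1"
  using q_gt_1 by (auto simp: b_def field_simps)

lemma domain_measurable [measurable]: "\<Omega> \<in> sets lebesgue" using open_domain by auto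

lemma p_pos: "0 < p" using p_gt_1 by simp

lemma emeasure_domain_finite: "emeasure lebesgue \<Omega> < \<infinity>"
  by (rule emeasure_lebesgue_bounded_finite[OF domain_measurable bounded_domain])

sublocale fL: finite_measure L
proof
  have sp: "space L = \<Omega>" by (simp add: space_restrict_space)
  have "emeasure L \<Omega> = emeasure lebesgue \<Omega>" by (rule emeasure_restrict_space) auto
  then show "emeasure L (space L) \<noteq> \<infinity>"
    using emeasure_domain_finite unfolding sp less_top infinity_ennreal_def by (simp only:)
qed

lemma space_L [simp]: "space L = \<Omega>" by (simp add: space_restrict_space)

lemma W_measurable: "u \<in> W \<Longrightarrow> u \<in> borel_measurable lebesgue"
  by (rule Wsp_tilde_measurable[OF p_gt_1 domain_measurable])

lemma W_measurable_on: "u \<in> W \<Longrightarrow> u \<in> borel_measurable L"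
  by (rule measurable_restrict_space1[OF W_measurable])

lemma W_zero_outside: "u \<in> W \<Longrightarrow> x \<notin> \<Omega> \<Longrightarrow> u x = 0"
  by (rule Wsp_tilde_zero[OF p_gt_1 domain_measurable])

lemma W_integrable: "u \<in> W \<Longrightarrow> integrable lebesgue (\<lambda>x. \<bar>u x\<bar> powr p)"
  by (rule Wsp_tilde_integrable[OF p_gt_1 domain_measurable])

lemma W_integrable_gagliardo: "u \<in> W \<Longrightarrow> integrable (lebesgue \<Otimes>\<^sub>M lebesgue) (gagliardo_integrand s p u)"
  by (rule Wsp_tilde_integrable_gagliardo[OF p_gt_1 domain_measurable])

lemma mass_nonneg: "0 \<le> mass u"
  by (intro integral_nonneg_AE) auto

lemma mass_L: "u \<in> W \<Longrightarrow> (LINT x|L. \<bar>u x\<bar> powr p) = mass u" "u \<in> W \<Longrightarrow> integrable L (\<lambda>x. \<bar>u x\<bar> powr p)"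
  using integral_lebesgue_eq_lebesgue_on[OF domain_measurable, of "\<lambda>x. \<bar>u x\<bar> powr p"] W_zero_outside W_integrable
    integrable_lebesgue_iff_lebesgue_on[OF domain_measurable, of "\<lambda>x. \<bar>u x\<bar> powr p"] by auto

lemma mass_scale: "mass (\<lambda>x. c * u x) = \<bar>c\<bar> powr p * mass u"
  by (simp add: abs_mult powr_mult)

lemma R_measurable: "V \<in> R \<Longrightarrow> V \<in> borel_measurable L"
  by (simp add: rearrangements_def)

lemma V0_measurable: "V0 \<in> borel_measurable L" and V0_integrable: "integrable L (\<lambda>x. \<bar>V0 x\<bar> powr q)"
  using V0 by (auto simp: Lp_space_def)

text \<open>Closed upper half-lines generate the Borel sets, so rearrangements have the same distribution.\<close>

lemma distr_rearrangement:
  assumes "V \<in> R"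
  shows "distr L borel V = distr L borel V0"
proof (rule measure_eqI_generator_eq[where E = "range (\<lambda>a::real. {a..})" and \<Omega> = UNIV and A = "\<lambda>n. {- real n..}"])
  note [measurable] = R_measurable[OF assms] V0_measurable
  have em: "emeasure L {x \<in> \<Omega>. a \<le> f x} = emeasure lebesgue {x \<in> \<Omega>. a \<le> f x}" for f :: "'a \<Rightarrow> real" and a
    by (rule emeasure_restrict_space) auto
  show "Int_stable (range (\<lambda>a::real. {a..}))"
  proof (rule Int_stableI)
    fix A B :: "real set" assume "A \<in> range (\<lambda>a. {a..})" "B \<in> range (\<lambda>a. {a..})"
    then obtain a b :: real where "A = {a..}" "B = {b..}" by auto
    then have "A \<inter> B = {max a b..}" by auto
    then show "A \<inter> B \<in> range (\<lambda>a. {a..})" by auto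
  qed
  show "emeasure (distr L borel V) X = emeasure (distr L borel V0) X" if X': "X \<in> range (\<lambda>a::real. {a..})" for X
  proof -
    obtain a where X: "X = {a..}" using X' by auto
    have "V -` {a..} \<inter> \<Omega> = {x \<in> \<Omega>. a \<le> V x}" "V0 -` {a..} \<inter> \<Omega> = {x \<in> \<Omega>. a \<le> V0 x}" by auto
    then show ?thesis using assms by (simp add: X emeasure_distr em rearrangements_def)
  qed
  show "sets (distr L borel V) = sigma_sets UNIV (range (\<lambda>a::real. {a..}))"
    "sets (distr L borel V0) = sigma_sets UNIV (range (\<lambda>a::real. {a..}))"
    by (simp_all add: borel_Ici sets_measure_of)
  show "(\<Union>i. {- real i..}) = UNIV"
  proof -
    have "\<exists>n. - real n \<le> x" for x :: real using real_arch_simple[of "- x"] by (auto simp: minus_le_iff)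
    then show ?thesis by auto
  qed
  show "emeasure (distr L borel V) {- real i..} \<noteq> \<infinity>" for i
    by (simp add: emeasure_distr fL.emeasure_finite)
qed auto

lemma integral_rearrangement:
  fixes h :: "real \<Rightarrow> real"
  assumes V: "V \<in> R" and [measurable]: "h \<in> borel_measurable borel"
  shows "(LINT x|L. h (V x)) = (LINT x|L. h (V0 x))" "integrable L (\<lambda>x. h (V x)) \<longleftrightarrow> integrable L (\<lambda>x. h (V0 x))"
  using integral_distr[OF R_measurable[OF V], of h] integral_distr[OF V0_measurable, of h]
    integrable_distr_eq[OF R_measurable[OF V], of h] integrable_distr_eq[OF V0_measurable, of h] distr_rearrangement[OF V]
  by auto

lemma R_integrable_powr: "V \<in> R \<Longrightarrow> integrable L (\<lambda>x. \<bar>V x\<bar> powr q)"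
  using integral_rearrangement(2)[of V "\<lambda>t. \<bar>t\<bar> powr q"] V0_integrable by simp

lemma R_integrable: assumes "V \<in> R" shows "integrable L V"
proof (rule Bochner_Integration.integrable_bound[OF Bochner_Integration.integrable_add[OF fL.integrable_const[of 1] R_integrable_powr[OF assms]]])
  show "AE x in L. norm (V x) \<le> norm (1 + \<bar>V x\<bar> powr q)"
  proof (rule AE_I2)
    fix x
    show "norm (V x) \<le> norm (1 + \<bar>V x\<bar> powr q)"
    proof (cases "\<bar>V x\<bar> \<le> 1")
      case False
      then have "\<bar>V x\<bar> powr 1 \<le> \<bar>V x\<bar> powr q" using q_gt_1 by (intro powr_mono) auto
      then show ?thesis using False by simp
    qed (simp add: add_increasing2)
  qed
qed (use R_measurable[OF assms] in measurable)

text \<open>The absolute value of \<open>t\<close> if it exceeds the level \<open>m\<close>, and \<open>0\<close> otherwise.\<close>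

definition above :: "real \<Rightarrow> real \<Rightarrow> real" where "above m t = (if m < \<bar>t\<bar> then \<bar>t\<bar> else 0)"

lemma above_measurable [measurable]: "above m \<in> borel_measurable borel"
  unfolding above_def by measurable

text \<open>The \<open>q\<close>-th power of the \<open>L\<^sup>q\<close> norm of the large values; it is the same for all rearrangements.\<close>

definition tail :: "real \<Rightarrow> real" where "tail m = (LINT x|L. above m (V0 x) powr q)"

lemma above_le: "0 \<le> above m t" "above m t \<le> \<bar>t\<bar>" "\<bar>t\<bar> \<le> above m t + \<bar>m\<bar>"
  by (auto simp: above_def)

lemma tail_rearrangement: assumes "V \<in> R" shows "(LINT x|L. above m (V x) powr q) = tail m" "integrable L (\<lambda>x. above m (V x) powr q)"
proof -
  note [measurable] = V0_measurable
  have "integrable L (\<lambda>x. above m (V0 x) powr q)"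
    by (rule Bochner_Integration.integrable_bound[OF V0_integrable])
       (use q_gt_1 above_le in \<open>auto intro!: powr_mono2\<close>)
  then show "(LINT x|L. above m (V x) powr q) = tail m" "integrable L (\<lambda>x. above m (V x) powr q)"
    using integral_rearrangement[OF assms, of "\<lambda>t. above m t powr q"] by (auto simp: tail_def)
qed

lemma tail_tendsto: "(\<lambda>k. tail (real k)) \<longlonglongrightarrow> 0"
proof -
  note [measurable] = V0_measurable
  have "(\<lambda>k. tail (real k)) \<longlonglongrightarrow> (LINT x|L. 0)"
    unfolding tail_def
  proof (rule integral_dominated_convergence[OF _ _ V0_integrable])
    show "AE x in L. (\<lambda>k. above (real k) (V0 x) powr q) \<longlonglongrightarrow> 0"
    proof (rule AE_I2)
      fix x
      obtain N where "\<bar>V0 x\<bar> \<le> real N" using real_arch_simple by blast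
      then have "eventually (\<lambda>k. above (real k) (V0 x) powr q = 0) sequentially"
        by (intro eventually_sequentiallyI[of N]) (auto simp: above_def)
      then show "(\<lambda>k. above (real k) (V0 x) powr q) \<longlonglongrightarrow> 0" by (rule tendsto_eventually)
    qed
    show "AE x in L. norm (above (real k) (V0 x) powr q) \<le> \<bar>V0 x\<bar> powr q" for k
      using q_gt_1 above_le by (auto intro!: powr_mono2)
  qed measurable
  then show ?thesis by simp
qed

text \<open>The large values of the potential are controlled by an arbitrarily small multiple of the energy,
  with a truncation level that is common to all rearrangements.\<close>

lemma form_bound:
  assumes e: "0 < e"
  obtains m where "0 \<le> m" "\<And>V u. V \<in> R \<Longrightarrow> u \<in> W \<Longrightarrow> integrable L (\<lambda>x. above m (V x) * \<bar>u x\<bar> powr p)"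
    "\<And>V u. V \<in> R \<Longrightarrow> u \<in> W \<Longrightarrow> (LINT x|L. above m (V x) * \<bar>u x\<bar> powr p) \<le> e * E u"
proof -
  obtain C where C: "0 \<le> C" "\<And>u. u \<in> W \<Longrightarrow> integrable lebesgue (\<lambda>x. \<bar>u x\<bar> powr (p * b))"
    "\<And>u. u \<in> W \<Longrightarrow> (LINT x|lebesgue. \<bar>u x\<bar> powr (p * b)) powr (1 / b) \<le> C * E u"
    using Sobolev_inequality[OF s_pos p_gt_1 q_gt_1 b_def q_gt domain_measurable bounded_domain] by blast
  have "(\<lambda>k. tail (real k) powr (1 / q) * C) \<longlonglongrightarrow> 0 powr (1 / q) * C"
    using q_gt_1 by (intro tendsto_mult tendsto_powr2 tail_tendsto tendsto_const)
      (auto intro!: always_eventually integral_nonneg_AE simp: tail_def)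
  then have "eventually (\<lambda>k. tail (real k) powr (1 / q) * C < e) sequentially"
    using e by (intro order_tendstoD(2)) auto
  then obtain k where k: "tail (real k) powr (1 / q) * C < e" by (auto simp: eventually_sequentially)
  show ?thesis
  proof (rule that[of "real k"])
    fix V u assume V: "V \<in> R" and u: "u \<in> W"
    note [measurable] = R_measurable[OF V] W_measurable_on[OF u]
    have z: "\<bar>u x\<bar> powr (p * b) = 0" if "x \<notin> \<Omega>" for x using W_zero_outside[OF u that] by simp
    have pb: "(\<bar>u x\<bar> powr p) powr b = \<bar>u x\<bar> powr (p * b)" for x by (simp add: powr_powr)
    have ib: "integrable L (\<lambda>x. (\<bar>u x\<bar> powr p) powr b)"
      unfolding pb using integrable_lebesgue_iff_lebesgue_on[OF domain_measurable, of "\<lambda>x. \<bar>u x\<bar> powr (p * b)"] z C(2)[OF u] by blast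
    have Ib: "(LINT x|L. (\<bar>u x\<bar> powr p) powr b) = (LINT x|lebesgue. \<bar>u x\<bar> powr (p * b))"
      unfolding pb using integral_lebesgue_eq_lebesgue_on[OF domain_measurable, of "\<lambda>x. \<bar>u x\<bar> powr (p * b)"] z by blast
    note H = Holder_inequality[OF q_gt_1 b_gt_1 conj_exponents, of "\<lambda>x. above (real k) (V x)" L "\<lambda>x. \<bar>u x\<bar> powr p", OF _ _ above_le(1) _ tail_rearrangement(2)[OF V] ib]
    show "integrable L (\<lambda>x. above (real k) (V x) * \<bar>u x\<bar> powr p)" by (rule H(1)) measurable
    have "(LINT x|L. above (real k) (V x) * \<bar>u x\<bar> powr p) \<le> tail (real k) powr (1 / q) * (LINT x|lebesgue. \<bar>u x\<bar> powr (p * b)) powr (1 / b)"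
      using H(2) unfolding tail_rearrangement(1)[OF V] Ib by auto
    also have "\<dots> \<le> tail (real k) powr (1 / q) * (C * E u)"
      by (intro mult_left_mono C(3)[OF u]) auto
    also have "\<dots> \<le> e * E u"
      using mult_right_mono[OF less_imp_le[OF k] gagliardo_energy_nonneg[of s p u]] by (simp add: mult.assoc)
    finally show "(LINT x|L. above (real k) (V x) * \<bar>u x\<bar> powr p) \<le> e * E u" .
  qed simp
qed

lemma potential_integrable:
  assumes V: "V \<in> R" and u: "u \<in> W"
  shows "integrable L (\<lambda>x. V x * \<bar>u x\<bar> powr p)"
proof -
  note [measurable] = R_measurable[OF V] W_measurable_on[OF u]
  obtain m where m: "0 \<le> m" "integrable L (\<lambda>x. above m (V x) * \<bar>u x\<bar> powr p)"
    by (rule form_bound[of 1]) (simp, use V u in blast)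
  show ?thesis
  proof (rule Bochner_Integration.integrable_bound[OF Bochner_Integration.integrable_add[OF m(2) integrable_mult_right[OF mass_L(2)[OF u], of m]]])
    show "AE x in L. norm (V x * \<bar>u x\<bar> powr p) \<le> norm (above m (V x) * \<bar>u x\<bar> powr p + m * \<bar>u x\<bar> powr p)"
    proof (rule AE_I2)
      fix x
      have "\<bar>V x\<bar> * \<bar>u x\<bar> powr p \<le> (above m (V x) + m) * \<bar>u x\<bar> powr p"
        using above_le(3)[of "V x" m] m(1) by (intro mult_right_mono) auto
      then show "norm (V x * \<bar>u x\<bar> powr p) \<le> norm (above m (V x) * \<bar>u x\<bar> powr p + m * \<bar>u x\<bar> powr p)"
        by (simp add: abs_mult distrib_right)
    qed
  qed measurable
qed

lemma coercive:
  obtains A where "0 \<le> A" "\<And>V u. V \<in> R \<Longrightarrow> u \<in> W \<Longrightarrow> 1 / 4 * E u - A * mass u \<le> J V u"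
proof -
  obtain m where m: "0 \<le> m" "\<And>V u. V \<in> R \<Longrightarrow> u \<in> W \<Longrightarrow> integrable L (\<lambda>x. above m (V x) * \<bar>u x\<bar> powr p)"
    "\<And>V u. V \<in> R \<Longrightarrow> u \<in> W \<Longrightarrow> (LINT x|L. above m (V x) * \<bar>u x\<bar> powr p) \<le> 1 / 4 * E u"
    by (rule form_bound[of "1 / 4"]) (simp, blast)
  have "1 / 4 * E u - m * mass u \<le> J V u" if V: "V \<in> R" and u: "u \<in> W" for V u
  proof -
    have "- (LINT x|L. V x * \<bar>u x\<bar> powr p) = (LINT x|L. - (V x * \<bar>u x\<bar> powr p))" by simp
    also have "\<dots> \<le> (LINT x|L. above m (V x) * \<bar>u x\<bar> powr p + m * \<bar>u x\<bar> powr p)"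
    proof (rule integral_mono)
      fix x
      have "- V x * \<bar>u x\<bar> powr p \<le> (above m (V x) + m) * \<bar>u x\<bar> powr p"
        using above_le(3)[of "V x" m] m(1) by (intro mult_right_mono) auto
      then show "- (V x * \<bar>u x\<bar> powr p) \<le> above m (V x) * \<bar>u x\<bar> powr p + m * \<bar>u x\<bar> powr p"
        by (simp add: distrib_right)
    qed (use potential_integrable[OF V u] m(2)[OF V u] mass_L(2)[OF u] in auto)
    also have "\<dots> = (LINT x|L. above m (V x) * \<bar>u x\<bar> powr p) + m * mass u"
      using m(2)[OF V u] mass_L[OF u] by simp
    also have "\<dots> \<le> 1 / 4 * E u + m * mass u" using m(3)[OF V u] by simp
    finally show ?thesis by (simp add: J_def)
  qed
  then show ?thesis using that m(1) by blast
qed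

lemma J_scale:
  "J V (\<lambda>x. c * u x) = \<bar>c\<bar> powr p * J V u"
proof -
  have "(LINT x|L. V x * \<bar>c * u x\<bar> powr p) = (LINT x|L. \<bar>c\<bar> powr p * (V x * \<bar>u x\<bar> powr p))"
    by (intro Bochner_Integration.integral_cong) (auto simp: abs_mult powr_mult)
  then show ?thesis by (simp add: J_def gagliardo_energy_scale distrib_left)
qed

lemma lam_eq: "lam V = Inf {J V u | u. u \<in> W \<and> mass u = 1}"
  by (simp add: first_eigenvalue_def J_def gagliardo_seminorm_powr[OF p_pos] Lp_norm_UNIV_eq_1_iff[OF p_pos])

text \<open>A Lipschitz function that is positive exactly on \<open>\<Omega>\<close>.\<close>

definition bump :: "'a \<Rightarrow> real" where "bump x = min 1 (infdist x (- \<Omega>))"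

lemma complement_nonempty: "- \<Omega> \<noteq> {}"
proof
  assume "- \<Omega> = {}"
  then have "\<Omega> = UNIV" by blast
  then show False using bounded_domain not_bounded_UNIV by simp
qed

lemma truncated_infdist_W:
  assumes G: "open G" "G \<subseteq> \<Omega>" and k: "0 \<le> k"
  shows "(\<lambda>x. min 1 (k * infdist x (- G))) \<in> W"
proof (rule Lipschitz_in_Wsp_tilde[OF s_pos s_lt_1 p_gt_1 domain_measurable bounded_domain, where L = k and B = 1])
  have ne: "- G \<noteq> {}" using complement_nonempty G by auto
  fix x y :: 'a
  have "\<bar>infdist x (- G) - infdist y (- G)\<bar> \<le> norm (x - y)"
    using infdist_triangle_abs[of x "- G" y] by (simp add: dist_norm)
  then have "k * \<bar>infdist x (- G) - infdist y (- G)\<bar> \<le> k * norm (x - y)" using k by (intro mult_left_mono)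
  moreover have "\<bar>min 1 (k * infdist x (- G)) - min 1 (k * infdist y (- G))\<bar> \<le> \<bar>k * infdist x (- G) - k * infdist y (- G)\<bar>"
    by (smt (verit))
  moreover have "\<bar>k * infdist x (- G) - k * infdist y (- G)\<bar> = k * \<bar>infdist x (- G) - infdist y (- G)\<bar>"
    using k by (simp add: right_diff_distrib[symmetric] abs_mult)
  ultimately show "\<bar>min 1 (k * infdist x (- G)) - min 1 (k * infdist y (- G))\<bar> \<le> k * norm (x - y)" by linarith
  show "\<bar>min 1 (k * infdist x (- G))\<bar> \<le> 1" using k infdist_nonneg[of x "- G"] by (simp add: abs_le_iff)
next
  fix x assume "x \<notin> \<Omega>"
  then have "x \<in> - G" using G by auto
  then show "min 1 (k * infdist x (- G)) = 0" by simp
qed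

lemma bump_W: "bump \<in> W"
  using truncated_infdist_W[OF open_domain subset_refl, of 1] by (simp add: bump_def[abs_def])

lemma bump_bounds: "0 \<le> bump x" "bump x \<le> 1" "x \<in> \<Omega> \<Longrightarrow> 0 < bump x"
proof -
  show "0 \<le> bump x" "bump x \<le> 1" by (auto simp: bump_def infdist_nonneg)
  assume "x \<in> \<Omega>"
  then have "infdist x (- \<Omega>) \<noteq> 0"
    using in_closed_iff_infdist_zero[of "- \<Omega>" x] open_domain complement_nonempty by (simp add: closed_Compl)
  then show "0 < bump x" using infdist_nonneg[of x "- \<Omega>"] by (simp add: bump_def)
qed

lemma measure_domain_pos: "0 < measure lebesgue \<Omega>"
proof -
  obtain x r where "0 < r" "ball x r \<subseteq> \<Omega>" using nonempty_domain open_domain open_contains_ball by (metis ex_in_conv)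
  moreover have "measure lebesgue (ball x r) \<le> measure lebesgue \<Omega>"
    using emeasure_domain_finite \<open>ball x r \<subseteq> \<Omega>\<close> by (intro measure_mono_fmeasurable) (auto simp: fmeasurable_def)
  moreover have "0 < measure lebesgue (ball x r)" using \<open>0 < r\<close> by simp
  ultimately show ?thesis by linarith
qed

lemma bump_mass: "0 < mass bump"
proof (rule ccontr)
  assume "\<not> 0 < mass bump"
  then have "mass bump = 0" using mass_nonneg[of bump] by simp
  then have "AE x in lebesgue. \<bar>bump x\<bar> powr p = 0"
    using integral_nonneg_eq_0_iff_AE[OF W_integrable[OF bump_W]] by auto
  then have "AE x in lebesgue. x \<notin> \<Omega>"
  proof eventually_elim
    case (elim x)
    then show ?case using bump_bounds(3)[of x] by auto
  qed
  then have "\<Omega> \<in> null_sets lebesgue" by (simp add: AE_iff_null_sets)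
  then show False using measure_domain_pos by (simp add: measure_def null_sets_def)
qed

lemma normalize_W:
  assumes u: "u \<in> W" and pos: "0 < mass u"
  shows "(\<lambda>x. mass u powr (- (1 / p)) * u x) \<in> W" "mass (\<lambda>x. mass u powr (- (1 / p)) * u x) = 1"
    "J V (\<lambda>x. mass u powr (- (1 / p)) * u x) = J V u / mass u"
proof -
  have "\<bar>mass u powr (- (1 / p))\<bar> powr p = mass u powr (- 1)"
    using p_gt_1 by (simp add: powr_powr)
  then have c: "\<bar>mass u powr (- (1 / p))\<bar> powr p = 1 / mass u"
    using pos by (simp add: powr_minus_divide)
  show "(\<lambda>x. mass u powr (- (1 / p)) * u x) \<in> W" by (rule Wsp_tilde_scale[OF p_gt_1 domain_measurable u])
  show "mass (\<lambda>x. mass u powr (- (1 / p)) * u x) = 1" unfolding mass_scale c using pos by simp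
  show "J V (\<lambda>x. mass u powr (- (1 / p)) * u x) = J V u / mass u" unfolding J_scale c by simp
qed

lemma admissible_ne: "{J V u | u. u \<in> W \<and> mass u = 1} \<noteq> {}"
  using normalize_W(1,2)[OF bump_W bump_mass] by auto

lemma admissible_bdd: assumes "V \<in> R" shows "bdd_below {J V u | u. u \<in> W \<and> mass u = 1}"
proof -
  obtain A where A: "0 \<le> A" "\<And>V u. V \<in> R \<Longrightarrow> u \<in> W \<Longrightarrow> 1 / 4 * E u - A * mass u \<le> J V u"
    using coercive by blast
  show ?thesis
  proof (rule bdd_belowI)
    fix y assume "y \<in> {J V u | u. u \<in> W \<and> mass u = 1}"
    then obtain u where u: "y = J V u" "u \<in> W" "mass u = 1" by auto
    then show "- A \<le> y" using A(2)[OF assms u(2)] gagliardo_energy_nonneg[of s p u] by simp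
  qed
qed

lemma lam_le:
  assumes V: "V \<in> R" and u: "u \<in> W"
  shows "lam V * mass u \<le> J V u"
proof (cases "mass u = 0")
  case True
  then have "AE x in lebesgue. \<bar>u x\<bar> powr p = 0"
    using integral_nonneg_eq_0_iff_AE[OF W_integrable[OF u]] by auto
  then have "AE x in L. \<bar>u x\<bar> powr p = 0" by (subst AE_restrict_space_iff) (auto elim!: eventually_mono)
  then have "(LINT x|L. V x * \<bar>u x\<bar> powr p) = 0" by (intro integral_eq_zero_AE) (auto elim!: eventually_mono)
  then show ?thesis using True gagliardo_energy_nonneg[of s p u] by (simp add: J_def)
next
  case False
  then have pos: "0 < mass u" using mass_nonneg[of u] by linarith
  have "lam V \<le> J V u / mass u"
    unfolding lam_eq by (rule cInf_lower[OF _ admissible_bdd[OF V]]) (use normalize_W[OF u pos] in \<open>auto simp del: Bochner_Integration.integral_mult_right_zero intro!: exI\<close>)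
  then show ?thesis using pos by (simp add: field_simps)
qed

text \<open>The functional \<open>J V w - lam V * mass w\<close> is nonnegative and vanishes at \<open>w = u\<close>; hence its derivative at \<open>u\<close>
  is nonnegative in every direction, and by linearity it is zero.\<close>

lemma Euler_Lagrange:
  assumes V: "V \<in> R" and u: "u \<in> W" and min: "J V u = lam V * mass u" and v: "v \<in> W"
  shows "H_form s p u v + (LINT x|L. V x * \<bar>u x\<bar> powr (p - 2) * u x * v x)
    = lam V * (LINT x|lebesgue. \<bar>u x\<bar> powr (p - 2) * u x * v x)"
proof -
  define D where "D v = H_form s p u v + (LINT x|L. V x * \<bar>u x\<bar> powr (p - 2) * u x * v x)
    - lam V * (LINT x|lebesgue. \<bar>u x\<bar> powr (p - 2) * u x * v x)" for v
  have main: "0 \<le> D v" if v: "v \<in> W" for v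
  proof -
    let ?t = "\<lambda>n. 1 / real (Suc n)"
    let ?w = "\<lambda>n x. u x + ?t n * v x"
    note [measurable] = W_measurable[OF u] W_measurable[OF v] W_measurable_on[OF u] W_measurable_on[OF v] R_measurable[OF V]
    have w: "?w n \<in> W" for n by (rule Wsp_tilde_add[OF p_gt_1 domain_measurable u Wsp_tilde_scale[OF p_gt_1 domain_measurable v]])
    let ?k = "\<lambda>z::'a \<times> 'a. 1 / norm (fst z - snd z) powr (real DIM('a) + s * p)"
    let ?d = "\<lambda>f z::'a \<times> 'a. f (fst z) - f (snd z) :: real"
    have g: "gagliardo_integrand s p f = (\<lambda>z. ?k z * \<bar>?d f z\<bar> powr p)" for f
      by (auto simp: gagliardo_integrand_def)
    have Ew: "E (?w n) = (LINT z|(lebesgue \<Otimes>\<^sub>M lebesgue). ?k z * \<bar>?d u z + ?t n * ?d v z\<bar> powr p)" for n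
      unfolding gagliardo_energy_def g by (intro Bochner_Integration.integral_cong) (auto simp: algebra_simps)
    have Eu: "E u = (LINT z|(lebesgue \<Otimes>\<^sub>M lebesgue). ?k z * \<bar>?d u z\<bar> powr p)"
      unfolding gagliardo_energy_def g ..
    have H: "(LINT z|(lebesgue \<Otimes>\<^sub>M lebesgue). ?k z * (\<bar>?d u z\<bar> powr (p - 2) * ?d u z * ?d v z)) = 2 * H_form s p u v"
      unfolding H_form_def case_prod_beta by simp
    have l1: "(\<lambda>n. (E (?w n) - E u) / ?t n) \<longlonglongrightarrow> p * (2 * H_form s p u v)"
      unfolding Ew Eu H[symmetric]
      by (rule integral_abs_powr_quotient_tendsto[OF p_gt_1]) (use W_integrable_gagliardo[OF u] W_integrable_gagliardo[OF v] in \<open>measurable, auto simp: g\<close>)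
    have l2: "(\<lambda>n. ((LINT x|L. V x * \<bar>?w n x\<bar> powr p) - (LINT x|L. V x * \<bar>u x\<bar> powr p)) / ?t n)
        \<longlonglongrightarrow> p * (LINT x|L. V x * (\<bar>u x\<bar> powr (p - 2) * u x * v x))"
      by (rule integral_abs_powr_quotient_tendsto[OF p_gt_1 W_measurable_on[OF u] W_measurable_on[OF v] R_measurable[OF V]
            potential_integrable[OF V u] potential_integrable[OF V v]])
    have l3: "(\<lambda>n. (mass (?w n) - mass u) / ?t n) \<longlonglongrightarrow> p * (LINT x|lebesgue. \<bar>u x\<bar> powr (p - 2) * u x * v x)"
      using integral_abs_powr_quotient_tendsto[OF p_gt_1, of u lebesgue v "\<lambda>_. 1"] W_integrable[OF u] W_integrable[OF v] by simp
    have lim: "(\<lambda>n. 1 / 2 * ((E (?w n) - E u) / ?t n)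
        + ((LINT x|L. V x * \<bar>?w n x\<bar> powr p) - (LINT x|L. V x * \<bar>u x\<bar> powr p)) / ?t n - lam V * ((mass (?w n) - mass u) / ?t n))
        \<longlonglongrightarrow> 1 / 2 * (p * (2 * H_form s p u v)) + p * (LINT x|L. V x * (\<bar>u x\<bar> powr (p - 2) * u x * v x))
          - lam V * (p * (LINT x|lebesgue. \<bar>u x\<bar> powr (p - 2) * u x * v x))"
      by (intro tendsto_intros l1 l2 l3)
    have "0 \<le> 1 / 2 * ((E (?w n) - E u) / ?t n)
        + ((LINT x|L. V x * \<bar>?w n x\<bar> powr p) - (LINT x|L. V x * \<bar>u x\<bar> powr p)) / ?t n - lam V * ((mass (?w n) - mass u) / ?t n)" for n
    proof -
      have t: "0 < ?t n" by simp
      have "0 \<le> (J V (?w n) - lam V * mass (?w n) - (J V u - lam V * mass u)) / ?t n"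
        using lam_le[OF V w[of n]] min t by (intro divide_nonneg_pos) auto
      also have "\<dots> = 1 / 2 * ((E (?w n) - E u) / ?t n)
        + ((LINT x|L. V x * \<bar>?w n x\<bar> powr p) - (LINT x|L. V x * \<bar>u x\<bar> powr p)) / ?t n - lam V * ((mass (?w n) - mass u) / ?t n)"
        unfolding J_def using t by (simp only: divide_inverse) (simp only: algebra_simps)
      finally show ?thesis .
    qed
    then have "0 \<le> 1 / 2 * (p * (2 * H_form s p u v)) + p * (LINT x|L. V x * (\<bar>u x\<bar> powr (p - 2) * u x * v x))
          - lam V * (p * (LINT x|lebesgue. \<bar>u x\<bar> powr (p - 2) * u x * v x))"
      by (intro LIMSEQ_le_const[OF lim]) auto
    also have "\<dots> = p * D v" by (simp add: D_def algebra_simps)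
    finally show ?thesis using p_pos by (simp add: zero_le_mult_iff)
  qed
  have "0 \<le> D v" using main[OF v] .
  moreover have "0 \<le> D (\<lambda>x. - v x)"
    using main Wsp_tilde_scale[OF p_gt_1 domain_measurable v, of "-1"] by simp
  moreover have "D (\<lambda>x. - v x) = - D v" by (simp add: D_def H_form_minus)
  ultimately show ?thesis by (simp add: D_def)
qed

text \<open>The amount by which the Gagliardo integrands of \<open>u\<close> and \<open>w\<close> exceed those of their maximum and minimum.\<close>

definition excess :: "('a \<Rightarrow> real) \<Rightarrow> ('a \<Rightarrow> real) \<Rightarrow> 'a \<times> 'a \<Rightarrow> real" where
  "excess u w z = gagliardo_integrand s p u z + gagliardo_integrand s p w z
    - gagliardo_integrand s p (\<lambda>x. max (u x) (w x)) z - gagliardo_integrand s p (\<lambda>x. min (u x) (w x)) z"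

lemma excess_nonneg: "0 \<le> excess u w z"
  using gagliardo_integrand_max_min_le[OF p_gt_1, of s u w z] by (simp add: excess_def)

lemma excess_integrable:
  assumes "u \<in> W" "w \<in> W"
  shows "integrable (lebesgue \<Otimes>\<^sub>M lebesgue) (excess u w)"
  unfolding excess_def[abs_def]
  by (intro Bochner_Integration.integrable_diff Bochner_Integration.integrable_add W_integrable_gagliardo assms
      Wsp_tilde_max[OF p_gt_1 domain_measurable] Wsp_tilde_min[OF p_gt_1 domain_measurable])

text \<open>The potential and the norm terms of the maximum and the minimum add up to those of \<open>u\<close> and \<open>w\<close>. For
  neither of the two can \<open>J\<close> be less than the first eigenvalue times the mass, so the gain in energy is
  bounded by the amount by which \<open>J V w\<close> exceeds this value.\<close>

lemma excess_le:
  assumes V: "V \<in> R" and u: "u \<in> W" and min: "J V u = lam V * mass u" and w: "w \<in> W"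
  shows "1 / 2 * (LINT z|(lebesgue \<Otimes>\<^sub>M lebesgue). excess u w z) \<le> J V w - lam V * mass w"
proof -
  let ?M = "\<lambda>x. max (u x) (w x)" and ?m = "\<lambda>x. min (u x) (w x)"
  have M: "?M \<in> W" and m: "?m \<in> W" using Wsp_tilde_max[OF p_gt_1 domain_measurable u w] Wsp_tilde_min[OF p_gt_1 domain_measurable u w] .
  have ex: "(LINT z|(lebesgue \<Otimes>\<^sub>M lebesgue). excess u w z) = E u + E w - E ?M - E ?m"
    unfolding excess_def gagliardo_energy_def
    using W_integrable_gagliardo[OF u] W_integrable_gagliardo[OF w] W_integrable_gagliardo[OF M] W_integrable_gagliardo[OF m] by simp
  have pt: "\<bar>?M x\<bar> powr p + \<bar>?m x\<bar> powr p = \<bar>u x\<bar> powr p + \<bar>w x\<bar> powr p" for x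
    by (auto simp: max_def min_def)
  have mass: "mass ?M + mass ?m = mass u + mass w"
    using W_integrable[OF u] W_integrable[OF w] W_integrable[OF M] W_integrable[OF m]
    by (simp only: Bochner_Integration.integral_add[symmetric] pt)
  have pot: "(LINT x|L. V x * \<bar>?M x\<bar> powr p) + (LINT x|L. V x * \<bar>?m x\<bar> powr p)
      = (LINT x|L. V x * \<bar>u x\<bar> powr p) + (LINT x|L. V x * \<bar>w x\<bar> powr p)"
    using potential_integrable[OF V u] potential_integrable[OF V w] potential_integrable[OF V M] potential_integrable[OF V m]
    by (simp only: Bochner_Integration.integral_add[symmetric] pt distrib_left[symmetric])
  have "J V ?M + J V ?m + 1 / 2 * (LINT z|(lebesgue \<Otimes>\<^sub>M lebesgue). excess u w z) = J V u + J V w"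
    unfolding ex J_def using pot by (simp add: algebra_simps)
  moreover have "lam V * mass ?M \<le> J V ?M" "lam V * mass ?m \<le> J V ?m" by (rule lam_le[OF V M], rule lam_le[OF V m])
  moreover have "lam V * mass ?M + lam V * mass ?m = lam V * mass u + lam V * mass w"
    using mass by (simp only: distrib_left[symmetric])
  ultimately show ?thesis using min by linarith
qed

lemma excess_pos:
  assumes "w (fst z) < u (fst z)" "u (snd z) < w (snd z)"
  shows "0 < excess u w z"
proof -
  have "fst z \<noteq> snd z" using assms by auto
  then have k: "0 < norm (fst z - snd z) powr (real DIM('a) + s * p)" by simp
  show ?thesis
    using divide_strict_right_mono[OF powr_max_min_less[OF p_gt_1 assms] k]
    by (simp add: excess_def gagliardo_integrand_def case_prod_beta add_divide_distrib)
qed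

text \<open>For two minimisers the excess vanishes almost everywhere. It is positive on \<open>{w < u} \<times> {u < w}\<close>, so one
  of these two sets is a null set and the functions are ordered.\<close>

lemma minimizers_unique:
  assumes V: "V \<in> R" and u: "u \<in> W" "J V u = lam V * mass u" and w: "w \<in> W" "J V w = lam V * mass w"
    and pos: "AE x in lebesgue. 0 \<le> u x" "AE x in lebesgue. 0 \<le> w x" and eq: "mass u = mass w"
  shows "AE x in lebesgue. w x = u x"
proof -
  note [measurable] = W_measurable[OF u(1)] W_measurable[OF w(1)]
  have ordered: "AE x in lebesgue. f x = g x" if le: "AE x in lebesgue. f x \<le> g x" and f: "f \<in> W" "AE x in lebesgue. 0 \<le> f x"
    and g: "g \<in> W" and m: "mass f = mass g" for f g
  proof -
    have "AE x in lebesgue. \<bar>g x\<bar> powr p - \<bar>f x\<bar> powr p = 0"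
    proof (subst integral_nonneg_eq_0_iff_AE[symmetric])
      show "AE x in lebesgue. 0 \<le> \<bar>g x\<bar> powr p - \<bar>f x\<bar> powr p"
        using le f(2) by eventually_elim (use p_gt_1 in \<open>auto intro: powr_mono2\<close>)
    qed (use W_integrable[OF f(1)] W_integrable[OF g] m in auto)
    then show ?thesis
      using le f(2)
    proof eventually_elim
      case (elim x)
      then have "\<bar>f x\<bar> = \<bar>g x\<bar>"
        using powr_less_mono2[OF p_pos, of "\<bar>f x\<bar>" "\<bar>g x\<bar>"] powr_less_mono2[OF p_pos, of "\<bar>g x\<bar>" "\<bar>f x\<bar>"]
        by (cases "\<bar>f x\<bar>" "\<bar>g x\<bar>" rule: linorder_cases) auto
      then show ?case using elim by simp
    qed
  qed
  have "(LINT z|(lebesgue \<Otimes>\<^sub>M lebesgue). excess u w z) \<le> 0"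
    using excess_le[OF V u w(1)] w(2) by simp
  moreover have "0 \<le> (LINT z|(lebesgue \<Otimes>\<^sub>M lebesgue). excess u w z)"
    by (intro integral_nonneg_AE AE_I2 excess_nonneg)
  ultimately have "(LINT z|(lebesgue \<Otimes>\<^sub>M lebesgue). excess u w z) = 0" by linarith
  then have "AE z in lebesgue \<Otimes>\<^sub>M lebesgue. excess u w z = 0"
    using integral_nonneg_eq_0_iff_AE[OF excess_integrable[OF u(1) w(1)] AE_I2[OF excess_nonneg]] by simp
  then have AE_notin: "AE z in lebesgue \<Otimes>\<^sub>M lebesgue. z \<notin> {x. w x < u x} \<times> {x. u x < w x}"
    by eventually_elim (use excess_pos in force)
  have lt_sets: "{x. w x < u x} \<in> sets lebesgue" "{x. u x < w x} \<in> sets lebesgue"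
    using borel_measurable_less[OF W_measurable[OF w(1)] W_measurable[OF u(1)]] borel_measurable_less[OF W_measurable[OF u(1)] W_measurable[OF w(1)]] by simp_all
  have "{x. w x < u x} \<times> {x. u x < w x} \<in> sets (lebesgue \<Otimes>\<^sub>M (lebesgue :: 'a measure))"
    by (intro pair_measureI lt_sets)
  with AE_notin have "{x. w x < u x} \<times> {x. u x < w x} \<in> null_sets (lebesgue \<Otimes>\<^sub>M (lebesgue :: 'a measure))"
    by (simp add: AE_iff_null_sets)
  then have "emeasure lebesgue {x. w x < u x} * emeasure lebesgue {x. u x < w x} = 0"
    using leb.emeasure_pair_measure_Times[OF lt_sets] by (simp add: null_sets_def)
  then consider "{x. w x < u x} \<in> null_sets lebesgue" | "{x. u x < w x} \<in> null_sets lebesgue"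
    using lt_sets by (auto simp: null_sets_def)
  then show ?thesis
  proof cases
    case 1
    then have "AE x in lebesgue. u x \<le> w x" by (rule AE_I'[where N = "{x. w x < u x}"]) auto
    then have "AE x in lebesgue. u x = w x" using ordered[of u w] u w pos eq by blast
    then show ?thesis by eventually_elim simp
  next
    case 2
    then have "AE x in lebesgue. w x \<le> u x" by (rule AE_I'[where N = "{x. u x < w x}"]) auto
    then have "AE x in lebesgue. w x = u x" using ordered[of w u] u w pos eq[symmetric] by blast
    then show ?thesis by eventually_elim simp
  qed
qed

lemma powr_diff_lower_bound:
  fixes c h y :: real
  assumes "0 < h" "h \<le> c / 2" "c \<le> y"
  shows "h * (p * (c / 2) powr (p - 1)) \<le> y powr p - (y - h) powr p"
proof -
  have "\<exists>z>y - h. z < y \<and> y powr p - (y - h) powr p = (y - (y - h)) * (p * z powr (p - 1))"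
    using assms by (intro MVT2) (auto intro!: has_real_derivative_powr)
  then obtain z where z: "y - h < z" "y powr p - (y - h) powr p = h * (p * z powr (p - 1))" by auto
  have "(c / 2) powr (p - 1) \<le> z powr (p - 1)" using assms z p_gt_1 by (intro powr_mono2) auto
  then show ?thesis unfolding z(2) using assms p_pos by (intro mult_left_mono) auto
qed

text \<open>The gain from a zero of \<open>u\<close> at the first and a value at least \<open>c\<close> at the second point, when \<open>u\<close> is
  compared with a small multiple of \<open>\<phi>\<close>: it is of order \<open>t\<close>, up to an error of order \<open>t\<^sup>p\<close>.\<close>

lemma excess_lower_bound:
  assumes z: "u (fst z) = 0" "\<delta> \<le> \<phi> (fst z)" "\<phi> (fst z) \<le> 1" "0 \<le> \<phi> (snd z)" "\<phi> (snd z) \<le> 1" "c \<le> u (snd z)"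
    and pos: "0 < \<delta>" "0 < t" "t \<le> c / 2" and D: "norm (fst z - snd z) \<le> D"
    and nn: "t powr p \<le> p * (c / 2) powr (p - 1) * \<delta> * t"
  shows "(p * (c / 2) powr (p - 1) * \<delta> * t - t powr p) / D powr (real DIM('a) + s * p) \<le> excess u (\<lambda>x. t * \<phi> x) z"
proof -
  define x where "x = fst z"
  define y where "y = snd z"
  define a where "a = real DIM('a) + s * p"
  have xy: "x \<noteq> y" using z pos by (auto simp: x_def y_def)
  have \<phi>0: "0 < \<phi> x" using z pos by (simp add: x_def)
  have le: "t * \<phi> y \<le> t" "t * \<phi> x \<le> t" using z pos by (auto simp: x_def y_def mult_left_le)
  have cases: "max (u x) (t * \<phi> x) = t * \<phi> x" "min (u x) (t * \<phi> x) = 0" "max (u y) (t * \<phi> y) = u y" "min (u y) (t * \<phi> y) = t * \<phi> y"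
  proof -
    have "0 < t * \<phi> x" using pos \<phi>0 by simp
    moreover have "t * \<phi> y < u y" using z pos le unfolding y_def[symmetric] by linarith
    ultimately show "max (u x) (t * \<phi> x) = t * \<phi> x" "min (u x) (t * \<phi> x) = 0"
      "max (u y) (t * \<phi> y) = u y" "min (u y) (t * \<phi> y) = t * \<phi> y"
      using z by (auto simp: x_def)
  qed
  have "p * (c / 2) powr (p - 1) * \<delta> * t \<le> (t * \<phi> x) * (p * (c / 2) powr (p - 1))"
  proof -
    have "\<delta> * (p * (c / 2) powr (p - 1) * t) \<le> \<phi> x * (p * (c / 2) powr (p - 1) * t)"
      using z p_pos pos by (intro mult_right_mono) (auto simp: x_def)
    then show ?thesis by (simp add: mult_ac)
  qed
  also have "\<dots> \<le> u y powr p - (u y - t * \<phi> x) powr p"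
  proof (rule powr_diff_lower_bound)
    show "0 < t * \<phi> x" using pos \<phi>0 by simp
    show "t * \<phi> x \<le> c / 2" using le pos by linarith
    show "c \<le> u y" using z by (simp add: y_def)
  qed
  finally have 1: "p * (c / 2) powr (p - 1) * \<delta> * t \<le> u y powr p - (u y - t * \<phi> x) powr p" .
  have 2: "\<bar>t * \<phi> y\<bar> powr p \<le> t powr p" using z pos le p_pos by (intro powr_mono2) (auto simp: y_def)
  have e: "excess u (\<lambda>x. t * \<phi> x) z = (u y powr p + \<bar>t * \<phi> x - t * \<phi> y\<bar> powr p - (u y - t * \<phi> x) powr p - \<bar>t * \<phi> y\<bar> powr p) / norm (x - y) powr a"
  proof -
    have "\<bar>u x - u y\<bar> = u y" using z pos by (simp add: x_def y_def)
    moreover have "\<bar>t * \<phi> x - u y\<bar> = u y - t * \<phi> x"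
      using z(6) pos le unfolding y_def[symmetric] by linarith
    ultimately show ?thesis
      unfolding excess_def gagliardo_integrand_def case_prod_beta x_def[symmetric] y_def[symmetric] a_def[symmetric] cases
      by (simp add: add_divide_distrib diff_divide_distrib)
  qed
  have "(p * (c / 2) powr (p - 1) * \<delta> * t - t powr p) / D powr a \<le> (p * (c / 2) powr (p - 1) * \<delta> * t - t powr p) / norm (x - y) powr a"
    using nn D xy s_pos p_pos by (intro divide_left_mono powr_mono2 mult_pos_pos) (auto simp: x_def y_def a_def)
  also have "\<dots> \<le> excess u (\<lambda>x. t * \<phi> x) z"
    unfolding e using 1 2 powr_ge_zero[of "\<bar>t * \<phi> x - t * \<phi> y\<bar>" p]
    by (intro divide_right_mono powr_ge_zero) linarith
  finally show ?thesis by (simp add: a_def)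
qed

text \<open>If the zero set had positive measure, then the product of the parts on which \<open>u = 0\<close> and the bump
  function is at least \<open>\<delta>\<close>, and on which \<open>u \<ge> c\<close>, would have positive measure for suitable \<open>\<delta>\<close> and \<open>c\<close>. By
  \<open>excess_le\<close> this gives \<open>const * t \<le> const' * t\<^sup>p\<close> for all small \<open>t\<close>.\<close>

lemma minimizer_positive:
  assumes V: "V \<in> R" and u: "u \<in> W" and min: "J V u = lam V * mass u" and nn: "\<And>x. 0 \<le> u x" and m: "0 < mass u"
  shows "AE x in lebesgue. x \<in> \<Omega> \<longrightarrow> 0 < u x"
proof (rule ccontr)
  assume contra: "\<not> (AE x in lebesgue. x \<in> \<Omega> \<longrightarrow> 0 < u x)"
  note [measurable] = W_measurable[OF u] W_measurable[OF bump_W]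
  define A where "A j = {x \<in> \<Omega>. u x = 0 \<and> 1 / real (Suc j) \<le> bump x}" for j
  define B where "B j = {x. 1 / real (Suc j) \<le> u x}" for j
  have Am [measurable]: "A j \<in> sets lebesgue" for j
  proof -
    have "{x \<in> space lebesgue. x \<in> \<Omega> \<and> u x = 0 \<and> 1 / real (Suc j) \<le> bump x} \<in> sets lebesgue" by measurable
    then show ?thesis by (simp add: A_def)
  qed
  have Bm [measurable]: "B j \<in> sets lebesgue" for j
  proof -
    have "{x \<in> space lebesgue. 1 / real (Suc j) \<le> u x} \<in> sets lebesgue" by measurable
    then show ?thesis by (simp add: B_def)
  qed
  have B\<Omega>: "B j \<subseteq> \<Omega>" for j using W_zero_outside[OF u] by (force simp: B_def)
  have "\<exists>j. A j \<notin> null_sets lebesgue"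
  proof (rule ccontr)
    assume "\<nexists>j. A j \<notin> null_sets lebesgue"
    then have N: "(\<Union>j. A j) \<in> null_sets lebesgue" by (intro null_sets_UN) auto
    have "AE x in lebesgue. x \<in> \<Omega> \<longrightarrow> 0 < u x"
    proof (rule AE_I'[OF N])
      show "{x \<in> space lebesgue. \<not> (x \<in> \<Omega> \<longrightarrow> 0 < u x)} \<subseteq> (\<Union>j. A j)"
      proof
        fix x assume "x \<in> {x \<in> space lebesgue. \<not> (x \<in> \<Omega> \<longrightarrow> 0 < u x)}"
        then have x: "x \<in> \<Omega>" "u x = 0" using nn[of x] by auto
        obtain j where "1 / real (Suc j) < bump x" using nat_approx_posE[OF bump_bounds(3)[OF x(1)]] by blast
        then show "x \<in> (\<Union>j. A j)" using x by (auto simp: A_def intro: less_imp_le)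
      qed
    qed
    then show False using contra by blast
  qed
  then obtain i where i: "A i \<notin> null_sets lebesgue" by blast
  have "\<exists>j. B j \<notin> null_sets lebesgue"
  proof (rule ccontr)
    assume "\<nexists>j. B j \<notin> null_sets lebesgue"
    then have N: "(\<Union>j. B j) \<in> null_sets lebesgue" by (intro null_sets_UN) auto
    have "AE x in lebesgue. \<bar>u x\<bar> powr p = 0"
    proof (rule AE_I'[OF N])
      show "{x \<in> space lebesgue. \<not> (\<bar>u x\<bar> powr p = 0)} \<subseteq> (\<Union>j. B j)"
      proof
        fix x assume "x \<in> {x \<in> space lebesgue. \<not> (\<bar>u x\<bar> powr p = 0)}"
        then have x: "0 < u x" using nn[of x] by auto
        obtain j where "1 / real (Suc j) < u x" using nat_approx_posE[OF x] by blast
        then show "x \<in> (\<Union>j. B j)" by (auto simp: B_def intro: less_imp_le)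
      qed
    qed
    then have "mass u = 0" by (rule integral_eq_zero_AE)
    then show False using m by simp
  qed
  then obtain j where j: "B j \<notin> null_sets lebesgue" by blast
  obtain D where D: "0 < D" "\<And>x y. x \<in> \<Omega> \<Longrightarrow> y \<in> \<Omega> \<Longrightarrow> norm (x - y) \<le> D"
  proof -
    obtain r where r: "0 < r" "\<And>x. x \<in> \<Omega> \<Longrightarrow> norm x \<le> r" using bounded_domain by (auto simp: bounded_pos)
    have "norm (x - y) \<le> 2 * r" if "x \<in> \<Omega>" "y \<in> \<Omega>" for x y
      using norm_triangle_ineq4[of x y] r(2)[OF that(1)] r(2)[OF that(2)] by simp
    then show ?thesis using that[of "2 * r"] r by auto
  qed
  define \<delta> where "\<delta> = 1 / real (Suc i)"
  define c where "c = 1 / real (Suc j)"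
  define \<kappa> where "\<kappa> = p * (c / 2) powr (p - 1) * \<delta>"
  define a where "a = real DIM('a) + s * p"
  define K where "K = J V bump - lam V * mass bump"
  have dc: "0 < \<delta>" "0 < c" "0 < \<kappa>" using p_pos by (auto simp: \<delta>_def c_def \<kappa>_def)
  define P where "P = measure lebesgue (A i) * measure lebesgue (B j) / D powr a"
  have fin: "emeasure lebesgue S < \<infinity>" if "S \<subseteq> \<Omega>" "S \<in> sets lebesgue" for S
    using emeasure_mono[OF that(1) domain_measurable] emeasure_domain_finite by (rule le_less_trans)
  have pos_measure: "0 < measure lebesgue S" if "S \<subseteq> \<Omega>" "S \<in> sets lebesgue" "S \<notin> null_sets lebesgue" for S
  proof -
    have "emeasure lebesgue S \<noteq> 0" using that by (simp add: null_sets_def)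
    then show ?thesis using fin[OF that(1,2)] unfolding measure_def
      by (simp only: enn2real_positive_iff) (simp only: zero_less_iff_neq_zero infinity_ennreal_def simp_thms)
  qed
  have A\<Omega>: "A i \<subseteq> \<Omega>" by (auto simp: A_def)
  have P: "0 < P" using pos_measure[OF A\<Omega> Am i] pos_measure[OF B\<Omega> Bm j] D(1) by (simp add: P_def)
  have main: "1 / 2 * ((\<kappa> * t - t powr p) * P) \<le> t powr p * K" if t: "0 < t" "t \<le> c / 2" "t powr p \<le> \<kappa> * t" for t
  proof -
    let ?w = "\<lambda>x. t * bump x"
    have w: "?w \<in> W" by (rule Wsp_tilde_scale[OF p_gt_1 domain_measurable bump_W])
    let ?Q = "(\<kappa> * t - t powr p) / D powr a"
    have AB: "A i \<times> B j \<in> sets (lebesgue \<Otimes>\<^sub>M lebesgue)" by measurable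
    have em: "emeasure (lebesgue \<Otimes>\<^sub>M lebesgue) (A i \<times> B j) = emeasure lebesgue (A i) * emeasure lebesgue (B j)"
      by (rule leb.emeasure_pair_measure_Times) measurable
    have "emeasure (lebesgue \<Otimes>\<^sub>M lebesgue) (A i \<times> B j) < \<infinity>"
      unfolding em using fin[OF A\<Omega> Am] fin[OF B\<Omega> Bm, of j] by (simp only: infinity_ennreal_def) (rule ennreal_mult_less_top[THEN iffD2], simp)
    then have iAB: "integrable (lebesgue \<Otimes>\<^sub>M lebesgue) (indicator (A i \<times> B j) :: _ \<Rightarrow> real)"
      using AB by (intro integrable_real_indicator)
    have mAB: "measure (lebesgue \<Otimes>\<^sub>M lebesgue) (A i \<times> B j) = measure lebesgue (A i) * measure lebesgue (B j)"
      unfolding measure_def em by (rule enn2real_mult)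
    have pt: "?Q * indicator (A i \<times> B j) z \<le> excess u ?w z" for z
    proof (cases "z \<in> A i \<times> B j")
      case True
      then have "fst z \<in> A i" "snd z \<in> B j" by auto
      moreover have "norm (fst z - snd z) \<le> D" using D(2) A\<Omega> B\<Omega> calculation by blast
      ultimately show ?thesis
        using excess_lower_bound[of u z \<delta> bump c t D] t dc bump_bounds True
        by (simp add: \<kappa>_def a_def A_def B_def \<delta>_def c_def)
    next
      case False
      then show ?thesis using excess_nonneg by simp
    qed
    have "(\<kappa> * t - t powr p) * P = ?Q * measure (lebesgue \<Otimes>\<^sub>M lebesgue) (A i \<times> B j)"
      unfolding mAB P_def by simp
    also have "\<dots> = (LINT z|(lebesgue \<Otimes>\<^sub>M lebesgue). ?Q * indicator (A i \<times> B j) z)"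
      using iAB by (simp add: space_pair_measure)
    also have "\<dots> \<le> (LINT z|(lebesgue \<Otimes>\<^sub>M lebesgue). excess u ?w z)"
      by (rule integral_mono[OF integrable_mult_right[OF iAB] excess_integrable[OF u w] pt])
    finally have "1 / 2 * ((\<kappa> * t - t powr p) * P) \<le> J V ?w - lam V * mass ?w"
      using excess_le[OF V u min w] by linarith
    also have "\<dots> = t powr p * K"
      unfolding J_scale mass_scale K_def using t by (simp add: right_diff_distrib)
    finally show ?thesis .
  qed
  have t0: "(\<lambda>n. 1 / real (Suc n)) \<longlonglongrightarrow> 0"
    using LIMSEQ_inverse_real_of_nat by (simp add: inverse_eq_divide)
  then have "(\<lambda>n. (1 / real (Suc n)) powr (p - 1)) \<longlonglongrightarrow> 0 powr (p - 1)"
    using p_gt_1 by (intro tendsto_powr2 tendsto_const) auto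
  then have t1: "(\<lambda>n. (1 / real (Suc n)) powr (p - 1)) \<longlonglongrightarrow> 0" by simp
  have t2: "(\<lambda>n. (1 / real (Suc n)) powr (p - 1) * (K + 1 / 2 * P)) \<longlonglongrightarrow> 0 * (K + 1 / 2 * P)"
    by (intro tendsto_intros t1)
  have "eventually (\<lambda>n. 1 / real (Suc n) < c / 2 \<and> (1 / real (Suc n)) powr (p - 1) < \<kappa>
      \<and> (1 / real (Suc n)) powr (p - 1) * (K + 1 / 2 * P) < 1 / 2 * \<kappa> * P) sequentially"
    using dc P by (intro eventually_conj order_tendstoD(2)[OF t0] order_tendstoD(2)[OF t1] order_tendstoD(2)[OF t2]) auto
  then obtain n where n: "1 / real (Suc n) < c / 2" "(1 / real (Suc n)) powr (p - 1) < \<kappa>"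
      "(1 / real (Suc n)) powr (p - 1) * (K + 1 / 2 * P) < 1 / 2 * \<kappa> * P"
    by (auto simp: eventually_sequentially)
  define t where "t = 1 / real (Suc n)"
  have t: "0 < t" by (simp add: t_def)
  have tp: "t powr p = t powr (p - 1) * t" using t powr_add[of t "p - 1" 1] by simp
  have "1 / 2 * ((\<kappa> * t - t powr p) * P) \<le> t powr p * K"
    using n[folded t_def] t by (intro main) (auto simp: tp intro: mult_right_mono less_imp_le)
  then have "t * (1 / 2 * \<kappa> * P) \<le> t * (t powr (p - 1) * (K + 1 / 2 * P))"
    unfolding tp by (simp add: algebra_simps)
  then have "1 / 2 * \<kappa> * P \<le> t powr (p - 1) * (K + 1 / 2 * P)"
    using t by (subst (asm) mult_le_cancel_left_pos) auto
  then show False using n(3) by (simp add: t_def)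
qed

end

section \<open>Optimal potentials\<close>

text \<open>Measurable sets are, up to null sets, countable intersections of open sets.\<close>

lemma AE_zero_of_open_integrals:
  fixes g :: "'a::euclidean_space \<Rightarrow> real"
  assumes \<Omega>: "open \<Omega>" and g: "integrable (lebesgue_on \<Omega>) g"
    and zero: "\<And>G. open G \<Longrightarrow> G \<subseteq> \<Omega> \<Longrightarrow> (LINT x|lebesgue_on \<Omega>. indicator G x * g x) = 0"
  shows "AE x in lebesgue_on \<Omega>. g x = 0"
proof (rule density_unique_real[OF g])
  fix A assume "A \<in> sets (lebesgue_on \<Omega>)"
  then have A: "A \<in> sets lebesgue" "A \<subseteq> \<Omega>" using \<Omega> by (auto simp: sets_restrict_space)
  have "\<exists>T. open T \<and> A \<subseteq> T \<and> T - A \<in> sets lebesgue \<and> emeasure lebesgue (T - A) < ennreal (1 / real (Suc n))" for n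
    using sets_lebesgue_outer_open[OF A(1), of "1 / real (Suc n)"] by (metis fmeasurableD of_nat_0_less_iff zero_less_Suc zero_less_divide_1_iff)
  then obtain T where T: "\<And>n. open (T n)" "\<And>n. A \<subseteq> T n" "\<And>n. T n - A \<in> sets lebesgue"
    "\<And>n. emeasure lebesgue (T n - A) < ennreal (1 / real (Suc n))" by metis
  define G where "G n = \<Omega> \<inter> (\<Inter>k\<le>n. T k)" for n
  have Gop: "open (G n)" for n unfolding G_def using \<Omega> T(1) by (intro open_Int open_INT) auto
  define H where "H = \<Omega> \<inter> (\<Inter>n. T n)"
  have Gmeas: "G n \<in> sets (lebesgue_on \<Omega>)" for n
    using Gop[of n] \<Omega> by (auto simp: sets_restrict_space_iff G_def)
  have lim: "(\<lambda>n. indicator (G n) x * g x) \<longlonglongrightarrow> indicator H x * g x" for x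
  proof -
    have "eventually (\<lambda>n. indicator (G n) x = (indicator H x :: real)) sequentially"
    proof (cases "x \<in> H")
      case True
      then show ?thesis by (intro always_eventually) (auto simp: G_def H_def indicator_def)
    next
      case False
      show ?thesis
      proof (cases "x \<in> \<Omega>")
        case True
        then obtain N where "x \<notin> T N" using False by (auto simp: H_def)
        then show ?thesis using False by (intro eventually_sequentiallyI[of N]) (auto simp: G_def indicator_def)
      qed (use False in \<open>auto simp: G_def indicator_def intro!: always_eventually\<close>)
    qed
    then show ?thesis by (intro tendsto_eventually) (auto elim: eventually_mono)
  qed
  have [measurable]: "g \<in> borel_measurable (lebesgue_on \<Omega>)" using g by simp
  have "(\<lambda>n. LINT x|lebesgue_on \<Omega>. indicator (G n) x * g x) \<longlonglongrightarrow> (LINT x|lebesgue_on \<Omega>. indicator H x * g x)"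
  proof (rule integral_dominated_convergence[where w = "\<lambda>x. \<bar>g x\<bar>"])
    have "H \<in> sets (lebesgue_on \<Omega>)"
      using \<Omega> T(1) by (auto simp: sets_restrict_space_iff H_def intro!: sets.Int sets.countable_INT)
    then show "(\<lambda>x. indicator H x * g x) \<in> borel_measurable (lebesgue_on \<Omega>)" by measurable
    show "(\<lambda>x. indicator (G n) x * g x) \<in> borel_measurable (lebesgue_on \<Omega>)" for n
      using Gmeas[of n] by measurable
  qed (use g lim in \<open>auto simp: indicator_def\<close>)
  moreover have "(LINT x|lebesgue_on \<Omega>. indicator (G n) x * g x) = 0" for n
    using zero[OF Gop[of n]] by (auto simp: G_def)
  ultimately have H0: "(LINT x|lebesgue_on \<Omega>. indicator H x * g x) = 0"
    by (simp add: LIMSEQ_const_iff)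
  have HA: "H - A \<in> null_sets lebesgue"
  proof -
    have Hm: "H - A \<in> sets lebesgue"
      using \<Omega> T(1) A by (auto simp: H_def intro!: sets.Diff sets.Int sets.countable_INT)
    have He: "emeasure lebesgue (H - A) \<le> ennreal e" if e: "0 < e" for e
    proof -
      obtain n where n: "1 / real (Suc n) < e" using nat_approx_posE[OF e] by blast
      have "emeasure lebesgue (H - A) \<le> emeasure lebesgue (T n - A)"
        by (rule emeasure_mono) (auto simp: H_def T(3))
      also have "\<dots> \<le> ennreal (1 / real (Suc n))" using T(4) by (rule less_imp_le)
      also have "\<dots> \<le> ennreal e" using n by (intro ennreal_leI) simp
      finally show ?thesis .
    qed
    have "emeasure lebesgue (H - A) \<le> 0"
      by (rule ennreal_le_epsilon) (simp add: He)
    then have "emeasure lebesgue (H - A) = 0" by (simp only: le_zero_eq)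
    then show ?thesis using Hm unfolding null_sets_def by blast
  qed
  have "AE x in lebesgue_on \<Omega>. indicator A x * g x = indicator H x * g x"
  proof (subst AE_restrict_space_iff)
    show "AE x in lebesgue. x \<in> \<Omega> \<longrightarrow> indicator A x * g x = indicator H x * g x"
      using AE_not_in[OF HA]
    proof eventually_elim
      case (elim x)
      have "A \<subseteq> H" using A(2) T(2) unfolding H_def by blast
      with elim have "x \<in> A \<longleftrightarrow> x \<in> H" by blast
      then show ?case by (simp add: indicator_def)
    qed
  qed (use \<Omega> in auto)
  then have "(LINT x|lebesgue_on \<Omega>. indicator A x * g x) = (LINT x|lebesgue_on \<Omega>. indicator H x * g x)"
  proof (rule integral_cong_AE[rotated 2])
    have "A \<in> sets (lebesgue_on \<Omega>)" "H \<in> sets (lebesgue_on \<Omega>)"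
      using \<Omega> T(1) A by (auto simp: sets_restrict_space_iff H_def intro!: sets.Int sets.countable_INT)
    then show "(\<lambda>x. indicator A x * g x) \<in> borel_measurable (lebesgue_on \<Omega>)" "(\<lambda>x. indicator H x * g x) \<in> borel_measurable (lebesgue_on \<Omega>)"
      by measurable
  qed
  then show "(LINT x:A|lebesgue_on \<Omega>. g x) = (LINT x:A|lebesgue_on \<Omega>. 0)"
    using H0 by (simp add: set_lebesgue_integral_def)
qed simp

context schroedinger
begin

lemma potential_weight_integrable:
  assumes V: "V \<in> R" and u: "u \<in> W"
  shows "integrable L (\<lambda>x. V x * (\<bar>u x\<bar> powr (p - 2) * u x))"
proof -
  note [measurable] = R_measurable[OF V] W_measurable_on[OF u]
  show ?thesis
  proof (rule Bochner_Integration.integrable_bound)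
    show "integrable L (\<lambda>x. \<bar>V x\<bar> + \<bar>V x * \<bar>u x\<bar> powr p\<bar>)"
      using R_integrable[OF V] potential_integrable[OF V u] by (intro Bochner_Integration.integrable_add integrable_abs)
    show "AE x in L. norm (V x * (\<bar>u x\<bar> powr (p - 2) * u x)) \<le> norm (\<bar>V x\<bar> + \<bar>V x * \<bar>u x\<bar> powr p\<bar>)"
    proof (rule AE_I2)
      fix x
      have "\<bar>u x\<bar> powr (p - 1) \<le> 1 + \<bar>u x\<bar> powr p"
      proof (cases "\<bar>u x\<bar> \<le> 1")
        case True
        then have "\<bar>u x\<bar> powr (p - 1) \<le> 1" using p_gt_1 by (intro powr_le1) auto
        then show ?thesis by (simp add: add_increasing2)
      next
        case False
        then have "\<bar>u x\<bar> powr (p - 1) \<le> \<bar>u x\<bar> powr p" using p_gt_1 by (intro powr_mono) auto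
        then show ?thesis by simp
      qed
      then have "\<bar>V x\<bar> * \<bar>u x\<bar> powr (p - 1) \<le> \<bar>V x\<bar> * (1 + \<bar>u x\<bar> powr p)" by (intro mult_left_mono) auto
      then show "norm (V x * (\<bar>u x\<bar> powr (p - 2) * u x)) \<le> norm (\<bar>V x\<bar> + \<bar>V x * \<bar>u x\<bar> powr p\<bar>)"
        unfolding real_norm_def abs_mult[of "V x"] abs_abs_powr_mult by (simp add: algebra_simps)
    qed
  qed measurable
qed

text \<open>If a positive \<open>u\<close> is a minimiser for two potentials with the same first eigenvalue, then the
  difference of the two Euler-Lagrange equations says that the integral of \<open>(V - V') u\<^bsup>p - 1\<^esup>\<close> against every
  test function is zero. The test functions include Lipschitz approximations of the indicators of open sets.\<close>

lemma optimal_potentials_equal: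
  assumes V: "V \<in> R" "V' \<in> R" and u: "u \<in> W" "J V u = lam V * mass u" "J V' u = lam V' * mass u"
    and eq: "lam V = lam V'" and pos: "AE x in lebesgue. x \<in> \<Omega> \<longrightarrow> 0 < u x"
  shows "AE x in L. V x = V' x"
proof -
  let ?g = "\<lambda>x. (V x - V' x) * (\<bar>u x\<bar> powr (p - 2) * u x)"
  have g: "integrable L ?g"
    using potential_weight_integrable[OF V(1) u(1)] potential_weight_integrable[OF V(2) u(1)]
    by (simp add: left_diff_distrib)
  have [measurable]: "?g \<in> borel_measurable L" using g by simp
  have test: "(LINT x|L. ?g x * v x) = 0" if v: "v \<in> W" and bd: "\<And>x. \<bar>v x\<bar> \<le> 1" for v
  proof -
    note [measurable] = W_measurable_on[OF v] R_measurable[OF V(1)] R_measurable[OF V(2)] W_measurable_on[OF u(1)]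
    have i: "integrable L (\<lambda>x. U x * \<bar>u x\<bar> powr (p - 2) * u x * v x)" if U: "U \<in> R" for U
    proof (rule Bochner_Integration.integrable_bound[OF potential_weight_integrable[OF U u(1)]])
      note [measurable] = R_measurable[OF U]
      show "(\<lambda>x. U x * \<bar>u x\<bar> powr (p - 2) * u x * v x) \<in> borel_measurable L" by measurable
      have "\<bar>a * v x\<bar> \<le> \<bar>a\<bar>" for a x using bd[of x] by (simp add: abs_mult mult_left_le)
      then show "AE x in L. norm (U x * \<bar>u x\<bar> powr (p - 2) * u x * v x) \<le> norm (U x * (\<bar>u x\<bar> powr (p - 2) * u x))"
        by (intro AE_I2) (simp add: mult.assoc[symmetric])
    qed
    have "(LINT x|L. V x * \<bar>u x\<bar> powr (p - 2) * u x * v x) = (LINT x|L. V' x * \<bar>u x\<bar> powr (p - 2) * u x * v x)"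
      using Euler_Lagrange[OF V(1) u(1,2) v] Euler_Lagrange[OF V(2) u(1,3) v] eq by simp
    then have "(LINT x|L. V x * \<bar>u x\<bar> powr (p - 2) * u x * v x - V' x * \<bar>u x\<bar> powr (p - 2) * u x * v x) = 0"
      using i V by simp
    moreover have "V x * \<bar>u x\<bar> powr (p - 2) * u x * v x - V' x * \<bar>u x\<bar> powr (p - 2) * u x * v x = ?g x * v x" for x
      by (simp add: algebra_simps)
    ultimately show ?thesis by simp
  qed
  have "AE x in L. ?g x = 0"
  proof (rule AE_zero_of_open_integrals[OF open_domain g])
    fix G assume G: "open G" "G \<subseteq> \<Omega>"
    define v where "v k x = min 1 (real k * infdist x (- G))" for k x
    have v: "v k \<in> W" for k unfolding v_def by (rule truncated_infdist_W[OF G]) simp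
    have bd: "\<bar>v k x\<bar> \<le> 1" for k x using infdist_nonneg[of x "- G"] by (simp add: v_def abs_le_iff)
    have neG: "- G \<noteq> {}" using complement_nonempty G by auto
    have vlim: "(\<lambda>k. v k x) \<longlonglongrightarrow> indicator G x" for x
    proof (cases "x \<in> G")
      case True
      have "infdist x (- G) \<noteq> 0"
        using in_closed_iff_infdist_zero[of "- G" x] G neG True by (simp add: closed_Compl)
      then have d: "0 < infdist x (- G)" using infdist_nonneg[of x "- G"] by simp
      obtain N where N: "1 / infdist x (- G) \<le> real N" using real_arch_simple by blast
      have "eventually (\<lambda>k. v k x = 1) sequentially"
      proof (rule eventually_sequentiallyI[of N])
        fix k assume "N \<le> k"
        then have "1 / infdist x (- G) \<le> real k" using N by simp
        then show "v k x = 1" using d by (simp add: v_def field_simps)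
      qed
      then show ?thesis using True by (simp add: tendsto_eventually)
    next
      case False
      then show ?thesis by (simp add: v_def)
    qed
    have "(\<lambda>k. LINT x|L. ?g x * v k x) \<longlonglongrightarrow> (LINT x|L. ?g x * indicator G x)"
    proof (rule integral_dominated_convergence[where w = "\<lambda>x. \<bar>?g x\<bar>"])
      show "(\<lambda>x. ?g x * indicator G x) \<in> borel_measurable L"
      proof -
        have "G \<in> sets L" using G by (auto simp: sets_restrict_space_iff)
        then show ?thesis by measurable
      qed
      show "(\<lambda>x. ?g x * v k x) \<in> borel_measurable L" for k
        by (rule borel_measurable_times[OF borel_measurable_integrable[OF g] W_measurable_on[OF v]])
      show "AE x in L. (\<lambda>k. ?g x * v k x) \<longlonglongrightarrow> ?g x * indicator G x"
        by (intro AE_I2 tendsto_mult tendsto_const vlim)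
      have "\<bar>a * v k x\<bar> \<le> \<bar>a\<bar>" for a x k using bd[of k x] by (simp add: abs_mult mult_left_le)
      then show "AE x in L. norm (?g x * v k x) \<le> \<bar>?g x\<bar>" for k
        unfolding real_norm_def by (intro AE_I2)
      show "integrable L (\<lambda>x. \<bar>?g x\<bar>)" using g by (rule integrable_abs)
    qed
    then show "(LINT x|L. indicator G x * ?g x) = 0"
      using test[OF v bd] by (simp add: LIMSEQ_const_iff mult.commute)
  qed
  moreover have "AE x in L. 0 < u x"
    using pos by (subst AE_restrict_space_iff) auto
  ultimately show ?thesis
    by eventually_elim auto
qed

text \<open>The limit of the functions in a minimising sequence of pairs. The potentials in the sequence are not
  passed to the limit: each is compared with a rearrangement \<open>U\<close> that is optimal for the limit function.\<close>

lemma minimizing_limit: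
  assumes inf: "\<And>V u. V \<in> R \<Longrightarrow> u \<in> W \<Longrightarrow> mass u = 1 \<Longrightarrow> \<mu> \<le> J V u"
    and approx: "\<And>e. 0 < e \<Longrightarrow> \<exists>V\<in>R. \<exists>u\<in>W. mass u = 1 \<and> J V u < \<mu> + e"
  obtains u where "u \<in> W" "mass u = 1" "\<And>x. 0 \<le> u x"
    "\<And>U. U \<in> R \<Longrightarrow> (\<And>V. V \<in> R \<Longrightarrow> (LINT x|L. U x * \<bar>u x\<bar> powr p) \<le> (LINT x|L. V x * \<bar>u x\<bar> powr p)) \<Longrightarrow> J U u = \<mu>"
proof -
  have "\<exists>V u. V \<in> R \<and> u \<in> W \<and> mass u = 1 \<and> J V u < \<mu> + 1 / real (Suc k)" for k
    using approx[of "1 / real (Suc k)"] by fastforce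
  then obtain V u where V: "\<And>k. V k \<in> R" and u: "\<And>k. u k \<in> W" and m1: "\<And>k. mass (u k) = 1"
    and J1: "\<And>k. J (V k) (u k) < \<mu> + 1 / real (Suc k)" by metis
  obtain A where A: "0 \<le> A" "\<And>V u. V \<in> R \<Longrightarrow> u \<in> W \<Longrightarrow> 1 / 4 * E u - A * mass u \<le> J V u"
    using coercive by blast
  define K where "K = max 1 (4 * (\<mu> + 1 + A))"
  have EK: "E (u k) \<le> K" for k
  proof -
    have "1 / real (Suc k) \<le> 1" by simp
    then have "1 / 4 * E (u k) - A \<le> \<mu> + 1" 
      using A(2)[OF V[of k] u[of k]] J1[of k] unfolding m1 mult_1_right by linarith
    then show ?thesis by (simp add: K_def)
  qed
  have mK: "mass (u k) \<le> K" for k unfolding m1 by (simp add: K_def)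
  obtain r v where r: "strict_mono r" "v \<in> W" "AE x in lebesgue. (\<lambda>k. u (r k) x) \<longlonglongrightarrow> v x"
    by (rule Rellich_subsequence[OF s_pos p_gt_1 domain_measurable bounded_domain u EK mK], rule that)
  obtain C where C: "0 \<le> C" "\<And>u. u \<in> W \<Longrightarrow> integrable lebesgue (\<lambda>x. \<bar>u x\<bar> powr (p * b))"
    "\<And>u. u \<in> W \<Longrightarrow> (LINT x|lebesgue. \<bar>u x\<bar> powr (p * b)) powr (1 / b) \<le> C * E u"
    using Sobolev_inequality[OF s_pos p_gt_1 q_gt_1 b_def q_gt domain_measurable bounded_domain] by blast
  define f where "f k x = \<bar>u (r k) x\<bar> powr p - \<bar>v x\<bar> powr p" for k x
  have [measurable]: "u k \<in> borel_measurable lebesgue" "v \<in> borel_measurable lebesgue" for k using W_measurable u r(2) by auto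
  have fm: "f k \<in> borel_measurable lebesgue" for k unfolding f_def by measurable
  have fz: "f k x = 0" if "x \<notin> \<Omega>" for k x using W_zero_outside[OF u that] W_zero_outside[OF r(2) that] by (simp add: f_def)
  have fpt: "\<bar>f k x\<bar> powr b \<le> 2 powr b * (\<bar>u (r k) x\<bar> powr (p * b) + \<bar>v x\<bar> powr (p * b))" for k x
  proof -
    have "\<bar>f k x\<bar> \<le> 1 * (\<bar>\<bar>u (r k) x\<bar> powr p\<bar> + \<bar>\<bar>v x\<bar> powr p\<bar>)"
      unfolding f_def mult_1 by (rule abs_triangle_ineq4)
    from powr_abs_le_sum[OF _ _ this, of b] show ?thesis using b_gt_1 by (simp add: powr_powr)
  qed
  have iR: "integrable lebesgue (\<lambda>x. 2 powr b * (\<bar>u (r k) x\<bar> powr (p * b) + \<bar>v x\<bar> powr (p * b)))" for k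
    by (intro integrable_mult_right Bochner_Integration.integrable_add C(2) u r(2))
  have fi: "integrable lebesgue (\<lambda>x. \<bar>f k x\<bar> powr b)" for k
    by (rule Bochner_Integration.integrable_bound[OF iR[of k]])
       (use fm fpt in \<open>auto intro: order_trans[OF _ abs_ge_self]\<close>)
  define S where "S = (C * K) powr b"
  have Su: "(LINT x|lebesgue. \<bar>u k x\<bar> powr (p * b)) \<le> S" for k
  proof -
    have "(LINT x|lebesgue. \<bar>u k x\<bar> powr (p * b)) powr (1 / b) \<le> C * K"
      using C(3)[OF u[of k]] mult_left_mono[OF EK[of k] C(1)] by linarith
    then have "((LINT x|lebesgue. \<bar>u k x\<bar> powr (p * b)) powr (1 / b)) powr b \<le> S"
      unfolding S_def using b_gt_1 by (intro powr_mono2) auto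
    then show ?thesis using b_gt_1 by (simp add: powr_powr integral_nonneg_AE)
  qed
  have fS: "(LINT x|lebesgue. \<bar>f k x\<bar> powr b) \<le> 2 powr b * (S + (LINT x|lebesgue. \<bar>v x\<bar> powr (p * b)))" for k
  proof -
    have "(LINT x|lebesgue. \<bar>f k x\<bar> powr b) \<le> (LINT x|lebesgue. 2 powr b * (\<bar>u (r k) x\<bar> powr (p * b) + \<bar>v x\<bar> powr (p * b)))"
      by (rule integral_mono[OF fi iR fpt])
    also have "\<dots> = 2 powr b * ((LINT x|lebesgue. \<bar>u (r k) x\<bar> powr (p * b)) + (LINT x|lebesgue. \<bar>v x\<bar> powr (p * b)))"
      using C(2)[OF u[of "r k"]] C(2)[OF r(2)] by simp
    also have "\<dots> \<le> 2 powr b * (S + (LINT x|lebesgue. \<bar>v x\<bar> powr (p * b)))"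
      using Su by (intro mult_left_mono add_right_mono) auto
    finally show ?thesis .
  qed
  have flim: "AE x in lebesgue. (\<lambda>k. f k x) \<longlonglongrightarrow> 0"
    using r(3)
  proof eventually_elim
    case (elim x)
    then have "(\<lambda>k. f k x) \<longlonglongrightarrow> \<bar>v x\<bar> powr p - \<bar>v x\<bar> powr p"
      unfolding f_def using p_pos by (intro tendsto_diff tendsto_const tendsto_powr' tendsto_rabs) auto
    then show ?case by simp
  qed
  note Vit = Vitali_tendsto_zero[OF fm domain_measurable emeasure_domain_finite fz b_gt_1 fi fS flim]
  have fint: "integrable lebesgue (f k)" for k by (rule Vit(1))
  have fL1: "(\<lambda>k. LINT x|lebesgue. \<bar>f k x\<bar>) \<longlonglongrightarrow> 0" by (rule Vit(2))
  have mv: "mass v = 1"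
  proof -
    have "\<bar>1 - mass v\<bar> \<le> (LINT x|lebesgue. \<bar>f k x\<bar>)" for k
    proof -
      have "(LINT x|lebesgue. f k x) = 1 - mass v"
        unfolding f_def using W_integrable[OF u[of "r k"]] W_integrable[OF r(2)] m1 by simp
      then show ?thesis using integral_abs_bound[of lebesgue "f k"] by simp
    qed
    then have "\<bar>1 - mass v\<bar> \<le> 0" by (intro LIMSEQ_le_const[OF fL1]) auto
    then show ?thesis by simp
  qed
  have fL: "integrable L (\<lambda>x. \<bar>f k x\<bar>)" "(LINT x|L. \<bar>f k x\<bar>) = (LINT x|lebesgue. \<bar>f k x\<bar>)" for k
    using integral_lebesgue_eq_lebesgue_on[OF domain_measurable, of "\<lambda>x. \<bar>f k x\<bar>"] fz fint[of k]
      integrable_lebesgue_iff_lebesgue_on[OF domain_measurable, of "\<lambda>x. \<bar>f k x\<bar>"] by auto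
  have key: "1 / 2 * E v + (LINT x|L. U x * \<bar>v x\<bar> powr p) \<le> \<mu> + e * (K + E v)"
    if U: "U \<in> R" "\<And>V. V \<in> R \<Longrightarrow> (LINT x|L. U x * \<bar>v x\<bar> powr p) \<le> (LINT x|L. V x * \<bar>v x\<bar> powr p)" and e: "0 < e" for U e
  proof -
    obtain m where m: "0 \<le> m" "\<And>V u. V \<in> R \<Longrightarrow> u \<in> W \<Longrightarrow> integrable L (\<lambda>x. above m (V x) * \<bar>u x\<bar> powr p)"
      "\<And>V u. V \<in> R \<Longrightarrow> u \<in> W \<Longrightarrow> (LINT x|L. above m (V x) * \<bar>u x\<bar> powr p) \<le> e * E u"
      by (rule form_bound[OF e]) blast
    define c where "c k = 2 * (\<mu> + 1 / real (Suc (r k)) - (LINT x|L. U x * \<bar>v x\<bar> powr p) + e * (K + E v) + m * (LINT x|lebesgue. \<bar>f k x\<bar>))" for k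
    have bound: "E (u (r k)) \<le> c k" for k
    proof -
      let ?V = "V (r k)" and ?u = "u (r k)"
      have "(LINT x|L. ?V x * \<bar>v x\<bar> powr p) - (LINT x|L. ?V x * \<bar>?u x\<bar> powr p) = (LINT x|L. ?V x * \<bar>v x\<bar> powr p - ?V x * \<bar>?u x\<bar> powr p)"
        using potential_integrable[OF V r(2)] potential_integrable[OF V u] by simp
      also have "\<dots> \<le> (LINT x|L. (above m (?V x) * \<bar>?u x\<bar> powr p + above m (?V x) * \<bar>v x\<bar> powr p) + m * \<bar>f k x\<bar>)"
      proof (rule integral_mono)
        fix x
        have "?V x * \<bar>v x\<bar> powr p - ?V x * \<bar>?u x\<bar> powr p = - ?V x * f k x"
          by (simp add: f_def algebra_simps)
        also have "\<dots> \<le> \<bar>?V x\<bar> * \<bar>f k x\<bar>" by (metis abs_ge_self abs_minus_cancel abs_mult mult_minus_left)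
        also have "\<dots> \<le> (above m (?V x) + m) * \<bar>f k x\<bar>"
          using above_le(3)[of "?V x" m] m(1) by (intro mult_right_mono) auto
        also have "\<dots> \<le> above m (?V x) * (\<bar>?u x\<bar> powr p + \<bar>v x\<bar> powr p) + m * \<bar>f k x\<bar>"
        proof -
          have "\<bar>f k x\<bar> \<le> \<bar>?u x\<bar> powr p + \<bar>v x\<bar> powr p" by (simp add: f_def abs_le_iff add_increasing)
          then have "above m (?V x) * \<bar>f k x\<bar> \<le> above m (?V x) * (\<bar>?u x\<bar> powr p + \<bar>v x\<bar> powr p)"
            by (intro mult_left_mono above_le)
          then show ?thesis by (simp add: distrib_right)
        qed
        finally show "?V x * \<bar>v x\<bar> powr p - ?V x * \<bar>?u x\<bar> powr p \<le> (above m (?V x) * \<bar>?u x\<bar> powr p + above m (?V x) * \<bar>v x\<bar> powr p) + m * \<bar>f k x\<bar>"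
          by (simp add: distrib_left)
      qed (use potential_integrable[OF V r(2)] potential_integrable[OF V u] m(2)[OF V r(2)] m(2)[OF V u] fL(1) in auto)
      also have "\<dots> = (LINT x|L. above m (?V x) * \<bar>?u x\<bar> powr p) + (LINT x|L. above m (?V x) * \<bar>v x\<bar> powr p) + m * (LINT x|lebesgue. \<bar>f k x\<bar>)"
        using m(2)[OF V[of "r k"] r(2)] m(2)[OF V[of "r k"] u[of "r k"]] fL by simp
      also have "\<dots> \<le> e * K + e * E v + m * (LINT x|lebesgue. \<bar>f k x\<bar>)"
        using m(3)[OF V[of "r k"] u[of "r k"]] m(3)[OF V[of "r k"] r(2)] mult_left_mono[OF EK[of "r k"], of e] e by linarith
      finally have "(LINT x|L. ?V x * \<bar>v x\<bar> powr p) - (LINT x|L. ?V x * \<bar>?u x\<bar> powr p) \<le> e * K + e * E v + m * (LINT x|lebesgue. \<bar>f k x\<bar>)" .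
      moreover have "1 / 2 * E ?u + (LINT x|L. ?V x * \<bar>?u x\<bar> powr p) < \<mu> + 1 / real (Suc (r k))"
        using J1[of "r k"] by (simp add: J_def)
      ultimately have "1 / 2 * E ?u \<le> \<mu> + 1 / real (Suc (r k)) - (LINT x|L. U x * \<bar>v x\<bar> powr p)
          + (e * K + e * E v) + m * (LINT x|lebesgue. \<bar>f k x\<bar>)"
        using U(2)[OF V[of "r k"]] by linarith
      moreover have "t \<le> 2 * y" if "1 / 2 * t \<le> y" for t y :: real using that by simp
      ultimately show ?thesis unfolding c_def distrib_left[of e] by blast
    qed
    have rk: "(\<lambda>k. 1 / real (Suc (r k))) \<longlonglongrightarrow> 0"
    proof -
      have "(\<lambda>n. 1 / real (Suc n)) \<longlonglongrightarrow> 0"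
        using LIMSEQ_inverse_real_of_nat by (simp add: inverse_eq_divide)
      from LIMSEQ_subseq_LIMSEQ[OF this r(1)] show ?thesis by (simp add: o_def)
    qed
    have c: "c \<longlonglongrightarrow> 2 * (\<mu> + 0 - (LINT x|L. U x * \<bar>v x\<bar> powr p) + e * (K + E v) + m * 0)"
      unfolding c_def by (intro tendsto_intros rk fL1)
    have "E v \<le> 2 * (\<mu> + 0 - (LINT x|L. U x * \<bar>v x\<bar> powr p) + e * (K + E v) + m * 0)"
      unfolding gagliardo_energy_def
    proof (rule Fatou_integrable(2)[where f = "\<lambda>k. gagliardo_integrand s p (u (r k))" and c = c, OF _ gagliardo_integrand_nonneg])
      show "AE z in lebesgue \<Otimes>\<^sub>M lebesgue. (\<lambda>k. gagliardo_integrand s p (u (r k)) z) \<longlonglongrightarrow> gagliardo_integrand s p v z"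
        by (rule gagliardo_integrand_tendsto[OF p_pos r(3)])
      show "c \<longlonglongrightarrow> 2 * (\<mu> + 0 - (LINT x|L. U x * \<bar>v x\<bar> powr p) + e * (K + (LINT z|(lebesgue \<Otimes>\<^sub>M lebesgue). gagliardo_integrand s p v z)) + m * 0)"
        using c by (simp only: gagliardo_energy_def)
    qed (use bound W_integrable_gagliardo[OF u] W_integrable_gagliardo[OF r(2)] in \<open>auto simp: gagliardo_energy_def\<close>)
    then show ?thesis by simp
  qed
  \<comment> \<open>Passing to the absolute value does not increase the energy.\<close>
  define w where "w x = \<bar>v x\<bar>" for x
  have w: "w \<in> W" unfolding w_def by (rule Wsp_tilde_abs[OF p_gt_1 domain_measurable r(2)])
  have Ew: "E w \<le> E v"
    by (rule gagliardo_energy_mono[OF p_gt_1 domain_measurable r(2)]) (simp add: w_def abs_triangle_ineq3)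
  have aw: "\<bar>w x\<bar> = \<bar>v x\<bar>" for x by (simp add: w_def)
  have mw: "mass w = 1" unfolding aw by (rule mv)
  show ?thesis
  proof (rule that[OF w mw])
    show "0 \<le> w x" for x by (simp add: w_def)
    fix U assume U: "U \<in> R" "\<And>V. V \<in> R \<Longrightarrow> (LINT x|L. U x * \<bar>w x\<bar> powr p) \<le> (LINT x|L. V x * \<bar>w x\<bar> powr p)"
    have "J U w \<le> \<mu>"
    proof (rule field_le_epsilon)
      fix e :: real assume e: "0 < e"
      have KE: "0 < K + E v" using gagliardo_energy_nonneg[of s p v] by (simp add: K_def add_pos_nonneg)
      have "1 / 2 * E v + (LINT x|L. U x * \<bar>v x\<bar> powr p) \<le> \<mu> + e / (K + E v) * (K + E v)"
        by (rule key) (use U e KE in \<open>auto simp: aw\<close>)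
      then show "J U w \<le> \<mu> + e" using KE Ew by (simp add: J_def aw)
    qed
    then show "J U w = \<mu>" using inf[OF U(1) w mw] by simp
  qed
qed

lemma hyperplane_null:
  assumes "i \<in> (Basis :: 'a set)"
  shows "{x \<in> space L. x \<bullet> i = c} \<in> null_sets L"
proof -
  have "{x. x \<bullet> i = c} \<in> null_sets lebesgue"
    using negligible_standard_hyperplane[OF assms, of c] by (simp add: negligible_iff_null_sets)
  then have "{x \<in> \<Omega>. x \<bullet> i = c} \<in> null_sets lebesgue"
    by (rule null_sets_completion_subset[rotated]) auto
  then show ?thesis by (auto simp: null_sets_restrict_space)
qed

text \<open>For any admissible tie-breaking function there is a rearrangement of \<open>V\<^sub>0\<close> that decreases along
  \<open>|u|\<^sup>p\<close> and minimises \<open>\<integral> V |u|\<^sup>p\<close>.\<close>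

lemma optimal_rearrangement:
  assumes u: "u \<in> W" and [measurable]: "\<tau> \<in> borel_measurable L" and null: "\<And>c. {x \<in> space L. \<tau> x = c} \<in> null_sets L"
  obtains V G where "V \<in> R" "AE x in L. x \<in> G"
    "\<And>x y. x \<in> G \<Longrightarrow> y \<in> G \<Longrightarrow> lex_less (\<lambda>x. \<bar>u x\<bar> powr p) \<tau> x y \<Longrightarrow> V y \<le> V x"
    "\<And>V'. V' \<in> R \<Longrightarrow> (LINT x|L. V x * \<bar>u x\<bar> powr p) \<le> (LINT x|L. V' x * \<bar>u x\<bar> powr p)"
proof -
  note [measurable] = W_measurable_on[OF u] V0_measurable
  have f: "(\<lambda>x. \<bar>u x\<bar> powr p) \<in> borel_measurable L" by measurable
  have null': "emeasure L {x \<in> space L. \<tau> x = c} = 0" for c using null[of c] by (simp add: null_sets_def)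
  have pos: "0 < measure L (space L)"
    using measure_domain_pos by (simp add: measure_restrict_space)
  obtain V G where V: "V \<in> borel_measurable L" "\<And>a. measure L {x \<in> space L. a \<le> V x} = measure L {x \<in> space L. a \<le> V0 x}"
    "AE x in L. x \<in> G" "\<And>x y. x \<in> G \<Longrightarrow> y \<in> G \<Longrightarrow> lex_less (\<lambda>x. \<bar>u x\<bar> powr p) \<tau> x y \<Longrightarrow> V y \<le> V x"
    by (rule fL.exists_lex_antitone_rearrangement[OF f assms(2) null' V0_measurable pos], rule that)
  have em: "emeasure lebesgue {x \<in> \<Omega>. a \<le> g x} = ennreal (measure L {x \<in> \<Omega>. a \<le> g x})" for g :: "'a \<Rightarrow> real" and a
    using emeasure_restrict_space[of \<Omega> lebesgue "{x \<in> \<Omega>. a \<le> g x}"] by (simp add: fL.emeasure_eq_measure)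
  have VR: "V \<in> R"
    using V(1,2) unfolding rearrangements_def by (simp only: mem_Collect_eq em space_L) simp
  show ?thesis
  proof (rule that[OF VR V(3,4)])
    fix V' assume V': "V' \<in> R"
    have "measure L {x \<in> space L. a \<le> V' x} = measure L {x \<in> space L. a \<le> V0 x}" for a
    proof -
      have "ennreal (measure L {x \<in> \<Omega>. a \<le> V' x}) = ennreal (measure L {x \<in> \<Omega>. a \<le> V0 x})"
        using V' unfolding rearrangements_def em[symmetric] by simp
      then show ?thesis by simp
    qed
    then show "(LINT x|L. V x * \<bar>u x\<bar> powr p) \<le> (LINT x|L. V' x * \<bar>u x\<bar> powr p)"
      using V by (intro fL.Hardy_Littlewood_antitone[OF V(1) R_measurable[OF V'] f _ _ V(3)])
        (auto simp: lex_less_def intro!: potential_integrable VR V' u)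
  qed
qed

lemma optimal_potential_exists:
  "\<exists>V1\<in>R. (\<forall>V\<in>R. lam V1 \<le> lam V) \<and>
    (\<exists>u. is_positive_first_eigenfunction s p \<Omega> V1 u \<and>
      (\<forall>w. is_positive_first_eigenfunction s p \<Omega> V1 w \<longrightarrow> (AE x in lebesgue. w x = u x)) \<and>
      (\<exists>\<phi> :: real \<Rightarrow> ereal. antimono \<phi> \<and> (AE x in L. ereal (V1 x) = \<phi> (\<bar>u x\<bar> powr p))))"
proof -
  define X where "X = {J V u | V u. V \<in> R \<and> u \<in> W \<and> mass u = 1}"
  define \<mu> where "\<mu> = Inf X"
  have V0R: "V0 \<in> R" using V0_measurable by (simp add: rearrangements_def)
  have Xne: "X \<noteq> {}" using admissible_ne[of V0] V0R by (auto simp: X_def)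
  obtain A where A: "0 \<le> A" "\<And>V u. V \<in> R \<Longrightarrow> u \<in> W \<Longrightarrow> 1 / 4 * E u - A * mass u \<le> J V u"
    using coercive by blast
  have Xbdd: "bdd_below X"
  proof (rule bdd_belowI)
    fix y assume "y \<in> X"
    then obtain V u where y: "y = J V u" "V \<in> R" "u \<in> W" "mass u = 1" by (auto simp: X_def)
    then show "- A \<le> y" using A(2)[OF y(2,3)] gagliardo_energy_nonneg[of s p u] by simp
  qed
  have \<mu>le: "\<mu> \<le> J V u" if "V \<in> R" "u \<in> W" "mass u = 1" for V u
    unfolding \<mu>_def using Xbdd that by (intro cInf_lower) (auto simp: X_def)
  have approx: "\<exists>V\<in>R. \<exists>u\<in>W. mass u = 1 \<and> J V u < \<mu> + e" if "0 < e" for e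
    using cInf_lessD[OF Xne, of "\<mu> + e"] that unfolding \<mu>_def by (auto simp: X_def)
  obtain u where u: "u \<in> W" "mass u = 1" "\<And>x. 0 \<le> u x"
    and opt: "\<And>U. U \<in> R \<Longrightarrow> (\<And>V. V \<in> R \<Longrightarrow> (LINT x|L. U x * \<bar>u x\<bar> powr p) \<le> (LINT x|L. V x * \<bar>u x\<bar> powr p)) \<Longrightarrow> J U u = \<mu>"
  proof (rule minimizing_limit[of \<mu>])
    show "\<mu> \<le> J V u" if "V \<in> R" "u \<in> W" "mass u = 1" for V u using that by (rule \<mu>le)
    show "\<exists>V\<in>R. \<exists>u\<in>W. mass u = 1 \<and> J V u < \<mu> + e" if "0 < e" for e using that by (rule approx)
    fix u assume u: "u \<in> W" "mass u = 1" "\<And>x. 0 \<le> u x"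
      "\<And>U. U \<in> R \<Longrightarrow> (\<And>V. V \<in> R \<Longrightarrow> (LINT x|L. U x * \<bar>u x\<bar> powr p) \<le> (LINT x|L. V x * \<bar>u x\<bar> powr p)) \<Longrightarrow> J U u = \<mu>"
    show thesis by (rule that[OF u])
  qed
  have \<mu>_lam: "\<mu> \<le> lam V" if "V \<in> R" for V
    unfolding lam_eq using admissible_ne \<mu>le[OF that] by (intro cInf_greatest) auto
  have lam_opt: "lam U = \<mu>" if "U \<in> R" "J U u = \<mu>" for U
    using lam_le[OF that(1) u(1)] u(2) that \<mu>_lam[OF that(1)] by simp
  \<comment> \<open>Hyperplanes are null sets, so a coordinate and its negative are admissible tie-breaking functions.\<close>
  obtain i where i: "i \<in> (Basis :: 'a set)" using nonempty_Basis by blast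
  have \<tau>: "(\<lambda>x. x \<bullet> i) \<in> borel_measurable L" "(\<lambda>x. - (x \<bullet> i)) \<in> borel_measurable L"
    using measurable_ident_lebesgue_on[of \<Omega>] by measurable
  have null: "{x \<in> space L. x \<bullet> i = c} \<in> null_sets L" "{x \<in> space L. - (x \<bullet> i) = c} \<in> null_sets L" for c
  proof -
    show "{x \<in> space L. x \<bullet> i = c} \<in> null_sets L" by (rule hyperplane_null[OF i])
    have "{x \<in> space L. - (x \<bullet> i) = c} = {x \<in> space L. x \<bullet> i = - c}" by auto
    then show "{x \<in> space L. - (x \<bullet> i) = c} \<in> null_sets L" using hyperplane_null[OF i, of "- c"] by simp
  qed
  obtain V1 G1 where V1: "V1 \<in> R" "AE x in L. x \<in> G1"
    "\<And>x y. x \<in> G1 \<Longrightarrow> y \<in> G1 \<Longrightarrow> lex_less (\<lambda>x. \<bar>u x\<bar> powr p) (\<lambda>x. x \<bullet> i) x y \<Longrightarrow> V1 y \<le> V1 x"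
    "\<And>V'. V' \<in> R \<Longrightarrow> (LINT x|L. V1 x * \<bar>u x\<bar> powr p) \<le> (LINT x|L. V' x * \<bar>u x\<bar> powr p)"
    by (rule optimal_rearrangement[OF u(1) \<tau>(1) null(1)], rule that)
  obtain V2 G2 where V2: "V2 \<in> R" "AE x in L. x \<in> G2"
    "\<And>x y. x \<in> G2 \<Longrightarrow> y \<in> G2 \<Longrightarrow> lex_less (\<lambda>x. \<bar>u x\<bar> powr p) (\<lambda>x. - (x \<bullet> i)) x y \<Longrightarrow> V2 y \<le> V2 x"
    "\<And>V'. V' \<in> R \<Longrightarrow> (LINT x|L. V2 x * \<bar>u x\<bar> powr p) \<le> (LINT x|L. V' x * \<bar>u x\<bar> powr p)"
    by (rule optimal_rearrangement[OF u(1) \<tau>(2) null(2)], rule that)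
  have J1: "J V1 u = \<mu>" and J2: "J V2 u = \<mu>" using opt[OF V1(1,4)] opt[OF V2(1,4)] by auto
  have l1: "lam V1 = \<mu>" and l2: "lam V2 = \<mu>" using lam_opt V1(1) V2(1) J1 J2 by auto
  have min1: "J V1 u = lam V1 * mass u" and min2: "J V2 u = lam V2 * mass u" using J1 J2 l1 l2 u(2) by auto
  have pos: "AE x in lebesgue. x \<in> \<Omega> \<longrightarrow> 0 < u x"
    by (rule minimizer_positive[OF V1(1) u(1) min1 u(3)]) (use u(2) in simp)
  have posL: "AE x in L. 0 < u x" using pos by (subst AE_restrict_space_iff) auto
  have eig: "is_positive_first_eigenfunction s p \<Omega> V1 u"
    unfolding is_positive_first_eigenfunction_def is_eigenfunction_def
  proof (intro conjI ballI)
    show "\<not> (AE x in lebesgue. u x = 0)"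
    proof
      assume "AE x in lebesgue. u x = 0"
      then have "mass u = 0" by (intro integral_eq_zero_AE) (auto elim!: eventually_mono)
      then show False using u(2) by simp
    qed
    show "Lp_norm p UNIV u = 1" using u(2) by (simp add: Lp_norm_UNIV_eq_1_iff[OF p_pos])
  qed (use u(1) posL Euler_Lagrange[OF V1(1) u(1) min1] in auto)
  have unique: "AE x in lebesgue. w x = u x" if w: "is_positive_first_eigenfunction s p \<Omega> V1 w" for w
  proof -
    have wW: "w \<in> W" and mw: "mass w = 1" and wpos: "AE x in L. 0 < w x"
      and eq: "H_form s p w w + (LINT x|L. V1 x * \<bar>w x\<bar> powr (p - 2) * w x * w x)
        = lam V1 * (LINT x|lebesgue. \<bar>w x\<bar> powr (p - 2) * w x * w x)"
      using w by (auto simp: is_positive_first_eigenfunction_def is_eigenfunction_def Lp_norm_UNIV_eq_1_iff[OF p_pos])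
    have pw: "c * \<bar>d\<bar> powr (p - 2) * d * d = c * \<bar>d\<bar> powr p" for c d :: real
      using abs_powr_mult_mult[of d p] by (simp add: mult.assoc)
    have "J V1 w = lam V1 * mass w"
      using eq unfolding J_def H_form_self abs_powr_mult_mult pw .
    moreover have "AE x in lebesgue. 0 \<le> w x"
    proof -
      have "AE x in lebesgue. x \<in> \<Omega> \<longrightarrow> 0 < w x" using wpos by (subst (asm) AE_restrict_space_iff) auto
      then show ?thesis
      proof eventually_elim
        case (elim x)
        then show ?case using W_zero_outside[OF wW, of x] by (cases "x \<in> \<Omega>") auto
      qed
    qed
    ultimately show ?thesis
      using minimizers_unique[OF V1(1) u(1) min1 wW] u(2,3) mw by simp
  qed
  have V12: "AE x in L. V1 x = V2 x"
    by (rule optimal_potentials_equal[OF V1(1) V2(1) u(1) min1 min2 _ pos]) (simp add: l1 l2)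
  define G where "G = {x \<in> G1 \<inter> G2 \<inter> \<Omega>. V1 x = V2 x}"
  have AEG: "AE x in L. x \<in> G"
    using V1(2) V2(2) V12 AE_space by eventually_elim (simp add: G_def)
  have "\<exists>\<phi> :: real \<Rightarrow> ereal. antimono \<phi> \<and> (AE x in L. ereal (V1 x) = \<phi> (\<bar>u x\<bar> powr p))"
  proof (rule fL.antitone_factorization[where G = G and V' = V2 and \<tau> = "\<lambda>x. x \<bullet> i", OF null(1) AEG])
    fix x y assume xy: "x \<in> G" "y \<in> G"
    show "V1 y \<le> V1 x" if "lex_less (\<lambda>x. \<bar>u x\<bar> powr p) (\<lambda>x. x \<bullet> i) x y"
      using V1(3)[OF _ _ that] xy by (simp add: G_def)
    show "V2 y \<le> V2 x" if "lex_less (\<lambda>x. \<bar>u x\<bar> powr p) (\<lambda>x. - (x \<bullet> i)) x y"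
      using V2(3)[OF _ _ that] xy by (simp add: G_def)
  qed (auto simp: G_def)
  moreover have "\<forall>V\<in>R. lam V1 \<le> lam V" using \<mu>_lam l1 by simp
  ultimately show ?thesis using V1(1) eig unique by blast
qed

end

theorem theorem5p6:
  fixes \<Omega> :: "'a::euclidean_space set" and V0 :: "'a \<Rightarrow> real" and s p q :: real
  assumes "0 < s" and "s < 1" and "1 < p"
    and "\<Omega> \<noteq> {}" and "bounded \<Omega>" and "extension_domain s p \<Omega>"
    and "1 < q" and "real DIM('a) / (s * p) < q"
    and "V0 \<in> Lp_space q \<Omega>"
  shows "\<exists>V1\<in>rearrangements \<Omega> V0.
    (\<forall>V\<in>rearrangements \<Omega> V0. first_eigenvalue s p \<Omega> V1 \<le> first_eigenvalue s p \<Omega> V) \<and>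
    (\<exists>u. is_positive_first_eigenfunction s p \<Omega> V1 u \<and>
      (\<forall>w. is_positive_first_eigenfunction s p \<Omega> V1 w \<longrightarrow> (AE x in lebesgue. w x = u x)) \<and>
      (\<exists>\<phi> :: real \<Rightarrow> ereal. antimono \<phi> \<and>
        (AE x in lebesgue_on \<Omega>. ereal (V1 x) = \<phi> (\<bar>u x\<bar> powr p))))"
proof -
  have "open \<Omega>" using assms(6) by (simp add: extension_domain_def)
  then interpret schroedinger s p q \<Omega> V0
    by unfold_locales (use assms in auto)
  show ?thesis by (rule optimal_potential_exists)
qed

end
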